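(* Let $f$ be an odd prime. For a prime $p$ with $p\equiv 1 \pmod f$ let $G_p\subset \mathbb{F}_p^\times$ denote the (unique) subgroup of order $f$. Then, as $p\to\infty$ through primes with $p\equiv 1\pmod f$, \[ \frac{1}{p-1}\sum_{t=1}^{p-1}\log\left|\sum_{g\in G_p} e^{2\pi\sqrt{-1}\,tg/p}\right| = m(1+X_1+\cdots+X_{f-1}) + O\!\left(p^{-\frac{1}{5(f-1)^2}}\right), \] where the implied constant depends only on $f$; in particular, the logarithm is well-defined (the inner sums are non-zero) for all sufficiently large such $p$.
   Context: For $t\in\mathbb{F}_p$ the expression $e^{2\pi\sqrt{-1}\,tg/p}$ is well defined. For a non-zero Laurent polynomial $P\in\mathbb{C}[X_1^{\pm1},\ldots,X_n^{\pm1}]$ its logarithmic Mahler measure is $m(P)=\int_0^1\cdots\int_0^1\log|P(e^{2\pi\sqrt{-1}x_1},\ldots,e^{2\pi\sqrt{-1}x_n})|\,dx_1\cdots dx_n$. *)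

theory Defs
  imports
    "HOL-Analysis.Analysis"
    "HOL-Library.Poly_Mapping"
    "HOL-Library.Landau_Symbols"
    "HOL-Number_Theory.Residues"
    "HOL-Algebra.Multiplicative_Group"
begin

(* Complex Laurent polynomials in variables indexed by nat: the group algebra of the finitely
   supported exponent vectors, multiplication being the convolution of Poly_Mapping. *)
type_synonym laurent_mpoly = "(nat \<Rightarrow>\<^sub>0 int) \<Rightarrow>\<^sub>0 complex"

definition lvar :: "nat \<Rightarrow> laurent_mpoly" where
  "lvar i = Poly_Mapping.single (Poly_Mapping.single i 1) 1"

definition leval :: "laurent_mpoly \<Rightarrow> (nat \<Rightarrow> complex) \<Rightarrow> complex" where
  "leval P z = (\<Sum>e\<in>Poly_Mapping.keys P.
     Poly_Mapping.lookup P e * (\<Prod>i\<in>Poly_Mapping.keys e. z i powi Poly_Mapping.lookup e i))"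

(* Meant for non-zero P in the variables 1, ..., n only. The zeros of such a P on the torus form a
   null set, so the convention ln 0 = 0 does not matter. *)
definition log_mahler :: "nat \<Rightarrow> laurent_mpoly \<Rightarrow> real" where
  "log_mahler n P =
     (LINT x:(\<Pi>\<^sub>E i\<in>{1..n}. {0..1})|(\<Pi>\<^sub>M i\<in>{1..n}. (lborel :: real measure)).
        ln (cmod (leval P (\<lambda>i. exp (2 * complex_of_real pi * \<i> * complex_of_real (x i))))))"

(* residue_ring represents the elements of F_p by the integers 0, ..., p - 1. *)
definition order_subgroup :: "nat \<Rightarrow> nat \<Rightarrow> int set" where
  "order_subgroup f p =
     (THE H. subgroup H (units_of (residue_ring (int p))) \<and> card H = f)"

definition gaussian_period :: "nat \<Rightarrow> nat \<Rightarrow> nat \<Rightarrow> complex" where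
  "gaussian_period f p t =
     (\<Sum>g\<in>order_subgroup f p.
        exp (2 * complex_of_real pi * \<i> * of_nat t * of_int g / of_nat p))"

definition at_top_primes_1_mod :: "nat \<Rightarrow> nat filter" where
  "at_top_primes_1_mod f = inf at_top (principal {p. prime p \<and> [p = 1] (mod f)})"

lemma ex1_order_subgroup:
  assumes p: "prime p" and cong: "[p = 1] (mod f)"
  shows "\<exists>!H. subgroup H (units_of (residue_ring (int p))) \<and> card H = f"
proof -
  interpret R: residues_prime p "residue_ring (int p)"
    by (simp add: residues_prime_def p)
  let ?R = "residue_ring (int p)"
  let ?G = "mult_of ?R"
  interpret G: group ?G by (rule R.field_mult_group)
  have finR: "finite (carrier ?R)" by (simp add: R.res_carrier_eq)
  have finG: "finite (carrier ?G)" using finR by (rule R.finite_mult_of)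
  have ordG: "order ?G = p - 1"
    using R.order_mult_of[OF finR] by (simp add: order_def R.res_carrier_eq)
  have p1: "p > 1" using p by (rule prime_gt_1_nat)
  have dvd: "f dvd p - 1"
    using cong p1 by (simp add: cong_altdef_nat)
  then obtain k where k: "p - 1 = f * k" by (elim dvdE)
  have fpos: "f > 0" and kpos: "k > 0" using k p1 by (auto intro!: Nat.gr0I)
  obtain a where a: "a \<in> carrier ?G"
    and a_gen: "carrier ?G = {a [^]\<^bsub>?R\<^esub> i | i::nat. i \<in> UNIV}"
    using R.finite_field_mult_group_has_gen[OF finR] by auto
  have "G.ord a = p - 1"
  proof -
    have "generate ?G {a} = carrier ?G"
      using G.generate_pow_nat[OF a] a_gen G.ord_ge_1[OF finG a]
      by (auto simp: nat_pow_mult_of)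
    then show ?thesis using G.generate_pow_card[OF a] ordG by (simp add: order_def)
  qed
  then have "G.ord (a [^]\<^bsub>?G\<^esub> k) = f"
    using G.ord_pow[OF a, of k] k kpos by simp
  moreover have ak: "a [^]\<^bsub>?G\<^esub> k \<in> carrier ?G" using a by (rule G.nat_pow_closed)
  ultimately have ex: "subgroup (generate ?G {a [^]\<^bsub>?G\<^esub> k}) ?G
      \<and> card (generate ?G {a [^]\<^bsub>?G\<^esub> k}) = f"
    using G.generate_pow_card[OF ak] G.generate_is_subgroup[of "{a [^]\<^bsub>?G\<^esub> k}"] by simp
  let ?S = "{x \<in> carrier ?R. x [^]\<^bsub>?R\<^esub> f = \<one>\<^bsub>?R\<^esub>}"
  have uniq: "H = ?S" if H: "subgroup H ?G" "card H = f" for H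
  proof (rule card_seteq)
    show "finite ?S" using finR by simp
    show "H \<subseteq> ?S"
    proof
      fix x assume x: "x \<in> H"
      interpret H: group "?G\<lparr>carrier := H\<rparr>"
        using H(1) G.is_group by (rule subgroup.subgroup_is_group)
      have "x [^]\<^bsub>?G\<lparr>carrier := H\<rparr>\<^esub> order (?G\<lparr>carrier := H\<rparr>) = \<one>\<^bsub>?G\<lparr>carrier := H\<rparr>\<^esub>"
        using x by (intro H.pow_order_eq_1) simp
      then have "x [^]\<^bsub>?G\<^esub> f = \<one>\<^bsub>?G\<^esub>"
        using H(2) G.nat_pow_consistent[of x f H] by (simp add: order_def)
      moreover have "x \<in> carrier ?G" using subgroup.mem_carrier[OF H(1) x] .
      ultimately show "x \<in> ?S" by (simp add: nat_pow_mult_of)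
    qed
    show "card ?S \<le> card H" using R.num_roots_le_deg[OF finR, of f] fpos H(2) by simp
  qed
  from ex uniq show ?thesis unfolding R.mult_of_is_Units by blast
qed

lemma order_subgroup:
  assumes "prime p" and "[p = 1] (mod f)"
  shows "subgroup (order_subgroup f p) (units_of (residue_ring (int p)))"
    and "card (order_subgroup f p) = f"
  using theI'[OF ex1_order_subgroup[OF assms]] unfolding order_subgroup_def by auto

end

theory Submission
  imports
    Defs
    "HOL-Number_Theory.Pocklington"
    "HOL-Analysis.Kronecker_Approximation_Theorem"
    "HOL-Probability.Probability_Measure"
    "HOL-Real_Asymp.Real_Asymp"
    "Subresultants.Subresultant_Gcd"
    "Berlekamp_Zassenhaus.Mahler_Measure"
begin

text \<open>
  Dividing a period by the term of the identity element gives the value of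
  \<open>P = 1 + X\<^sub>1 + \<dots> + X\<^bsub>f-1\<^esub>\<close> at the point with coordinates
  \<open>exp (2\<pi>\<i> t(g\<^sup>i - 1)/p)\<close>, where \<open>g\<close> generates \<open>G\<^sub>p\<close>. Since \<open>f\<close> is prime, a norm from
  \<open>\<int>[\<zeta>\<^sub>f]\<close> shows that every nontrivial integer relation modulo \<open>p\<close> between the numbers
  \<open>g\<^sup>i - 1\<close> has a coefficient of size at least \<open>c p\<^bsup>1/(f-1)\<^esup>\<close>. Hence the average over \<open>t\<close> of a
  trigonometric polynomial of smaller degree equals its integral. This is applied to the powers \<open>v\<^sup>k\<close> of
  \<open>v = 1 - \<bar>P\<bar>\<^sup>2/f\<^sup>2\<close>, as \<open>- log (1 - v) = \<Sum> v\<^sup>k/k\<close>; the tail of the series is negligible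
  except at those \<open>t\<close> for which the period is smaller than a fixed power of \<open>1/p\<close>.

  For these \<open>t\<close> one chooses \<open>q\<close> such that all but one of the exponents of the period of \<open>tq\<close> are small up to
  a common shift. The period is then \<open>\<eta> + Q(\<xi>)\<close> with \<open>p\<close>-th roots of unity \<open>\<xi>\<close>, \<open>\<eta>\<close> and \<open>Q\<close> of degree
  about \<open>p\<^bsup>1-1/(f-2)\<^esup>\<close>. If it is small, then so is \<open>R(\<xi>) = \<xi>\<^sup>D (\<bar>Q(\<xi>)\<bar>\<^sup>2 - 1)\<close>, and, as \<open>R\<close> has few
  terms, \<open>\<xi>\<close> is close to a root \<open>\<alpha>\<close> of \<open>R\<close>. A relation \<open>\<eta>\<^sup>m \<xi>\<^sup>n = 1\<close> gives a second polynomial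
  \<open>T = (- Q)\<^sup>m X\<^sup>n - 1\<close> that is small at \<open>\<alpha>\<close>. Since the resultant of \<open>R\<close> and \<open>T\<close> is a nonzero
  integer, the sum of \<open>- log \<bar>T(\<alpha>)\<bar>\<close> over these \<open>t\<close> is at most of the order of \<open>m D + n\<close>, which
  can be kept below \<open>p\<^bsup>1-1/((f-1)(f-2))\<^esup>\<close>.
\<close>

text \<open>The logarithm is unbounded, so equidistribution alone does not control the average. That
  the norm of a period is a nonzero integer bounds the sum of -log over the small periods only by
  O(p), which is the order of the main term. What saves a power of p is that the resultant of R and
  T has logarithm of order m D + n, up to log p, instead of p. The sizes come from a balance.
  Approximating only f-2 exponents makes D of order p^(1-1/(f-2)). Since the norm bound excludes
  short relations, the lattice of pairs (m, n) has a basis with m up to order p^(1/(f-1)) and n up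
  to order p^(1-1/((f-1)(f-2))), and then m D has the same order as n. The series is cut at N of
  order p^(1/(f-1)), the limit of exact averaging. This leaves errors of order p^(-1/(6(f-1))) and
  p^(-1/(3(f-1))) log p, next to p^(-1/((f-1)(f-2))) log p from the small periods; for f >= 3 all of
  them are O(p^(-1/(5(f-1)^2))).\<close>

hide_const (open) Module.smult UnivPoly.monom UnivPoly.coeff comm_monoid_mult_class.coprime

subsection \<open>Norms of integer polynomials\<close>

text \<open>Newton rather than Lagrange form, since R may have repeated complex roots: the
  triangular matrix then still has the values T(a), for a in \<open>as\<close>, on its diagonal with
  multiplicity.\<close>

definition newton_basis :: "complex list \<Rightarrow> nat \<Rightarrow> complex poly" where
  "newton_basis as k = (\<Prod>i<k. [:- (as ! i), 1:])"

lemma newton_basis_Suc: "newton_basis as (Suc k) = newton_basis as k * [:- (as ! k), 1:]"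
  by (simp add: newton_basis_def mult.commute)

lemma monic_newton_basis: "monic (newton_basis as k)" and degree_newton_basis: "degree (newton_basis as k) = k"
proof -
  show "monic (newton_basis as k)" unfolding newton_basis_def by (intro monic_prod) auto
  show "degree (newton_basis as k) = k"
    unfolding newton_basis_def by (subst degree_prod_eq_sum_degree) auto
qed

text \<open>Divided differences: subtracting the value at node m leaves a multiple of X -
  \<open>as ! m\<close>, which is passed on to the next basis polynomial. The first coefficient
  \<open>l m\<close> becomes a diagonal entry of the triangular matrix in
  \<open>prod_roots_int\<close>.\<close>

lemma newton_expansion:
  assumes "m < n" "degree (w * newton_basis as m) < n"
  shows "\<exists>l. l m = poly w (as ! m) \<and>
    w * newton_basis as m = (\<Sum>i\<in>{m..<n}. smult (l i) (newton_basis as i))"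
  using assms
proof (induction "n - m" arbitrary: m w)
  case 0
  then show ?case by simp
next
  case (Suc k)
  let ?u = "newton_basis as"
  define c where "c = poly w (as ! m)"
  have "poly (w - [:c:]) (as ! m) = 0" by (simp add: c_def)
  then obtain w' where w': "w - [:c:] = [:- (as ! m), 1:] * w'"
    unfolding poly_eq_0_iff_dvd by blast
  then have "w = [:c:] + [:- (as ! m), 1:] * w'" by (simp add: algebra_simps)
  then have split: "w * ?u m = smult c (?u m) + w' * ?u (Suc m)"
    by (simp only: newton_basis_Suc ring_distribs mult.assoc mult.commute mult.left_commute) simp
  have "w' * ?u (Suc m) = w * ?u m - smult c (?u m)" using split by simp
  moreover have "degree (w * ?u m - smult c (?u m)) < n"
    using Suc.prems degree_smult_le[of c "?u m"] by (intro degree_diff_less) (auto simp: degree_newton_basis)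
  ultimately have deg: "degree (w' * ?u (Suc m)) < n" by simp
  show ?case
  proof (cases "Suc m < n")
    case True
    then obtain l where l: "w' * ?u (Suc m) = (\<Sum>i\<in>{Suc m..<n}. smult (l i) (?u i))"
      using Suc.hyps(1)[of "Suc m" w'] Suc.hyps(2) deg by (metis Suc_diff_Suc Suc.prems(1) diff_Suc_Suc nat.inject)
    have "w * ?u m = (\<Sum>i\<in>{m..<n}. smult ((l(m := c)) i) (?u i))"
      using Suc.prems(1) by (simp add: sum.atLeast_Suc_lessThan split l)
    then show ?thesis by (intro exI[of _ "l(m := c)"]) (simp add: c_def)
  next
    case False
    with Suc.prems have n: "n = Suc m" by simp
    have "w' = 0"
    proof (rule ccontr)
      assume "w' \<noteq> 0"
      moreover have "?u (Suc m) \<noteq> 0" using monic_newton_basis[of as "Suc m"] by auto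
      ultimately have "degree (w' * ?u (Suc m)) = degree w' + Suc m"
        by (simp add: degree_mult_eq degree_newton_basis)
      with deg n show False by simp
    qed
    then show ?thesis using n split by (intro exI[of _ "\<lambda>_. c"]) (simp add: c_def)
  qed
qed

abbreviation cpoly :: "int poly \<Rightarrow> complex \<Rightarrow> complex" where
  "cpoly F \<equiv> poly (map_poly of_int F)"

text \<open>The product is the determinant of multiplication by \<open>T\<close> on \<open>\<int>[X]/(R)\<close>, because that map
  is triangular in the Newton basis. Modulo \<open>p\<close> the vector \<open>(1, g, g\<^sup>2, \<dots>)\<close> is a
  left eigenvector of its matrix with eigenvalue \<open>T(g)\<close>.\<close>

lemma prod_roots_int:
  fixes R T :: "int poly" and as :: "complex list"
  assumes "monic R" and deg: "degree R > 0"
    and roots: "(\<Prod>a\<leftarrow>as. [:- a, 1:]) = map_poly of_int R"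
  shows "\<exists>N. of_int N = (\<Prod>a\<leftarrow>as. cpoly T a) \<and>
    (\<forall>p g. p dvd poly R g \<longrightarrow> p dvd poly T g \<longrightarrow> p dvd N)"
proof -
  define n where "n = degree R"
  let ?u = "newton_basis as"
  let ?c = "map_poly (of_int :: int \<Rightarrow> complex)"
  have un: "?u (length as) = ?c R"
    by (simp add: newton_basis_def flip: roots)
       (simp add: prod.list_conv_set_nth atLeast0LessThan)
  have len: "length as = n"
    using arg_cong[OF un, of degree] by (simp add: degree_newton_basis n_def)
  have R0: "R \<noteq> 0" using deg by auto
  \<comment> \<open>As R is monic, pseudo-division multiplies by 1, so it is division with integral
    remainder.\<close>
  have "\<exists>q r. T * monom 1 j = R * q + r \<and> degree r < n" for j
  proof -
    obtain q r where qr: "pseudo_divmod (T * monom 1 j) R = (q, r)" by fastforce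
    from pseudo_divmod[OF R0 this] have "T * monom 1 j = R * q + r" "degree r < n"
      using assms(1) deg by (auto simp: n_def)
    then show ?thesis by blast
  qed
  then obtain q r where qr: "\<And>j. T * monom 1 j = R * q j + r j" "\<And>j. degree (r j) < n" by metis
  define M where "M = mat n n (\<lambda>(i,j). coeff (r j) i)"
  have Mc: "M \<in> carrier_mat n n" by (simp add: M_def)
  define MC where "MC = map_mat (of_int :: int \<Rightarrow> complex) M"
  have MCc: "MC \<in> carrier_mat n n" using Mc by (simp add: MC_def)
  define U where "U = mat n n (\<lambda>(i,k). coeff (?u k) i)"
  have Uc: "U \<in> carrier_mat n n" by (simp add: U_def)
  define Q where "Q k = (\<Sum>j<n. smult (coeff (?u k) j) (?c (q j)))" for k
  define s where "s k = (\<Sum>j<n. smult (coeff (?u k) j) (?c (r j)))" for k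
  have u_sum: "?u k = (\<Sum>j<n. smult (coeff (?u k) j) (monom 1 j))" if "k < n" for k
  proof -
    have "?u k = (\<Sum>j\<le>degree (?u k). monom (coeff (?u k) j) j)" by (rule poly_as_sum_of_monoms[symmetric])
    also have "\<dots> = (\<Sum>j<n. monom (coeff (?u k) j) j)"
      by (rule sum.mono_neutral_left) (use that in \<open>auto simp: degree_newton_basis intro!: coeff_eq_0\<close>)
    finally show ?thesis by (simp add: smult_monom)
  qed
  have s_eq: "s k = ?c T * ?u k - ?c R * Q k" if "k < n" for k
  proof -
    have "?c T * ?u k = (\<Sum>j<n. smult (coeff (?u k) j) (?c T * monom 1 j))"
      by (subst u_sum[OF that]) (simp add: sum_distrib_left)
    also have "\<dots> = (\<Sum>j<n. smult (coeff (?u k) j) (?c R * ?c (q j) + ?c (r j)))"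
    proof (intro sum.cong refl arg_cong2[where f = smult])
      fix j
      have "?c (T * monom 1 j) = ?c (R * q j + r j)" by (simp add: qr)
      then show "?c T * monom 1 j = ?c R * ?c (q j) + ?c (r j)"
        by (simp add: of_int_poly_hom.hom_mult of_int_poly_hom.hom_add)
    qed
    also have "\<dots> = ?c R * Q k + s k"
      by (simp add: Q_def s_def smult_add_right sum.distrib sum_distrib_left)
    finally show ?thesis by simp
  qed
  have deg_s: "degree (s k) < n" for k
    unfolding s_def using deg qr(2)
    by (intro degree_sum_less) (auto simp: n_def intro: le_less_trans[OF degree_smult_le])
  have "\<exists>l. l k = poly (?c T) (as ! k) \<and> s k = (\<Sum>i\<in>{k..<n}. smult (l i) (?u i))" if k: "k < n" for k
  proof -
    \<comment> \<open>\<open>W\<close> is the cofactor of \<open>newton_basis as k\<close> in R.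
      Thus \<open>s k\<close> is a multiple of \<open>newton_basis as k\<close>; the cofactor T - W
      Q takes the value T(a) at a = \<open>as ! k\<close>, because W vanishes there.\<close>
    define W where "W = (\<Prod>i\<in>{k..<n}. [:- (as ! i), 1:])"
    have R_W: "?c R = ?u k * W"
      unfolding un[symmetric] W_def newton_basis_def len using k
      by (subst prod.union_disjoint[symmetric]) (auto intro!: prod.cong)
    have "poly W (as ! k) = 0" unfolding W_def poly_prod using k by (auto intro!: prod_zero)
    moreover have "s k = (?c T - W * Q k) * ?u k"
      by (simp add: s_eq[OF k] R_W algebra_simps)
    ultimately show ?thesis
      using newton_expansion[OF k, of "?c T - W * Q k" as] deg_s[of k] by auto
  qed
  then obtain l where l: "\<And>k. k < n \<Longrightarrow> l k k = poly (?c T) (as ! k)"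
    "\<And>k. k < n \<Longrightarrow> s k = (\<Sum>i\<in>{k..<n}. smult (l k i) (?u i))" by metis
  define L where "L = mat n n (\<lambda>(i,k). if k \<le> i then l k i else 0)"
  have Lc: "L \<in> carrier_mat n n" by (simp add: L_def)
  have "MC * U = U * L"
  proof (rule eq_matI)
    show "dim_row (MC * U) = dim_row (U * L)" "dim_col (MC * U) = dim_col (U * L)"
      using MCc Uc Lc by auto
    fix i k assume "i < dim_row (U * L)" "k < dim_col (U * L)"
    then have i: "i < n" and k: "k < n" using Uc Lc by auto
    have "(MC * U) $$ (i, k) = coeff (s k) i"
      using i k by (simp add: MC_def M_def U_def scalar_prod_def s_def coeff_sum atLeast0LessThan mult.commute)
    also have "\<dots> = (\<Sum>j\<in>{k..<n}. l k j * coeff (?u j) i)"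
      by (simp add: l(2)[OF k] coeff_sum)
    also have "\<dots> = (\<Sum>j\<in>{0..<n}. coeff (?u j) i * (if k \<le> j then l k j else 0))"
      by (rule sum.mono_neutral_cong_left) auto
    also have "\<dots> = (U * L) $$ (i, k)"
      using i k by (simp add: L_def U_def scalar_prod_def)
    finally show "(MC * U) $$ (i, k) = (U * L) $$ (i, k)" .
  qed
  then have "det MC * det U = det U * det L"
    using det_mult[OF MCc Uc] det_mult[OF Uc Lc] by metis
  moreover have "det U = 1"
  proof -
    have "upper_triangular U"
      unfolding upper_triangular_def by (auto simp: U_def degree_newton_basis intro!: coeff_eq_0)
    then have "det U = prod_list (diag_mat U)" using Uc by (rule det_upper_triangular)
    also have "diag_mat U = map (\<lambda>_. 1) [0..<n]"
      using monic_newton_basis[of as] degree_newton_basis[of as] by (auto simp: diag_mat_def U_def)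
    also have "prod_list (map (\<lambda>_. 1 :: complex) [0..<n]) = 1" by (induction n) auto
    finally show ?thesis .
  qed
  moreover have "det L = (\<Prod>a\<leftarrow>as. poly (?c T) a)"
  proof -
    have "det L = prod_list (diag_mat L)"
      by (rule det_lower_triangular[OF _ Lc]) (auto simp: L_def)
    also have "diag_mat L = map (\<lambda>a. poly (?c T) a) as"
      by (rule nth_equalityI) (auto simp: diag_mat_def L_def l len)
    finally show ?thesis .
  qed
  ultimately have "of_int (det M) = (\<Prod>a\<leftarrow>as. poly (?c T) a)"
    by (simp add: MC_def)
  moreover have "p dvd det M" if "p dvd poly R g" "p dvd poly T g" for p g
  proof -
    have col: "p dvd (\<Sum>i<n. g ^ i * M $$ (i, j))" if j: "j < n" for j
    proof -
      have "(\<Sum>i<n. g ^ i * M $$ (i, j)) = (\<Sum>i<n. coeff (r j) i * g ^ i)"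
        using j by (intro sum.cong) (auto simp: M_def)
      also have "\<dots> = poly (r j) g"
        unfolding poly_altdef using qr(2)[of j]
        by (intro sum.mono_neutral_right) (auto intro: coeff_eq_0)
      also have "\<dots> = poly T g * g ^ j - poly R g * poly (q j) g"
        using arg_cong[OF qr(1), of "\<lambda>x. poly x g" j] by (simp add: poly_monom)
      finally show ?thesis using \<open>p dvd poly R g\<close> \<open>p dvd poly T g\<close> by simp
    qed
    have n0: "0 < n" using deg by (simp add: n_def)
    \<comment> \<open>Column 0 of the adjugate suffices: the row vector of the powers of g has first
      entry 1, so pairing its product with M against that column gives det M itself.\<close>
    have adj: "(\<Sum>j<n. M $$ (i, j) * adj_mat M $$ (j, 0)) = (if i = 0 then det M else 0)" if i: "i < n" for i
    proof -
      have "(M * adj_mat M) $$ (i, 0) = (det M \<cdot>\<^sub>m 1\<^sub>m n) $$ (i, 0)"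
        using adj_mat(2)[OF Mc] by simp
      then show ?thesis using i n0 Mc adj_mat(1)[OF Mc]
        by (auto simp: scalar_prod_def atLeast0LessThan)
    qed
    have "(\<Sum>j<n. (\<Sum>i<n. g ^ i * M $$ (i, j)) * adj_mat M $$ (j, 0))
        = (\<Sum>i<n. g ^ i * (\<Sum>j<n. M $$ (i, j) * adj_mat M $$ (j, 0)))"
      by (simp add: sum_distrib_left sum_distrib_right mult.assoc) (rule sum.swap)
    also have "\<dots> = (\<Sum>i<n. if i = 0 then det M else 0)"
      by (intro sum.cong) (auto simp: adj)
    also have "\<dots> = det M" using n0 by simp
    finally show ?thesis using col by (metis (no_types, lifting) dvd_sum dvd_mult2 lessThan_iff)
  qed
  ultimately show ?thesis by blast
qed

subsection \<open>Cyclotomic polynomials of prime index\<close>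

definition cyc_poly :: "nat \<Rightarrow> int poly" where
  "cyc_poly l = (\<Sum>i<l. monom 1 i)"

lemma poly_cyc_poly: "cpoly (cyc_poly l) (x :: complex) = (\<Sum>i<l. x ^ i)"
  by (simp add: cyc_poly_def of_int_poly_hom.hom_sum poly_sum poly_monom)

lemma poly_cyc_poly_int: "poly (cyc_poly l) x = (\<Sum>i<l. x ^ i)"
  by (simp add: cyc_poly_def poly_sum poly_monom)

lemma coeff_cyc_poly: "coeff (cyc_poly l) n = (if n < l then 1 else 0)"
  by (simp add: cyc_poly_def coeff_sum)

lemma degree_cyc_poly: "degree (cyc_poly l) = l - 1"
proof (cases l)
  case (Suc n)
  show ?thesis
    by (rule antisym[OF degree_le le_degree]) (auto simp: coeff_cyc_poly Suc)
qed (simp add: cyc_poly_def)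

lemma monic_cyc_poly: "l > 0 \<Longrightarrow> monic (cyc_poly l)"
  by (simp add: degree_cyc_poly coeff_cyc_poly)

lemma cyc_poly_root_iff:
  assumes "l > 0"
  shows "cpoly (cyc_poly l) (x :: complex) = 0 \<longleftrightarrow> x ^ l = 1 \<and> x \<noteq> 1"
  unfolding poly_cyc_poly using assms power_diff_1_eq[of x l] by (cases "x = 1") auto

lemma int_poly_roots_ex:
  fixes R :: "int poly"
  assumes "monic R"
  obtains as :: "complex list" where "(\<Prod>a\<leftarrow>as. [:- a, 1:]) = map_poly of_int R" "length as = degree R"
    "set as = {a. cpoly R a = 0}"
proof
  show *: "(\<Prod>a\<leftarrow>complex_roots_int R. [:- a, 1:]) = map_poly of_int R"
    using complex_roots_int(1)[of R] assms by simp
  show "length (complex_roots_int R) = degree R" by (rule complex_roots_int(2))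
  show "set (complex_roots_int R) = {a. cpoly R a = 0}"
    unfolding *[symmetric] by (auto simp: poly_prod_list prod_list_zero_iff)
qed

text \<open>Modulo \<open>l\<close> the polynomial \<open>(X - 1)\<^sup>l\<close> is \<open>X\<^sup>l - 1\<close>, so \<open>(b - 1)\<^sup>l\<close> is \<open>l\<close> times
  an element of \<open>\<int>[b]\<close> for each \<open>l\<close>-th root of unity \<open>b\<close>.\<close>

lemma prime_dvd_factor_at_1:
  fixes H :: "int poly"
  assumes l: "prime l" "odd l" and H: "monic H" "degree H > 0" "H dvd cyc_poly l"
  shows "int l dvd poly H 1"
proof -
  have l0: "l > 0" using l by (simp add: prime_gt_0_nat)
  define h :: "int poly" where "h = (\<Sum>k\<in>{0<..<l}. monom (int ((l choose k) div l) * (-1) ^ (l - k)) k)"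
  have h: "(b - 1) ^ l = of_nat l * cpoly h b" if b: "b ^ l = 1" for b :: complex
  proof -
    have "(b + (-1)) ^ l = (\<Sum>k\<le>l. of_nat (l choose k) * b ^ k * (-1) ^ (l - k))"
      by (rule binomial_ring)
    also have "{..l} = insert 0 (insert l {0<..<l})" using l0 by auto
    \<comment> \<open>Oddness of l makes the end terms b^l = 1 and (-1)^l cancel.\<close>
    also have "(\<Sum>k\<in>\<dots>. of_nat (l choose k) * b ^ k * (-1) ^ (l - k)) =
        (\<Sum>k\<in>{0<..<l}. of_nat (l choose k) * b ^ k * (-1) ^ (l - k))"
      using l0 l(2) b by simp
    also have "\<dots> = (\<Sum>k\<in>{0<..<l}. of_nat l * (of_int (int ((l choose k) div l) * (-1) ^ (l - k)) * b ^ k))"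
    proof (intro sum.cong refl)
      fix k assume "k \<in> {0<..<l}"
      then have "l dvd (l choose k)" using l(1) by (intro dvd_choose_prime) auto
      then have "l choose k = l * ((l choose k) div l)" by simp
      then have "(of_nat (l choose k) :: complex) = of_nat l * of_nat ((l choose k) div l)"
        by (metis of_nat_mult)
      then show "of_nat (l choose k) * b ^ k * (-1) ^ (l - k) =
          of_nat l * (of_int (int ((l choose k) div l) * (-1) ^ (l - k)) * b ^ k)"
        by simp
    qed
    also have "\<dots> = of_nat l * cpoly h b"
      by (simp add: h_def of_int_poly_hom.hom_sum poly_sum poly_monom sum_distrib_left)
    finally show ?thesis by simp
  qed
  obtain as where as: "(\<Prod>a\<leftarrow>as. [:- a, 1:]) = map_poly of_int H" "length as = degree H"
    "set as = {a. cpoly H a = 0}"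
    using int_poly_roots_ex[OF H(1)] by metis
  have roots: "a ^ l = 1" if "a \<in> set as" for a
  proof -
    obtain K where "cyc_poly l = H * K" using H(3) by (elim dvdE)
    then have "cpoly (cyc_poly l) a = 0"
      using that by (simp add: as(3) of_int_poly_hom.hom_mult)
    then show ?thesis using cyc_poly_root_iff[OF l0] by simp
  qed
  obtain N where N: "of_int N = (\<Prod>a\<leftarrow>as. cpoly h a)"
    using prod_roots_int[OF H(1,2) as(1), of h] by auto
  have "(-1) ^ degree H * of_int (poly H 1) = (\<Prod>a\<leftarrow>as. a - 1)"
  proof -
    have "of_int (poly H 1) = cpoly H (of_int 1)"
      by (simp only: of_int_hom.poly_map_poly)
    also have "\<dots> = (\<Prod>a\<leftarrow>as. 1 - a)" by (simp flip: as(1) add: poly_prod_list o_def)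
    also have "(-1) ^ degree H * \<dots> = (\<Prod>a\<leftarrow>as. a - 1)"
      unfolding as(2)[symmetric] by (induction as) (auto simp: algebra_simps)
    finally show ?thesis .
  qed
  \<comment> \<open>The l-th power of H(1) is, up to sign, l^(deg H) times the product of h over the
    roots of H, and that product is the integer \<open>N\<close>.\<close>
  then have "((-1) ^ degree H * of_int (poly H 1)) ^ l = (\<Prod>a\<leftarrow>as. a - 1) ^ l" by simp
  also have "\<dots> = (\<Prod>a\<leftarrow>as. (a - 1) ^ l)" by (induction as) (auto simp: power_mult_distrib)
  also have "\<dots> = (\<Prod>a\<leftarrow>as. of_nat l * cpoly h a)"
    by (intro arg_cong[of _ _ prod_list] map_cong refl h roots)
  also have "\<dots> = of_nat l ^ degree H * of_int N"
    unfolding N as(2)[symmetric] by (induction as) auto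
  finally have "of_int (((-1) ^ degree H * poly H 1) ^ l) = complex_of_int (int l ^ degree H * N)"
    by simp
  then have "((-1) ^ degree H * poly H 1) ^ l = int l ^ degree H * N" by (simp only: of_int_eq_iff)
  moreover have "int l dvd int l ^ degree H * N" using H(2) by (simp add: dvd_power)
  ultimately have "int l dvd ((-1) ^ degree H * poly H 1) ^ l" by simp
  then have "int l dvd (-1) ^ degree H * poly H 1"
    using l(1) by (metis prime_dvd_power prime_nat_int_transfer)
  then show ?thesis by (cases "even (degree H)") auto
qed

text \<open>Vanishing of the resultant is unaffected by the embedding of the integers into the
  complex numbers, so a common complex root already forces a nonconstant common factor over the
  integers.\<close>

lemma common_root_gcd:
  fixes F G :: "int poly" and a :: complex
  assumes "cpoly F a = 0" "cpoly G a = 0" "F \<noteq> 0 \<or> G \<noteq> 0"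
  shows "degree (gcd F G) > 0"
proof -
  let ?c = "map_poly complex_of_int"
  have "[:-a, 1:] dvd gcd (?c F) (?c G)"
    using assms by (auto simp: poly_eq_0_iff_dvd)
  moreover have "gcd (?c F) (?c G) \<noteq> 0" using assms(3) by auto
  ultimately have "degree (gcd (?c F) (?c G)) \<noteq> 0"
    using dvd_imp_degree_le[of "[:-a, 1:]" "gcd (?c F) (?c G)"] by auto
  then have "resultant (?c F) (?c G) = 0" by (simp add: resultant_0_gcd)
  then have "resultant F G = 0" by (simp add: of_int_hom.resultant_hom)
  then show ?thesis by (simp add: resultant_0_gcd)
qed

text \<open>The gcd of F and \<open>cyc_poly l\<close> divides a monic polynomial, so its leading
  coefficient is 1 or -1.\<close>

lemma cyc_common_factor:
  fixes F :: "int poly" and a :: complex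
  assumes l: "prime l" and a: "a ^ l = 1" "a \<noteq> 1" and F: "cpoly F a = 0"
  obtains H where "monic H" "degree H > 0" "H dvd cyc_poly l" "H dvd F"
proof -
  have l0: "l > 0" using l by (simp add: prime_gt_0_nat)
  define H where "H = gcd F (cyc_poly l)"
  have mon: "monic (cyc_poly l)" using monic_cyc_poly[OF l0] .
  then have nz: "cyc_poly l \<noteq> 0" by auto
  have deg: "degree H > 0" unfolding H_def
    using cyc_poly_root_iff[OF l0, of a] a F nz by (intro common_root_gcd[of _ a]) auto
  have dvd: "H dvd cyc_poly l" "H dvd F" by (auto simp: H_def)
  then obtain K where K: "cyc_poly l = H * K" by (elim dvdE)
  then have "lead_coeff H * lead_coeff K = 1" using mon by (simp add: lead_coeff_mult)
  then have "lead_coeff H = 1 \<or> lead_coeff H = -1" by (auto simp: zmult_eq_1_iff)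
  then show ?thesis
  proof
    assume "lead_coeff H = 1"
    with deg dvd show ?thesis by (intro that)
  next
    assume "lead_coeff H = -1"
    with deg dvd show ?thesis by (intro that[of "- H"]) auto
  qed
qed

text \<open>Elementary form of reduction modulo the prime above l in the l-th cyclotomic field,
  where all l-th roots of unity become 1.\<close>

lemma cyc_root_dvd:
  fixes F :: "int poly" and a :: complex
  assumes "prime l" "odd l" "a ^ l = 1" "a \<noteq> 1" "cpoly F a = 0"
  shows "int l dvd poly F 1"
proof -
  obtain H where "monic H" "degree H > 0" "H dvd cyc_poly l" "H dvd F"
    using cyc_common_factor[OF assms(1,3-5)] .
  then have "int l dvd poly H 1" "poly H 1 dvd poly F 1"
    using prime_dvd_factor_at_1[OF assms(1,2)] by (auto elim!: dvdE)
  then show ?thesis by (rule dvd_trans)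
qed

text \<open>Irreducibility of \<open>cyc_poly l\<close> in the form needed: for smaller degree the
  common factor H and its cofactor K would both be monic and nonconstant, so l would divide H(1) and
  K(1), and l^2 would divide their product, which is l.\<close>

lemma cyc_root_degree:
  fixes F :: "int poly" and a :: complex
  assumes "prime l" "odd l" "a ^ l = 1" "a \<noteq> 1" "cpoly F a = 0" "F \<noteq> 0"
  shows "l - 1 \<le> degree F"
proof (rule ccontr)
  assume less: "\<not> l - 1 \<le> degree F"
  obtain H where H: "monic H" "degree H > 0" "H dvd cyc_poly l" "H dvd F"
    using cyc_common_factor[OF assms(1,3-5)] .
  obtain K where K: "cyc_poly l = H * K" using H(3) by (elim dvdE)
  have l0: "l > 1" using assms(1) by (rule prime_gt_1_nat)
  have nz: "cyc_poly l \<noteq> 0" using monic_cyc_poly[of l] l0 by auto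
  then have "H \<noteq> 0" "K \<noteq> 0" using K by auto
  then have "degree H + degree K = l - 1"
    using degree_mult_eq[of H K] K degree_cyc_poly[of l] by simp
  moreover have "degree H \<le> degree F" using H(4) assms(6) by (rule dvd_imp_degree_le)
  ultimately have "degree K > 0" using less by simp
  moreover have "monic K"
    using monic_cyc_poly[of l] l0 H(1) K by (simp add: lead_coeff_mult)
  moreover have "K dvd cyc_poly l" using K by simp
  ultimately have "int l dvd poly K 1" "int l dvd poly H 1"
    using prime_dvd_factor_at_1[OF assms(1,2)] H by auto
  then have "int l * int l dvd poly (cyc_poly l) 1" unfolding K by (simp add: mult_dvd_mono)
  then have "l * l dvd l" by (simp add: poly_cyc_poly_int flip: of_nat_mult)
  then show False using l0 by (auto dest: dvd_imp_le)
qed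

subsection \<open>Linear relations modulo a prime\<close>

lemma prod_list_le_power:
  fixes h :: "'a \<Rightarrow> real"
  assumes "\<And>a. a \<in> set as \<Longrightarrow> 0 \<le> h a \<and> h a \<le> c"
  shows "(\<Prod>a\<leftarrow>as. h a) \<le> c ^ length as"
  using assms
proof (induction as)
  case (Cons a as)
  have "(\<Prod>a\<leftarrow>as. h a) \<ge> 0" using Cons.prems by (intro prod_list_nonneg) auto
  then show ?case using Cons by (auto intro!: mult_mono intro: order_trans)
qed simp

locale period_setup =
  fixes f p g :: nat
  assumes prime_f: "prime f" and odd_f: "odd f" and prime_p: "prime p"
    and g_pow: "[g ^ f = 1] (mod p)" and g_neq: "\<not> [g = 1] (mod p)"
begin

lemma f_ge_3: "f \<ge> 3"
  using prime_ge_2_nat[OF prime_f] odd_f by (cases "f = 2") auto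

lemma coprime_g: "coprime p g"
proof -
  have "\<not> p dvd g"
  proof
    assume "p dvd g"
    then have "p dvd g ^ f" using f_ge_3 by (metis dvd_power dvd_trans less_le_trans zero_less_numeral)
    then have "p dvd 1" using g_pow cong_dvd_iff by blast
    then show False using prime_p by simp
  qed
  then show ?thesis using prime_p by (simp add: prime_imp_coprime)
qed

lemma ord_g: "ord p g = f"
proof -
  have "ord p g dvd f" using g_pow ord_divides by blast
  then have "ord p g = 1 \<or> ord p g = f" using prime_f by (simp add: prime_nat_iff)
  moreover have "ord p g \<noteq> 1" using g_neq ord[of g p] by auto
  ultimately show ?thesis by simp
qed

lemma g_pow_cong_iff: "[g ^ i = g ^ j] (mod p) \<longleftrightarrow> [i = j] (mod f)"
  using order_divides_expdiff[OF coprime_g, of i j] ord_g by simp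

lemma f_dvd: "f dvd p - 1"
  using order_divides_totient[of p g] coprime_g ord_g prime_p by (simp add: totient_prime coprime_commute)

lemma p_gt_f: "p > f"
proof -
  have "p - 1 > 0" using prime_gt_1_nat[OF prime_p] by simp
  then have "f \<le> p - 1" using f_dvd by (rule dvd_imp_le[rotated])
  then show ?thesis using f_ge_3 by linarith
qed

lemma odd_p: "odd p"
  using prime_odd_nat[OF prime_p] p_gt_f f_ge_3 by linarith

lemma not_dvd_g_minus_1: "\<not> int p dvd int g - 1"
  using g_neq by (metis cong_iff_dvd_diff cong_int_iff of_nat_1)

lemma dvd_cyc_poly: "int p dvd poly (cyc_poly f) (int g)"
proof -
  have "int p dvd int g ^ f - 1"
    using g_pow by (simp add: cong_iff_dvd_diff flip: cong_int_iff)
  also have "int g ^ f - 1 = (int g - 1) * poly (cyc_poly f) (int g)"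
    by (simp add: poly_cyc_poly_int power_diff_1_eq)
  finally show ?thesis
    using prime_p not_dvd_g_minus_1 by (simp add: prime_dvd_mult_iff)
qed

text \<open>With F the sum of the b i (X^i - 1), the norm of F(\<zeta>) is a multiple of p because g
  is a root of \<open>cyc_poly f\<close> modulo p. It is nonzero, and each of its f-1 factors is at
  most 2 f B in absolute value, since |\<zeta>^i - 1| <= 2.\<close>

lemma relation_lower_bound:
  fixes b :: "nat \<Rightarrow> int" and B :: nat
  assumes dvd: "int p dvd (\<Sum>i\<in>{1..<f}. b i * (int g ^ i - 1))"
    and B: "\<And>i. i \<in> {1..<f} \<Longrightarrow> \<bar>b i\<bar> \<le> int B"
    and nz: "i0 \<in> {1..<f}" "b i0 \<noteq> 0"
  shows "p \<le> (2 * f * B) ^ (f - 1)"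
proof -
  define F where "F = (\<Sum>i\<in>{1..<f}. smult (b i) (monom 1 i - 1))"
  have coeff_F: "coeff F j = b j" if "j \<in> {1..<f}" for j
  proof -
    have "coeff F j = (\<Sum>i\<in>{1..<f}. coeff (smult (b i) (monom 1 i - 1)) j)"
      unfolding F_def by (rule coeff_sum)
    also have "\<dots> = (\<Sum>i\<in>{1..<f}. if i = j then b i else 0)"
      using that by (intro sum.cong) auto
    also have "\<dots> = b j" using that by simp
    finally show ?thesis .
  qed
  have deg_F: "degree F < f"
    unfolding F_def using f_ge_3
    by (intro degree_sum_less le_less_trans[OF degree_smult_le])
       (auto intro!: degree_diff_less simp: degree_monom_eq)
  have F1: "poly F 1 = 0" by (simp add: F_def poly_sum poly_monom)
  have F0: "F \<noteq> 0" using coeff_F[OF nz(1)] nz(2) by auto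
  have roots: "cpoly F a \<noteq> 0" if a: "a ^ f = 1" "a \<noteq> 1" for a :: complex
  proof
    assume root: "cpoly F a = 0"
    \<comment> \<open>By irreducibility a root would make F the multiple c of
      \<open>cyc_poly f\<close>; then F(1) = 0 forces c = 0.\<close>
    define c where "c = coeff F (f - 1)"
    define G where "G = F - smult c (cyc_poly f)"
    have "cpoly G a = 0"
      using root a cyc_poly_root_iff[of f a] f_ge_3
      by (simp add: G_def of_int_poly_hom.hom_minus of_int_hom.map_poly_hom_smult)
    moreover have "degree G < f - 1"
    proof -
      have "coeff G (f - 1) = 0" using f_ge_3 by (simp add: G_def c_def coeff_cyc_poly)
      moreover have "degree G \<le> f - 1"
        unfolding G_def using deg_F degree_smult_le[of c "cyc_poly f"]
        by (intro degree_diff_le) (auto simp: degree_cyc_poly)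
      moreover have "degree G \<noteq> f - 1"
      proof
        assume eq: "degree G = f - 1"
        then have "G = 0" using \<open>coeff G (f - 1) = 0\<close> by (metis leading_coeff_0_iff)
        then show False using eq f_ge_3 by simp
      qed
      ultimately show ?thesis by simp
    qed
    ultimately have "G = 0" using cyc_root_degree[OF prime_f odd_f a] by fastforce
    then have "F = smult c (cyc_poly f)" by (simp add: G_def)
    then have "c * int f = 0" using F1 by (simp add: poly_cyc_poly_int)
    then have "c = 0" using f_ge_3 by simp
    then show False using \<open>F = smult c (cyc_poly f)\<close> F0 by simp
  qed
  have mon: "monic (cyc_poly f)" using f_ge_3 by (intro monic_cyc_poly) auto
  have dg: "degree (cyc_poly f) > 0" using f_ge_3 by (simp add: degree_cyc_poly)
  obtain as where as: "(\<Prod>a\<leftarrow>as. [:- a, 1:]) = map_poly of_int (cyc_poly f)" "length as = degree (cyc_poly f)"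
    "set as = {a. cpoly (cyc_poly f) a = 0}"
    using int_poly_roots_ex[OF mon] by metis
  have as_root: "a ^ f = 1" "a \<noteq> 1" if "a \<in> set as" for a
    using that cyc_poly_root_iff[of f a] f_ge_3 by (auto simp: as(3))
  obtain N where N: "of_int N = (\<Prod>a\<leftarrow>as. cpoly F a)"
    and N_dvd: "\<And>p g. p dvd poly (cyc_poly f) g \<Longrightarrow> p dvd poly F g \<Longrightarrow> p dvd N"
    using prod_roots_int[OF mon dg as(1), of F] by blast
  have "int p dvd poly F (int g)"
    using dvd by (simp add: F_def poly_sum poly_monom)
  then have "int p dvd N" using N_dvd dvd_cyc_poly by blast
  moreover have "N \<noteq> 0"
  proof
    assume "N = 0"
    then have "(\<Prod>a\<leftarrow>as. cpoly F a) = 0" using N by simp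
    then show False using roots as_root by (auto simp: prod_list_zero_iff)
  qed
  ultimately have "int p \<le> \<bar>N\<bar>" by (metis dvd_imp_le_int abs_of_nat)
  then have "real p \<le> \<bar>of_int N\<bar>" by linarith
  also have "\<dots> = cmod (of_int N)" by (simp add: norm_of_int)
  also have "\<dots> = (\<Prod>a\<leftarrow>as. cmod (cpoly F a))"
    unfolding N by (induction as) (auto simp: norm_mult)
  also have "\<dots> \<le> real (2 * f * B) ^ length as"
  proof (rule prod_list_le_power)
    fix a assume "a \<in> set as"
    then have "cmod a ^ f = 1" using as_root(1)[of a] by (metis norm_one norm_power)
    then have "cmod a = 1" using f_ge_3 power_eq_imp_eq_base[of "cmod a" f 1] by simp
    have "cmod (cpoly F a) = cmod (\<Sum>i\<in>{1..<f}. of_int (b i) * (a ^ i - 1))"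
      by (simp add: F_def of_int_poly_hom.hom_sum poly_sum poly_monom of_int_hom.map_poly_hom_smult
          of_int_poly_hom.hom_minus)
    also have "\<dots> \<le> (\<Sum>i\<in>{1..<f}. real B * 2)"
    proof (rule sum_norm_le)
      fix i assume "i \<in> {1..<f}"
      then have "\<bar>real_of_int (b i)\<bar> \<le> real B" using B[of i] by linarith
      moreover have "cmod (a ^ i - 1) \<le> 2"
        using norm_triangle_ineq4[of "a ^ i" 1] \<open>cmod a = 1\<close> by (simp add: norm_power)
      ultimately show "cmod (of_int (b i) * (a ^ i - 1)) \<le> real B * 2"
        by (simp add: norm_mult norm_of_int mult_mono)
    qed
    also have "\<dots> \<le> real (2 * f * B)" by (simp, intro mult_left_mono) auto
    finally show "0 \<le> cmod (cpoly F a) \<and> cmod (cpoly F a) \<le> real (2 * f * B)"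
      by simp
  qed
  also have "\<dots> = real (2 * f * B) ^ (f - 1)"
    using as(2) by (simp add: degree_cyc_poly)
  finally show ?thesis by (simp flip: of_nat_power of_nat_mult)
qed

end

subsection \<open>Lattices of relations\<close>

text \<open>Pigeonhole: with coefficients in 0..B the form takes at most 2 |I| X B + 1 values, fewer
  than there are coefficient vectors. The solution is the difference of two vectors with equal
  value.\<close>

lemma siegel_one_equation:
  fixes x :: "'a \<Rightarrow> int" and X B :: nat
  assumes I: "finite I" and X: "\<And>i. i \<in> I \<Longrightarrow> \<bar>x i\<bar> \<le> int X"
    and large: "2 * card I * X * B + 1 < (B + 1) ^ card I"
  obtains b where "\<And>i. i \<in> I \<Longrightarrow> \<bar>b i\<bar> \<le> int B" "\<exists>i\<in>I. b i \<noteq> 0" "(\<Sum>i\<in>I. b i * x i) = 0"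
proof -
  define A where "A = I \<rightarrow>\<^sub>E {0..int B}"
  define h where "h b = (\<Sum>i\<in>I. b i * x i)" for b
  have cardA: "card A = (B + 1) ^ card I" using I by (simp add: A_def card_PiE nat_add_distrib)
  have "h ` A \<subseteq> {- int (card I * X * B)..int (card I * X * B)}"
  proof clarify
    fix b assume b: "b \<in> A"
    have "\<bar>h b\<bar> \<le> (\<Sum>i\<in>I. \<bar>b i * x i\<bar>)" unfolding h_def by (rule sum_abs)
    also have "\<dots> \<le> (\<Sum>i\<in>I. int B * int X)"
      using b X by (intro sum_mono) (auto simp: abs_mult A_def PiE_iff intro!: mult_mono)
    finally show "h b \<in> {- int (card I * X * B)..int (card I * X * B)}"
      by (auto simp: abs_le_iff algebra_simps)
  qed
  then have "card (h ` A) \<le> card {- int (card I * X * B)..int (card I * X * B)}"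
    by (intro card_mono) auto
  also have "\<dots> = 2 * card I * X * B + 1" by (simp add: algebra_simps nat_add_distrib nat_mult_distrib)
  finally have "card (h ` A) < card A" using large cardA by simp
  then have "\<not> inj_on h A" by (rule pigeonhole)
  then obtain b c where bc: "b \<in> A" "c \<in> A" "h b = h c" "b \<noteq> c" by (auto simp: inj_on_def)
  show ?thesis
  proof (rule that[of "\<lambda>i. b i - c i"])
    show "\<bar>b i - c i\<bar> \<le> int B" if "i \<in> I" for i
    proof -
      have "b i \<in> {0..int B}" "c i \<in> {0..int B}" using bc that by (auto simp: A_def)
      then show ?thesis by auto
    qed
    show "\<exists>i\<in>I. b i - c i \<noteq> 0"
    proof (rule ccontr)
      assume "\<not> ?thesis"
      then have "b = c" using bc(1,2) unfolding A_def by (intro PiE_ext) auto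
      with bc(4) show False by simp
    qed
    show "(\<Sum>i\<in>I. (b i - c i) * x i) = 0"
      using bc(3) by (simp add: h_def left_diff_distrib sum_subtractf)
  qed
qed

lemma dirichlet_int:
  fixes v p :: int and M K :: nat
  assumes "p > 0" "M > 0" "p \<le> int M * (int K + 1)"
  obtains m n :: int where "1 \<le> m" "m \<le> int M" "\<bar>n\<bar> \<le> int K" "p dvd m * v + n"
proof -
  obtain h k :: int where hk: "0 < k" "k \<le> int M" "\<bar>of_int k * (of_int v / of_int p) - of_int h\<bar> < 1 / real M"
    by (rule Dirichlet_approx[OF assms(2), of "of_int v / of_int p"])
  have "\<bar>real_of_int (h * p - k * v)\<bar> = \<bar>of_int k * (of_int v / of_int p) - of_int h\<bar> * of_int p"
    using assms(1) by (simp add: abs_mult_pos' field_simps abs_minus_commute flip: abs_mult)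
  also have "\<dots> < 1 / real M * of_int p" using hk(3) assms(1) by (intro mult_strict_right_mono) auto
  also have "\<dots> \<le> real K + 1"
  proof -
    have "real_of_int p \<le> real_of_int (int M * (int K + 1))" using assms(3) by (simp only: of_int_le_iff)
    then show ?thesis using assms(2) by (simp add: field_simps)
  qed
  \<comment> \<open>An integer below K + 1 is at most K, which accounts for the shape
    \<open>p \<le> int M * (int K + 1)\<close> of the hypothesis.\<close>
  finally have "\<bar>h * p - k * v\<bar> \<le> int K" by linarith
  then show ?thesis using hk(1,2) by (intro that[of k "h * p - k * v"]) auto
qed

text \<open>(m1, n1) has the least positive m subject to |n| <= K2, and (m2, n2) the least |n| among
  nonzero vectors with 0 <= m < m1. Absence of short vectors gives m1 > K1, so Dirichlet with bound
  m1 - 1 yields |n2| <= L, while minimality of m1 yields |n2| > K2. Subtracting the nearest integer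
  combination of the two leaves a lattice vector with |m| < m1 and |n| < |n2|, which can only be
  0.\<close>

lemma lattice_small_basis:
  fixes p v :: int and K1 K2 M L :: nat
  assumes p: "p > 0"
    and no_short: "\<And>m n. p dvd m * v + n \<Longrightarrow> \<bar>m\<bar> \<le> int K1 \<Longrightarrow> \<bar>n\<bar> \<le> int K2 \<Longrightarrow> m = 0 \<and> n = 0"
    and K1: "K1 \<ge> 1" and K2: "int K2 < p"
    and M: "p \<le> int M * (int K2 + 1)" and L: "p \<le> int K1 * (int L + 1)"
  obtains m1 n1 m2 n2 :: int where "p dvd m1 * v + n1" "p dvd m2 * v + n2"
    "0 \<le> m1" "m1 \<le> int M" "0 \<le> m2" "m2 \<le> int M" "\<bar>n1\<bar> \<le> int K2" "\<bar>n2\<bar> \<le> int L"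
    "\<And>m n. p dvd m * v + n \<Longrightarrow> \<exists>a b. m = a * m1 + b * m2 \<and> n = a * n1 + b * n2"
proof -
  have M0: "M > 0" using M p by (cases "M = 0") auto
  define P where "P k \<longleftrightarrow> k > 0 \<and> (\<exists>n. \<bar>n\<bar> \<le> int K2 \<and> p dvd int k * v + n)" for k :: nat
  obtain m n where mn: "1 \<le> m" "m \<le> int M" "\<bar>n\<bar> \<le> int K2" "p dvd m * v + n"
    using dirichlet_int[OF p M0 M] by metis
  have "P (nat m)" using mn by (auto simp: P_def)
  define k1 where "k1 = (LEAST k. P k)"
  have Pk1: "P k1" unfolding k1_def by (rule LeastI) fact
  have k1_le: "k1 \<le> k" if "P k" for k unfolding k1_def using that by (rule Least_le)
  define m1 where "m1 = int k1"
  obtain n1 where n1: "\<bar>n1\<bar> \<le> int K2" "p dvd m1 * v + n1" using Pk1 by (auto simp: P_def m1_def)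
  have m1: "0 < m1" "m1 \<le> int M"
    using Pk1 k1_le[OF \<open>P (nat m)\<close>] mn by (auto simp: P_def m1_def)
  have m1_K1: "m1 > int K1" using no_short[OF n1(2)] n1(1) m1 by force
  define Q where "Q k \<longleftrightarrow> (\<exists>m n. 0 \<le> m \<and> m < m1 \<and> (m \<noteq> 0 \<or> n \<noteq> 0) \<and> \<bar>n\<bar> = int k \<and> p dvd m * v + n)" for k :: nat
  have "p \<le> int (k1 - 1) * (int L + 1)"
  proof -
    have "int K1 \<le> int (k1 - 1)" using m1_K1 by (simp add: m1_def)
    then have "int K1 * (int L + 1) \<le> int (k1 - 1) * (int L + 1)" by (intro mult_right_mono) auto
    then show ?thesis using L by linarith
  qed
  moreover have "k1 - 1 > 0" using m1_K1 K1 by (simp add: m1_def)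
  ultimately obtain m' n' where mn': "1 \<le> m'" "m' \<le> int (k1 - 1)" "\<bar>n'\<bar> \<le> int L" "p dvd m' * v + n'"
    using dirichlet_int[OF p, of "k1 - 1" L v] by metis
  have Qn': "Q (nat \<bar>n'\<bar>)"
    unfolding Q_def using mn' \<open>k1 - 1 > 0\<close> by (intro exI[of _ m'] exI[of _ n']) (auto simp: m1_def)
  define k2 where "k2 = (LEAST k. Q k)"
  have Qk2: "Q k2" unfolding k2_def by (rule LeastI) fact
  have k2_le: "k2 \<le> k" if "Q k" for k unfolding k2_def using that by (rule Least_le)
  obtain m2 n2 where m2: "0 \<le> m2" "m2 < m1" "m2 \<noteq> 0 \<or> n2 \<noteq> 0" "\<bar>n2\<bar> = int k2" "p dvd m2 * v + n2"
    using Qk2 by (auto simp: Q_def)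
  have n2_L: "\<bar>n2\<bar> \<le> int L" using k2_le[OF Qn'] mn'(3) m2(4) by linarith
  have n2_K2: "int K2 < \<bar>n2\<bar>"
  proof (rule ccontr)
    assume le: "\<not> ?thesis"
    show False
    proof (cases "m2 = 0")
      case True
      then have "p dvd n2" "n2 \<noteq> 0" using m2 by auto
      then have "p \<le> \<bar>n2\<bar>" using p by (metis dvd_imp_le_int abs_of_pos)
      then show False using le K2 by simp
    next
      case False
      then have "P (nat m2)" using le m2 by (auto simp: P_def intro!: exI[of _ n2])
      then show False using k1_le m2 by (force simp: m1_def)
    qed
  qed
  have basis: "\<exists>a b. m = a * m1 + b * m2 \<and> n = a * n1 + b * n2" if mn: "p dvd m * v + n" for m n
  proof -
    define \<Delta> where "\<Delta> = real_of_int (m1 * n2 - m2 * n1)"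
    \<comment> \<open>m2 < m1 and |n1| <= K2 < |n2| make the two vectors linearly independent, so
      Cramer's rule applies.\<close>
    have "\<bar>m2 * n1\<bar> < \<bar>m1 * n2\<bar>"
      unfolding abs_mult using m2 m1 n1 n2_K2 by (intro mult_strict_mono') auto
    then have "m1 * n2 - m2 * n1 \<noteq> 0" by auto
    then have \<Delta>: "\<Delta> \<noteq> 0" unfolding \<Delta>_def using of_int_eq_0_iff by blast
    define x where "x = of_int (m * n2 - n * m2) / \<Delta>"
    define y where "y = of_int (m1 * n - n1 * m) / \<Delta>"
    have m_xy: "real_of_int m = x * of_int m1 + y * of_int m2"
    proof -
      have "x * of_int m1 + y * of_int m2 = of_int m * \<Delta> / \<Delta>"
        unfolding x_def y_def \<Delta>_def by (simp add: algebra_simps flip: add_divide_distrib)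
      then show ?thesis using \<Delta> by simp
    qed
    have n_xy: "real_of_int n = x * of_int n1 + y * of_int n2"
    proof -
      have "x * of_int n1 + y * of_int n2 = of_int n * \<Delta> / \<Delta>"
        unfolding x_def y_def \<Delta>_def by (simp add: algebra_simps flip: add_divide_distrib)
      then show ?thesis using \<Delta> by simp
    qed
    define a where "a = round x"
    define b where "b = round y"
    define m' where "m' = m - a * m1 - b * m2"
    define n' where "n' = n - a * n1 - b * n2"
    have ab: "\<bar>x - of_int a\<bar> \<le> 1/2" "\<bar>y - of_int b\<bar> \<le> 1/2"
      using of_int_round_abs_le[of x] of_int_round_abs_le[of y] by (auto simp: a_def b_def abs_minus_commute)
    have "real_of_int m' = (x - of_int a) * of_int m1 + (y - of_int b) * of_int m2"
      by (simp add: m'_def m_xy algebra_simps)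
    then have "\<bar>real_of_int m'\<bar> \<le> \<bar>x - of_int a\<bar> * \<bar>of_int m1\<bar> + \<bar>y - of_int b\<bar> * \<bar>of_int m2\<bar>"
      by (metis abs_mult abs_triangle_ineq)
    also have "\<dots> \<le> 1/2 * \<bar>of_int m1\<bar> + 1/2 * \<bar>of_int m2\<bar>"
      using ab by (intro add_mono mult_right_mono) auto
    also have "\<dots> < of_int m1" using m1 m2 by simp
    finally have m': "\<bar>m'\<bar> < m1" by linarith
    have "real_of_int n' = (x - of_int a) * of_int n1 + (y - of_int b) * of_int n2"
      by (simp add: n'_def n_xy algebra_simps)
    then have "\<bar>real_of_int n'\<bar> \<le> \<bar>x - of_int a\<bar> * \<bar>of_int n1\<bar> + \<bar>y - of_int b\<bar> * \<bar>of_int n2\<bar>"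
      by (metis abs_mult abs_triangle_ineq)
    also have "\<dots> \<le> 1/2 * \<bar>of_int n1\<bar> + 1/2 * \<bar>of_int n2\<bar>"
      using ab by (intro add_mono mult_right_mono) auto
    also have "\<dots> < \<bar>of_int n2\<bar>" using n1 n2_K2 by linarith
    finally have n': "\<bar>n'\<bar> < \<bar>n2\<bar>" by linarith
    have "m' * v + n' = (m * v + n) - a * (m1 * v + n1) - b * (m2 * v + n2)"
      by (simp add: m'_def n'_def algebra_simps)
    then have dvd': "p dvd m' * v + n'" using mn n1 m2 by simp
    have "m' = 0 \<and> n' = 0"
    proof (rule ccontr)
      assume nz: "\<not> ?thesis"
      \<comment> \<open>\<open>Q\<close> asks for m >= 0, so for negative m' the opposite vector is
        taken.\<close>
      have "p dvd - (m' * v + n')" using dvd' by (simp only: dvd_minus_iff)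
      then have "p dvd (- m') * v + (- n')" by (simp add: algebra_simps)
      then have "Q (nat \<bar>n'\<bar>)"
        unfolding Q_def using nz m' dvd'
        by (cases "m' \<ge> 0") (force intro: exI[of _ m'] exI[of _ n'] exI[of _ "-m'"] exI[of _ "-n'"])+
      then show False using k2_le n' m2(4) by fastforce
    qed
    then show ?thesis by (intro exI[of _ a] exI[of _ b]) (simp add: m'_def n'_def)
  qed
  show ?thesis
    by (rule that[OF n1(2) m2(5) _ _ _ _ n1(1) n2_L basis]) (use m1 m2 in auto)
qed

context period_setup
begin

text \<open>Transference: a short vector proportional to \<open>(g - 1, g\<^sup>2 - 1, \<dots>)\<close> modulo \<open>p\<close> is
  orthogonal to a short relation (Siegel), which contradicts the bound above.\<close>

lemma short_vector_bound:
  fixes x :: "nat \<Rightarrow> int" and s :: int and X :: nat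
  assumes s: "\<not> int p dvd s" and X: "X \<ge> 1"
    and cong: "\<And>i. i \<in> {1..<f} \<Longrightarrow> [x i = s * (int g ^ i - 1)] (mod int p)"
    and bound: "\<And>i. i \<in> {1..<f} \<Longrightarrow> \<bar>x i\<bar> \<le> int X"
  shows "p ^ (f - 2) \<le> (2 * f) ^ ((f - 1) * (f - 2)) * (3 * f * X) ^ (f - 1)"
proof -
  \<comment> \<open>\<open>P\<close> is what Siegel's condition needs after a factor B + 1 is split
    off. The least such B also satisfies B^(f-2) <= 3 f X.\<close>
  define P where "P B \<longleftrightarrow> 2 * (f - 1) * X + 1 \<le> (B + 1) ^ (f - 2)" for B :: nat
  have f2: "f - 2 > 0" using f_ge_3 by simp
  have "2 * (f - 1) * X + 1 \<le> (2 * (f - 1) * X + 1) ^ (f - 2)" using f2 by (intro self_le_power) auto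
  then have "P (2 * (f - 1) * X)" by (simp add: P_def)
  define B where "B = (LEAST B. P B)"
  have PB: "P B" unfolding B_def by (rule LeastI) fact
  have "\<not> P 0" using X f_ge_3 by (simp add: P_def)
  then have B0: "B > 0" using PB by (cases "B = 0") auto
  then have "\<not> P (B - 1)" unfolding B_def using not_less_Least[of "(LEAST B. P B) - 1" P] by simp
  then have "B ^ (f - 2) < 2 * (f - 1) * X + 1" using B0 by (simp add: P_def)
  also have "\<dots> \<le> 2 * (f - 1) * X + f * X" using f_ge_3 X by (simp add: Suc_leI)
  also have "\<dots> \<le> 2 * f * X + f * X" by (intro add_mono mult_right_mono) auto
  also have "\<dots> = 3 * f * X" by simp
  finally have B_le: "B ^ (f - 2) \<le> 3 * f * X" by simp
  have "2 * (f - 1) * X * B + 1 < (2 * (f - 1) * X + 1) * (B + 1)"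
  proof -
    have "Y * B + 1 < (Y + 1) * (B + 1)" for Y :: nat using B0 by simp
    then show ?thesis .
  qed
  also have "\<dots> \<le> (B + 1) ^ (f - 2) * (B + 1)" using PB by (intro mult_right_mono) (auto simp: P_def)
  also have "\<dots> = (B + 1) ^ (f - 1)"
  proof -
    have "f - 1 = Suc (f - 2)" using f_ge_3 by simp
    then show ?thesis by simp
  qed
  finally obtain b where b: "\<And>i. i \<in> {1..<f} \<Longrightarrow> \<bar>b i\<bar> \<le> int B" "\<exists>i\<in>{1..<f}. b i \<noteq> 0"
    "(\<Sum>i\<in>{1..<f}. b i * x i) = 0"
    using siegel_one_equation[of "{1..<f}" x X B] bound by auto
  have "[(\<Sum>i\<in>{1..<f}. b i * x i) = (\<Sum>i\<in>{1..<f}. b i * (s * (int g ^ i - 1)))] (mod int p)"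
    by (intro cong_sum cong_mult cong cong_refl)
  also have "(\<Sum>i\<in>{1..<f}. b i * (s * (int g ^ i - 1))) = s * (\<Sum>i\<in>{1..<f}. b i * (int g ^ i - 1))"
    by (simp add: sum_distrib_left mult_ac)
  finally have "int p dvd s * (\<Sum>i\<in>{1..<f}. b i * (int g ^ i - 1))"
    using b(3) by (simp add: cong_iff_dvd_diff)
  then have "int p dvd (\<Sum>i\<in>{1..<f}. b i * (int g ^ i - 1))"
    using s prime_p by (simp add: prime_dvd_mult_iff)
  then have "p \<le> (2 * f * B) ^ (f - 1)" using relation_lower_bound b(1,2) by blast
  \<comment> \<open>Raising to the power f-2 avoids extracting a root in B^(f-2) <= 3 f X.\<close>
  then have "p ^ (f - 2) \<le> ((2 * f * B) ^ (f - 1)) ^ (f - 2)" by (intro power_mono) auto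
  also have "\<dots> = (2 * f) ^ ((f - 1) * (f - 2)) * (B ^ (f - 2)) ^ (f - 1)"
    by (simp add: power_mult_distrib mult.commute flip: power_mult)
  also have "\<dots> \<le> (2 * f) ^ ((f - 1) * (f - 2)) * (3 * f * X) ^ (f - 1)"
    using B_le by (intro mult_left_mono power_mono) auto
  finally show ?thesis .
qed

end

subsection \<open>Roots near small values of fewnomials\<close>

text \<open>Passing from \<open>F(z)\<close> to \<open>F(\<rho> z) - \<rho>\<^sup>n F(z)\<close> kills the monomial \<open>z\<^sup>n\<close>; after
  \<open>card S - 1\<close> such steps only one monomial is left.\<close>

lemma fewnomial_coeff_bound:
  fixes c :: "nat \<Rightarrow> complex" and \<rho> \<theta> M E :: real
  assumes "finite S" "n0 \<in> S" and \<theta>: "\<theta> \<ge> 0" and \<rho>: "\<rho> \<ge> 0"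
    and M: "\<And>n. n \<in> S \<Longrightarrow> \<rho> ^ n \<le> M"
    and gap: "\<And>m n. m \<in> S \<Longrightarrow> n \<in> S \<Longrightarrow> m \<noteq> n \<Longrightarrow> \<theta> \<le> \<bar>\<rho> ^ m - \<rho> ^ n\<bar>"
    and E: "\<And>j. j < card S \<Longrightarrow> cmod (\<Sum>n\<in>S. c n * of_real (\<rho> ^ n) ^ j) \<le> E"
  shows "cmod (c n0) * \<theta> ^ (card S - 1) \<le> (1 + M) ^ (card S - 1) * E"
  using assms(1,2) M gap E
proof (induction "card S - 1" arbitrary: S c E)
  case 0
  have "card S \<noteq> 0" using 0(2,3) by auto
  with 0(1) have "card S = 1" by linarith
  then obtain m where "S = {m}" by (rule card_1_singletonE)
  with 0(3) have "S = {n0}" by simp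
  then show ?case using 0(6)[of 0] by simp
next
  case (Suc k)
  have "S - {n0} \<noteq> {}"
  proof
    assume "S - {n0} = {}"
    with Suc.prems(2) have "S = {n0}" by blast
    with Suc.hyps(2) show False by simp
  qed
  then obtain n where n: "n \<in> S" "n \<noteq> n0" by blast
  define S' where "S' = S - {n}"
  define c' where "c' m = c m * of_real (\<rho> ^ m - \<rho> ^ n)" for m
  have cS: "card S = Suc (card S')" unfolding S'_def by (rule card.remove[OF Suc.prems(1) n(1)])
  have M0: "0 \<le> M" using Suc.prems(3)[OF n(1)] \<rho> by (meson order_trans zero_le_power)
  have "cmod (c' n0) * \<theta> ^ (card S' - 1) \<le> (1 + M) ^ (card S' - 1) * ((1 + M) * E)"
  proof (rule Suc.hyps(1))
    show "k = card S' - 1" using Suc.hyps(2) cS by simp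
    show "finite S'" "n0 \<in> S'" using Suc.prems(1,2) n by (auto simp: S'_def)
    show "\<rho> ^ m \<le> M" if "m \<in> S'" for m using Suc.prems(3) that by (auto simp: S'_def)
    show "\<theta> \<le> \<bar>\<rho> ^ m - \<rho> ^ l\<bar>" if "m \<in> S'" "l \<in> S'" "m \<noteq> l" for m l
      using Suc.prems(4) that by (auto simp: S'_def)
    fix j assume j: "j < card S'"
    define G where "G i = (\<Sum>m\<in>S. c m * of_real (\<rho> ^ m) ^ i)" for i
    have "(\<Sum>m\<in>S'. c' m * of_real (\<rho> ^ m) ^ j) = (\<Sum>m\<in>S. c' m * of_real (\<rho> ^ m) ^ j)"
      by (rule sum.mono_neutral_left) (use Suc.prems(1) in \<open>auto simp: S'_def c'_def\<close>)
    also have "\<dots> = G (Suc j) - of_real (\<rho> ^ n) * G j"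
      by (simp add: G_def c'_def sum_distrib_left algebra_simps flip: sum_subtractf)
    also have "cmod \<dots> \<le> cmod (G (Suc j)) + \<rho> ^ n * cmod (G j)"
      using norm_triangle_ineq4[of "G (Suc j)" "of_real (\<rho> ^ n) * G j"] \<rho> by (simp add: norm_mult norm_power)
    also have "\<dots> \<le> E + M * E"
      using Suc.prems(5)[of "Suc j"] Suc.prems(5)[of j] j cS Suc.prems(3)[OF n(1)] M0
      by (intro add_mono mult_mono) (auto simp: G_def)
    finally show "cmod (\<Sum>m\<in>S'. c' m * of_real (\<rho> ^ m) ^ j) \<le> (1 + M) * E" by (simp add: algebra_simps)
  qed
  moreover have "cmod (c n0) * \<theta> ^ (card S - 1) \<le> cmod (c' n0) * \<theta> ^ (card S' - 1)"
  proof -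
    have "card S - 1 = Suc (card S' - 1)" using Suc.hyps(2) cS by simp
    then have "cmod (c n0) * \<theta> ^ (card S - 1) = cmod (c n0) * \<theta> * \<theta> ^ (card S' - 1)" by simp
    also have "\<dots> \<le> cmod (c n0) * \<bar>\<rho> ^ n0 - \<rho> ^ n\<bar> * \<theta> ^ (card S' - 1)"
      using Suc.prems(4)[OF Suc.prems(2) n(1)] n(2) \<theta> by (intro mult_right_mono mult_left_mono) auto
    also have "cmod (c n0) * \<bar>\<rho> ^ n0 - \<rho> ^ n\<bar> = cmod (c' n0)" by (simp add: c'_def norm_mult flip: of_real_diff of_real_power)
    finally show ?thesis .
  qed
  moreover have "(1 + M) ^ (card S' - 1) * ((1 + M) * E) = (1 + M) ^ (card S - 1) * E"
  proof -
    have "card S - 1 = Suc (card S' - 1)" using Suc.hyps(2) cS by simp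
    then show ?thesis by simp
  qed
  ultimately show ?case by linarith
qed

lemma one_plus_power_le:
  fixes x :: real
  assumes "0 \<le> x" "real n * x \<le> 1"
  shows "(1 + x) ^ n \<le> 1 + 2 * (real n * x)"
proof -
  have "(1 + x) ^ n \<le> exp x ^ n" using assms(1) exp_ge_add_one_self[of x] by (intro power_mono) auto
  also have "\<dots> = exp (real n * x)" by (simp add: exp_of_nat_mult)
  also have "\<dots> \<le> 1 + real n * x + (real n * x)\<^sup>2" using assms by (intro exp_bound) auto
  also have "(real n * x)\<^sup>2 \<le> (real n * x) * 1" unfolding power2_eq_square using assms by (intro mult_left_mono) auto
  finally show ?thesis by (simp add: algebra_simps)
qed

text \<open>Since |z - \<xi>| <= \<delta>/n <= |\<xi> - a|/n, each of the n factors grows at most by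
  1 + 1/n, and (1 + 1/n)^n <= 3.\<close>

lemma poly_near_bound:
  fixes as :: "complex list"
  assumes away: "\<And>a. a \<in> set as \<Longrightarrow> \<delta> \<le> cmod (\<xi> - a)" and z: "cmod (z - \<xi>) * real (length as) \<le> \<delta>"
  shows "cmod (\<Prod>a\<leftarrow>as. z - a) \<le> 3 * cmod (\<Prod>a\<leftarrow>as. \<xi> - a)"
proof (cases "as = []")
  case False
  define n where "n = length as"
  have n: "n > 0" using False by (simp add: n_def)
  have "cmod (\<Prod>a\<leftarrow>bs. z - a) \<le> (1 + 1 / real n) ^ length bs * cmod (\<Prod>a\<leftarrow>bs. \<xi> - a)"
    if "set bs \<subseteq> set as" for bs
    using that
  proof (induction bs)
    case (Cons a bs)
    have "cmod (z - \<xi>) \<le> \<delta> / real n" using z n by (simp add: field_simps n_def)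
    also have "\<dots> \<le> cmod (\<xi> - a) / real n" using away[of a] Cons.prems by (intro divide_right_mono) auto
    finally have "cmod (z - a) \<le> (1 + 1 / real n) * cmod (\<xi> - a)"
      using norm_triangle_ineq[of "z - \<xi>" "\<xi> - a"] by (simp add: algebra_simps)
    then have "cmod (z - a) * cmod (\<Prod>a\<leftarrow>bs. z - a) \<le>
        ((1 + 1 / real n) * cmod (\<xi> - a)) * ((1 + 1 / real n) ^ length bs * cmod (\<Prod>a\<leftarrow>bs. \<xi> - a))"
      using Cons by (intro mult_mono[OF _ _ _ norm_ge_zero]) auto
    then show ?case by (simp add: norm_mult mult_ac)
  qed simp
  from this[of as] have "cmod (\<Prod>a\<leftarrow>as. z - a) \<le> (1 + 1 / real n) ^ n * cmod (\<Prod>a\<leftarrow>as. \<xi> - a)"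
    by (simp add: n_def)
  also have "(1 + 1 / real n) ^ n \<le> 3" using one_plus_power_le[of "1 / real n" n] n by simp
  finally show ?thesis by (meson mult_right_mono norm_ge_zero order_trans)
qed simp

text \<open>If no root were that close, R would stay below 3 |R(\<xi>)| at the points \<xi>
  \<rho>^j, and the bound for the leading coefficient 1 would contradict smallness. The exponent is
  the number k of terms; factoring R over its roots would only give the exponent n.\<close>

lemma fewnomial_root_near:
  fixes R :: "complex poly" and as :: "complex list" and k :: nat
  assumes roots: "(\<Prod>a\<leftarrow>as. [:- a, 1:]) = R" and n: "length as = n" "n > 0"
    and few: "card {i. coeff R i \<noteq> 0} \<le> k"
    and \<xi>: "cmod \<xi> = 1" and \<delta>: "0 < \<delta>" "\<delta> \<le> 1"
    and small: "3 * cmod (poly R \<xi>) < (\<delta> / (8 * real k * real n)) ^ k"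
  shows "\<exists>a\<in>set as. cmod (\<xi> - a) < \<delta>"
proof (rule ccontr)
  assume "\<not> ?thesis"
  then have away: "\<And>a. a \<in> set as \<Longrightarrow> \<delta> \<le> cmod (\<xi> - a)" by auto
  define S where "S = {i. coeff R i \<noteq> 0}"
  have deg: "degree R = n" unfolding roots[symmetric] n(1)[symmetric]
    by (rule degree_linear_factors)
  have lead: "coeff R n = 1" unfolding deg[symmetric] roots[symmetric]
    by (rule monic_prod_list) auto
  have S: "finite S" "n \<in> S" "S \<subseteq> {..n}"
    using MOST_coeff_eq_0[of R] lead deg by (auto simp: S_def le_degree MOST_iff_cofinite)
  have k: "card S \<le> k" "card S \<ge> 1" using few S by (auto simp: S_def card_gt_0_iff Suc_le_eq)
  have polyR: "poly R z = (\<Sum>i\<in>S. coeff R i * z ^ i)" for z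
    unfolding poly_altdef deg by (rule sum.mono_neutral_right) (use S in \<open>auto simp: S_def\<close>)
  have polyR': "poly R z = (\<Prod>a\<leftarrow>as. z - a)" for z
    by (simp flip: roots add: poly_prod_list o_def)
  \<comment> \<open>With 2 k \<theta> = \<delta>/n the points \<xi> \<rho>^j, j <= k, stay within
    \<delta>/n of \<xi>; n \<theta> <= 1 keeps the powers \<rho>^i, i <= n, at most 3.\<close>
  define \<theta> where "\<theta> = \<delta> / (2 * real k * real n)"
  have \<theta>0: "0 < \<theta>" using \<delta> k n by (simp add: \<theta>_def)
  have k\<theta>: "real k * \<theta> = \<delta> / (2 * real n)" using k by (simp add: \<theta>_def)
  have k\<theta>1: "real k * \<theta> \<le> 1" unfolding k\<theta> using \<delta> n by (simp add: field_simps)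
  have n\<theta>1: "real n * \<theta> \<le> 1"
  proof -
    have "real n * \<theta> = \<delta> / (2 * real k)" using n by (simp add: \<theta>_def)
    also have "\<dots> \<le> 1" using \<delta> k by (simp add: field_simps)
    finally show ?thesis .
  qed
  define \<rho> where "\<rho> = 1 + \<theta>"
  have \<rho>1: "\<rho> \<ge> 1" using \<theta>0 by (simp add: \<rho>_def)
  have near: "cmod (poly R (\<xi> * of_real (\<rho> ^ j))) \<le> 3 * cmod (poly R \<xi>)" if j: "j \<le> k" for j
    unfolding polyR'
  proof (rule poly_near_bound[OF away])
    have "\<xi> * of_real (\<rho> ^ j) - \<xi> = \<xi> * of_real (\<rho> ^ j - 1)" by (simp add: algebra_simps)
    then have "cmod (\<xi> * of_real (\<rho> ^ j) - \<xi>) = \<bar>\<rho> ^ j - 1\<bar>" using \<xi> by (simp only: norm_mult norm_of_real) simp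
    also have "\<dots> = \<rho> ^ j - 1" using \<rho>1 by simp
    also have "\<dots> \<le> \<rho> ^ k - 1" using \<rho>1 j by (simp add: power_increasing)
    also have "\<dots> \<le> 2 * (real k * \<theta>)" using one_plus_power_le[of \<theta> k] \<theta>0 k\<theta>1 by (simp add: \<rho>_def)
    also have "\<dots> = \<delta> / real n" by (simp add: k\<theta>)
    finally show "cmod (\<xi> * of_real (\<rho> ^ j) - \<xi>) * real (length as) \<le> \<delta>"
      using n by (simp add: field_simps)
  qed
  have "cmod (coeff R n * \<xi> ^ n) * \<theta> ^ (card S - 1) \<le> (1 + 3) ^ (card S - 1) * (3 * cmod (poly R \<xi>))"
  proof (rule fewnomial_coeff_bound[where \<rho> = \<rho>])
    show "\<rho> ^ i \<le> 3" if "i \<in> S" for i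
    proof -
      have "\<rho> ^ i \<le> \<rho> ^ n" using S that \<rho>1 by (intro power_increasing) auto
      also have "\<dots> \<le> 1 + 2 * (real n * \<theta>)" unfolding \<rho>_def using \<theta>0 n\<theta>1 by (intro one_plus_power_le) auto
      finally show ?thesis using n\<theta>1 by linarith
    qed
    have gap: "\<theta> \<le> \<rho> ^ i - \<rho> ^ l" if "l < i" for i l
    proof -
      have "\<rho> ^ l * \<rho> ^ 1 \<le> \<rho> ^ i" unfolding power_add[symmetric] using that \<rho>1 by (intro power_increasing) auto
      moreover have "1 * \<theta> \<le> \<rho> ^ l * \<theta>" using \<rho>1 \<theta>0 by (intro mult_right_mono) auto
      ultimately show ?thesis by (simp add: \<rho>_def algebra_simps)
    qed
    show "\<theta> \<le> \<bar>\<rho> ^ i - \<rho> ^ l\<bar>" if "i \<noteq> l" for i l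
      using gap[of i l] gap[of l i] that by (cases "i < l") auto
    show "cmod (\<Sum>i\<in>S. coeff R i * \<xi> ^ i * of_real (\<rho> ^ i) ^ j) \<le> 3 * cmod (poly R \<xi>)" if "j < card S" for j
    proof -
      have "(\<Sum>i\<in>S. coeff R i * \<xi> ^ i * of_real (\<rho> ^ i) ^ j) = poly R (\<xi> * of_real (\<rho> ^ j))"
        unfolding polyR by (simp add: power_mult_distrib mult_ac flip: power_mult)
      then show ?thesis using near[of j] that k by simp
    qed
  qed (use S \<theta>0 \<rho>1 in auto)
  then have "\<theta> ^ (card S - 1) \<le> 4 ^ (card S - 1) * (3 * cmod (poly R \<xi>))"
    using lead \<xi> by (simp add: norm_mult norm_power)
  then have "(\<theta> / 4) ^ (card S - 1) \<le> 3 * cmod (poly R \<xi>)"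
    by (simp add: power_divide divide_le_eq mult_ac)
  moreover have "(\<theta> / 4) ^ k \<le> (\<theta> / 4) ^ (card S - 1)"
  proof (rule power_decreasing)
    have "1 * \<theta> \<le> real n * \<theta>" using n \<theta>0 by (intro mult_right_mono) auto
    then show "\<theta> / 4 \<le> 1" using n\<theta>1 by simp
  qed (use k \<theta>0 in auto)
  moreover have "\<theta> / 4 = \<delta> / (8 * real k * real n)" by (simp add: \<theta>_def)
  ultimately show False using small by simp
qed

subsection \<open>Gaussian periods as lacunary sums\<close>

context period_setup
begin

definition e :: "int \<Rightarrow> complex" where
  "e x = cis (2 * pi * of_int x / of_nat p)"

definition period :: "int \<Rightarrow> complex" where
  "period t = (\<Sum>i<f. e (t * int g ^ i))"

lemma p_pos: "p > 0" using p_gt_f by simp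

lemma e_add: "e (x + y) = e x * e y"
  by (simp add: e_def cis_mult ring_distribs add_divide_distrib)

lemma e_0 [simp]: "e 0 = 1" by (simp add: e_def)

lemma norm_e [simp]: "cmod (e x) = 1" by (simp add: e_def)

lemma e_nonzero [simp]: "e x \<noteq> 0" using norm_e[of x] by (metis norm_zero zero_neq_one)

lemma e_power: "e x ^ n = e (int n * x)"
  by (induction n) (auto simp: ring_distribs e_add)

lemma e_eq_1_iff: "e x = 1 \<longleftrightarrow> int p dvd x"
proof -
  have "e x = 1 \<longleftrightarrow> (\<exists>k. 2 * pi * of_int x / of_nat p = 2 * of_int k * pi)"
    unfolding e_def cis_conv_exp by (simp add: exp_eq_1)
  also have "\<dots> \<longleftrightarrow> (\<exists>k. x = int p * k)"
  proof (rule ex_cong1)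
    fix k
    have "2 * pi * of_int x / of_nat p = 2 * of_int k * pi \<longleftrightarrow> real_of_int x = real_of_int (int p * k)"
      using p_pos by (simp add: field_simps)
    then show "2 * pi * of_int x / of_nat p = 2 * of_int k * pi \<longleftrightarrow> x = int p * k"
      by (simp only: of_int_eq_iff)
  qed
  finally show ?thesis by (simp add: dvd_def)
qed

lemma e_cong: "[x = y] (mod int p) \<Longrightarrow> e x = e y"
proof -
  assume "[x = y] (mod int p)"
  then have "e (x - y) = 1" by (simp add: e_eq_1_iff cong_iff_dvd_diff)
  then show "e x = e y" using e_add[of "x - y" y] by simp
qed

lemma e_pow_p: "e x ^ p = 1" by (simp add: e_power e_eq_1_iff)

text \<open>The period is F(e(t)) for F the sum of the monomials X^(g^i), and F(1) = f. A zero would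
  make p divide f, contrary to f < p.\<close>

lemma period_nonzero:
  assumes "\<not> int p dvd t"
  shows "period t \<noteq> 0"
proof
  assume "period t = 0"
  define F :: "int poly" where "F = (\<Sum>i<f. monom 1 (g ^ i))"
  have "cpoly F (e t) = period t"
    by (simp add: F_def period_def of_int_poly_hom.hom_sum poly_sum poly_monom e_power mult.commute)
  then have "int p dvd poly F 1"
    using \<open>period t = 0\<close> cyc_root_dvd[OF prime_p odd_p e_pow_p, of t F] assms e_eq_1_iff by auto
  also have "poly F 1 = int f" by (simp add: F_def poly_sum poly_monom)
  finally have "p dvd f" by simp
  then show False using p_gt_f f_ge_3 by (auto dest: dvd_imp_le)
qed

text \<open>Index 1 is left out on purpose: simultaneous approximation of only the f-2 numbers (g^i
  - 1)/p with i >= 2 permits K up to about p^(1/(f-2)), while index 0 costs nothing as g^0 - 1 = 0.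
  The hypothesis \<open>K ^ (f - 2) < p\<close> keeps q below p, hence invertible.\<close>

lemma dirichlet_shift:
  assumes K: "K \<ge> 1" "K ^ (f - 2) < p"
  obtains q s :: int and c :: "nat \<Rightarrow> nat" where "\<not> int p dvd q"
    "\<And>i. i \<in> {..<f} - {1} \<Longrightarrow> [q * (int g ^ i - 1) = int (c i) + s] (mod int p)"
    "\<And>i. i \<in> {..<f} - {1} \<Longrightarrow> K * c i \<le> 2 * p"
    "\<And>i. i \<in> {..<f} - {1} \<Longrightarrow> int K * \<bar>int (c i) + s\<bar> \<le> int p"
    "inj_on c ({..<f} - {1})" "\<exists>i\<in>{..<f} - {1}. c i = 0"
proof -
  define I where "I = {..<f} - {1::nat}"
  obtain q h where qh: "0 < q" "q \<le> int (K ^ (f - 2))"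
    "\<And>i. i < f - 2 \<Longrightarrow> \<bar>of_int q * (of_int (int g ^ (i + 2) - 1) / real p) - of_int (h i)\<bar> < 1 / real K"
    using Dirichlet_approx_simult[of K "f - 2" "\<lambda>i. of_int (int g ^ (i + 2) - 1) / real p"] K(1)
    by (metis One_nat_def Suc_le_lessD)
  have q: "\<not> int p dvd q"
  proof
    assume "int p dvd q"
    then have "int p \<le> q" using qh(1) by (intro zdvd_imp_le)
    then have "p \<le> K ^ (f - 2)" using qh(2) by linarith
    with K(2) show False by simp
  qed
  define b where "b i = (if i = 0 then 0 else q * (int g ^ i - 1) - int p * h (i - 2))" for i
  have b_cong: "[q * (int g ^ i - 1) = b i] (mod int p)" for i
    by (auto simp: b_def cong_iff_dvd_diff)
  have b_bound: "int K * \<bar>b i\<bar> \<le> int p" if "i \<in> I" for i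
  proof (cases "i = 0")
    case False
    with that have i: "i - 2 < f - 2" "i - 2 + 2 = i" by (auto simp: I_def)
    have "\<bar>real_of_int (b i)\<bar> = \<bar>of_int q * (of_int (int g ^ i - 1) / real p) - of_int (h (i - 2))\<bar> * real p"
    proof -
      have "real_of_int (b i) = (of_int q * (of_int (int g ^ i - 1) / real p) - of_int (h (i - 2))) * real p"
        using False p_pos by (simp add: b_def field_simps)
      then show ?thesis by (simp add: abs_mult)
    qed
    also have "\<dots> \<le> 1 / real K * real p" 
      by (rule mult_right_mono[OF less_imp_le[OF qh(3)[OF i(1), unfolded i(2)]]]) simp
    finally have "real_of_int (int K * \<bar>b i\<bar>) \<le> real_of_int (int p)" using K(1) by (simp add: field_simps)
    then show ?thesis by (simp only: of_int_le_iff)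
  qed (simp add: b_def)
  have I: "finite I" "0 \<in> I" using f_ge_3 by (auto simp: I_def)
  \<comment> \<open>Subtracting the minimum makes all exponents nonnegative and one of them 0, so
    that \<open>Q\<close> will be a polynomial with constant term 1.\<close>
  define s where "s = Min (b ` I)"
  have "s \<in> b ` I" unfolding s_def using I by (intro Min_in) auto
  then obtain i0 where i0: "i0 \<in> I" "b i0 = s" by auto
  have s_le: "s \<le> b i" if "i \<in> I" for i unfolding s_def using that I by simp
  define c where "c i = nat (b i - s)" for i
  have c_eq: "int (c i) = b i - s" if "i \<in> I" for i using s_le[OF that] by (simp add: c_def)
  show ?thesis
  proof (rule that[OF q])
    fix i assume "i \<in> {..<f} - {1}"
    then have i: "i \<in> I" by (simp add: I_def)
    show "[q * (int g ^ i - 1) = int (c i) + s] (mod int p)" using b_cong[of i] c_eq[OF i] by simp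
    show "int K * \<bar>int (c i) + s\<bar> \<le> int p" using b_bound[OF i] c_eq[OF i] by simp
    have "int K * b i \<le> int K * \<bar>b i\<bar>" by (intro mult_left_mono) auto
    moreover have "int K * - s \<le> int K * \<bar>b i0\<bar>" using i0 by (intro mult_left_mono) auto
    ultimately have "int K * (b i - s) \<le> 2 * int p"
      using b_bound[OF i] b_bound[OF i0(1)] by (simp add: algebra_simps)
    then have "int (K * c i) \<le> int (2 * p)" using c_eq[OF i] by simp
    then show "K * c i \<le> 2 * p" by (simp only: of_nat_le_iff)
  next
    show "inj_on c ({..<f} - {1})"
    proof (rule inj_onI)
      fix i j assume "i \<in> {..<f} - {1}" "j \<in> {..<f} - {1}" and eq: "c i = c j"
      then have ij: "i \<in> I" "j \<in> I" "i < f" "j < f" by (auto simp: I_def)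
      then have "b i = b j" using eq c_eq[of i] c_eq[of j] by simp
      then have "[q * (int g ^ i - 1) = q * (int g ^ j - 1)] (mod int p)"
        using b_cong[of i] b_cong[of j] by (metis cong_sym cong_trans)
      then have "int p dvd q * (int g ^ i - int g ^ j)"
        by (simp add: cong_iff_dvd_diff algebra_simps)
      then have "int p dvd int g ^ i - int g ^ j"
        using q prime_p by (simp add: prime_dvd_mult_iff)
      then have "[g ^ i = g ^ j] (mod p)" by (simp add: cong_iff_dvd_diff flip: cong_int_iff)
      then show "i = j" using g_pow_cong_iff ij by (simp add: cong_def)
    qed
    show "\<exists>i\<in>{..<f} - {1}. c i = 0" using i0 by (auto simp: c_def I_def)
  qed
qed

end

text \<open>After the substitution \<open>t \<mapsto> tq\<close> and division by \<open>e(t(q + s))\<close>, the exponents of a period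
  are the small numbers \<open>c i\<close> for \<open>i \<noteq> 1\<close>, and one large number \<open>v\<close> for \<open>i = 1\<close>.
  So the period becomes \<open>Q(\<xi>) + \<eta>\<close> with \<open>\<xi> = e(t)\<close> and \<open>\<eta> = e(tv)\<close>. If it is small,
  then \<open>\<bar>Q(\<xi>)\<bar>\<^sup>2 - 1\<close> is small, that is, \<open>R(\<xi>)\<close> is small.\<close>

locale lacunary_period = period_setup f p g for f p g +
  fixes K :: nat and q s :: int and c :: "nat \<Rightarrow> nat"
  assumes q_not_dvd: "\<not> int p dvd q"
    and c_cong: "\<And>i. i \<in> {..<f} - {1} \<Longrightarrow> [q * (int g ^ i - 1) = int (c i) + s] (mod int p)"
    and c_bound: "\<And>i. i \<in> {..<f} - {1} \<Longrightarrow> K * c i \<le> 2 * p"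
    and cs_bound: "\<And>i. i \<in> {..<f} - {1} \<Longrightarrow> int K * \<bar>int (c i) + s\<bar> \<le> int p"
    and inj_c: "inj_on c ({..<f} - {1})"
    and c_zero: "\<exists>i\<in>{..<f} - {1}. c i = 0"
begin

definition I where "I = {..<f} - {1::nat}"
definition v where "v = q * (int g - 1) - s"
definition D where "D = Max (c ` I)"
definition Q :: "int poly" where "Q = (\<Sum>i\<in>I. monom 1 (c i))"
text \<open>The reciprocal polynomial X^D Q(1/X), which on the unit circle is \<xi>^D times the
  conjugate of Q(\<xi>).\<close>

definition Qr :: "int poly" where "Qr = (\<Sum>i\<in>I. monom 1 (D - c i))"
definition R where "R = Q * Qr - monom 1 D"
definition \<beta> where "\<beta> t = cpoly Q (e t) + e (t * v)"

lemma finite_I: "finite I" and card_I: "card I = f - 1" and zero_in_I: "0 \<in> I" and two_in_I: "2 \<in> I"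
  using f_ge_3 by (auto simp: I_def)

lemma c_le_D: "i \<in> I \<Longrightarrow> c i \<le> D" unfolding D_def using finite_I by simp

lemma D_in: "\<exists>i\<in>I. c i = D"
proof -
  have "D \<in> c ` I" unfolding D_def using finite_I zero_in_I by (intro Max_in) auto
  then show ?thesis by auto
qed

lemma K_mult_D_le: "K * D \<le> 2 * p"
proof -
  obtain i where "i \<in> I" "c i = D" using D_in by blast
  then show ?thesis using c_bound[of i] by (simp add: I_def)
qed

lemma D_pos: "D > 0"
proof -
  have "c 0 \<noteq> c 2" using inj_onD[OF inj_c, of 0 2] f_ge_3 by auto
  then show ?thesis using c_le_D[OF zero_in_I] c_le_D[OF two_in_I] by linarith
qed

lemma poly_Q: "cpoly Q (z :: complex) = (\<Sum>i\<in>I. z ^ c i)"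
  by (simp add: Q_def of_int_poly_hom.hom_sum poly_sum poly_monom)

lemma poly_Qr: "cpoly Qr (z :: complex) = (\<Sum>i\<in>I. z ^ (D - c i))"
  by (simp add: Qr_def of_int_poly_hom.hom_sum poly_sum poly_monom)

lemma poly_R: "cpoly R (z :: complex) =
    cpoly Q z * cpoly Qr z - z ^ D"
  by (simp add: R_def of_int_poly_hom.hom_minus of_int_poly_hom.hom_mult poly_monom)

lemma coeff_sum_monom_inj:
  assumes "inj_on h I"
  shows "coeff (\<Sum>i\<in>I. monom (1::int) (h i)) n = (if n \<in> h ` I then 1 else 0)"
proof -
  have "coeff (\<Sum>i\<in>I. monom (1::int) (h i)) n = (\<Sum>i\<in>I. if h i = n then 1 else 0)"
    by (simp add: coeff_sum)
  also have "\<dots> = (\<Sum>m\<in>h ` I. if m = n then 1 else 0)" using assms by (simp add: sum.reindex)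
  also have "\<dots> = (if n \<in> h ` I then 1 else 0)" using finite_I by simp
  finally show ?thesis .
qed

lemma inj_c': "inj_on c I" using inj_c by (simp add: I_def)

lemma inj_Dc: "inj_on (\<lambda>i. D - c i) I"
proof (rule inj_onI)
  fix i j assume ij: "i \<in> I" "j \<in> I" "D - c i = D - c j"
  then have "c i = c j" using c_le_D[of i] c_le_D[of j] by linarith
  then show "i = j" using ij inj_onD[OF inj_c'] by blast
qed

lemma coeff_Q: "coeff Q n = (if n \<in> c ` I then 1 else 0)"
  unfolding Q_def by (rule coeff_sum_monom_inj[OF inj_c'])

lemma coeff_Qr: "coeff Qr n = (if n \<in> (\<lambda>i. D - c i) ` I then 1 else 0)"
  unfolding Qr_def by (rule coeff_sum_monom_inj[OF inj_Dc])

lemma mem_images: "D \<in> c ` I" "0 \<in> c ` I" "D \<in> (\<lambda>i. D - c i) ` I" "0 \<in> (\<lambda>i. D - c i) ` I"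
proof -
  obtain i j where ij: "i \<in> I" "c i = D" "j \<in> I" "c j = 0"
    using D_in c_zero unfolding I_def by blast
  show "D \<in> c ` I" "D \<in> (\<lambda>i. D - c i) ` I"
    by (rule image_eqI[of _ _ i] image_eqI[of _ _ j]; use ij in simp)+
  show "0 \<in> c ` I" "0 \<in> (\<lambda>i. D - c i) ` I"
    by (rule image_eqI[of _ _ j] image_eqI[of _ _ i]; use ij in simp)+
qed

lemma degree_Q: "degree Q = D" and degree_Qr: "degree Qr = D"
proof -
  have "coeff Q D = 1" by (simp only: coeff_Q mem_images if_True)
  then have "D \<le> degree Q" by (intro le_degree) simp
  moreover have "degree Q \<le> D"
    by (rule degree_le) (auto simp: coeff_Q dest: c_le_D)
  ultimately show "degree Q = D" by simp
  have "coeff Qr D = 1" by (simp only: coeff_Qr mem_images if_True)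
  then have "D \<le> degree Qr" by (intro le_degree) simp
  moreover have "degree Qr \<le> D" by (rule degree_le) (auto simp: coeff_Qr)
  ultimately show "degree Qr = D" by simp
qed

lemma monic_QQr: "monic (Q * Qr)" "degree (Q * Qr) = 2 * D"
proof -
  have "coeff Q D = 1" by (simp only: coeff_Q mem_images if_True)
  moreover have "coeff Qr D = 1" by (simp only: coeff_Qr mem_images if_True)
  ultimately show "monic (Q * Qr)" by (simp add: lead_coeff_mult degree_Q degree_Qr)
  show "degree (Q * Qr) = 2 * D"
    using degree_Q degree_Qr D_pos by (subst degree_mult_eq) auto
qed

lemma degree_R: "degree R = 2 * D" and monic_R: "monic R"
proof -
  have "degree (monom (1::int) D) < degree (Q * Qr)" using monic_QQr D_pos by (simp add: degree_monom_eq)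
  then have *: "degree R = degree (Q * Qr)"
    unfolding R_def using degree_add_eq_left[of "- monom 1 D" "Q * Qr"] by simp
  then show "degree R = 2 * D" using monic_QQr by simp
  show "monic R" unfolding * using monic_QQr D_pos by (simp add: R_def)
qed

lemma R_0: "cpoly R (0 :: complex) = 1"
proof -
  have "poly Q 0 = 1" by (simp only: poly_0_coeff_0 coeff_Q mem_images if_True)
  moreover have "poly Qr 0 = 1" by (simp only: poly_0_coeff_0 coeff_Qr mem_images if_True)
  ultimately have "poly R 0 = 1" using D_pos by (simp add: R_def poly_monom)
  then have "of_int (poly R 0) = (1 :: complex)" by simp
  then show ?thesis using of_int_hom.poly_map_poly[of R 0, where ?'a = complex] by simp
qed

lemma R_expand: "R = (\<Sum>(i, j)\<in>I \<times> I. monom 1 (c i + (D - c j))) - monom 1 D"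
  by (simp add: R_def Q_def Qr_def sum_product sum.cartesian_product mult_monom)

lemma card_support_R: "card {n. coeff (map_poly complex_of_int R) n \<noteq> 0} \<le> f\<^sup>2"
proof -
  have "{n. coeff (map_poly complex_of_int R) n \<noteq> 0} \<subseteq> (\<lambda>(i, j). c i + (D - c j)) ` (I \<times> I)"
  proof clarify
    fix n assume nz: "coeff (map_poly complex_of_int R) n \<noteq> 0"
    show "n \<in> (\<lambda>(i, j). c i + (D - c j)) ` (I \<times> I)"
    proof (rule ccontr)
      assume n: "n \<notin> (\<lambda>(i, j). c i + (D - c j)) ` (I \<times> I)"
      have "D = c 0 + (D - c 0)" using c_le_D[OF zero_in_I] by simp
      then have "D \<in> (\<lambda>(i, j). c i + (D - c j)) ` (I \<times> I)" using zero_in_I by force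
      then have "n \<noteq> D" using n by metis
      moreover have "coeff (\<Sum>(i, j)\<in>I \<times> I. monom (1::int) (c i + (D - c j))) n = 0"
        unfolding coeff_sum using n by (intro sum.neutral) force
      ultimately have "coeff R n = 0" unfolding R_expand by simp
      with nz show False by simp
    qed
  qed
  then have "card {n. coeff (map_poly complex_of_int R) n \<noteq> 0} \<le> card ((\<lambda>(i, j). c i + (D - c j)) ` (I \<times> I))"
    using finite_I by (intro card_mono) auto
  also have "\<dots> \<le> card (I \<times> I)" using finite_I by (intro card_image_le) auto
  also have "\<dots> \<le> f * f" unfolding card_cartesian_product card_I by (intro mult_mono) auto
  finally show ?thesis by (simp add: power2_eq_square)
qed

lemma l1_norm_R: "(\<Sum>n\<le>degree R. \<bar>coeff R n\<bar>) \<le> int (f\<^sup>2)"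
proof -
  have "(\<Sum>n\<le>degree R. \<bar>coeff R n\<bar>) \<le>
      (\<Sum>n\<le>degree R. (\<Sum>(i, j)\<in>I \<times> I. if c i + (D - c j) = n then 1 else 0) + (if n = D then 1 else 0))"
  proof (rule sum_mono)
    fix n
    have "coeff R n = (\<Sum>(i, j)\<in>I \<times> I. if c i + (D - c j) = n then 1 else 0) - (if n = D then 1 else 0)"
      unfolding R_expand by (auto simp: coeff_sum case_prod_unfold)
    moreover have "0 \<le> (\<Sum>(i, j)\<in>I \<times> I. if c i + (D - c j) = n then 1 else (0::int))"
      by (intro sum_nonneg) auto
    ultimately show "\<bar>coeff R n\<bar> \<le>
        (\<Sum>(i, j)\<in>I \<times> I. if c i + (D - c j) = n then 1 else 0) + (if n = D then 1 else 0)" by auto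
  qed
  also have "\<dots> = (\<Sum>(i, j)\<in>I \<times> I. \<Sum>n\<le>degree R. if c i + (D - c j) = n then 1 else 0) + 1"
    unfolding sum.distrib by (subst sum.swap) (simp add: case_prod_unfold degree_R)
  also have "(\<Sum>(i, j)\<in>I \<times> I. \<Sum>n\<le>degree R. if c i + (D - c j) = n then 1 else (0::int)) \<le> (\<Sum>(i, j)\<in>I \<times> I. 1)"
    by (intro sum_mono) auto
  also have "\<dots> = int ((f - 1) * (f - 1))" by (simp add: card_I card_cartesian_product case_prod_unfold)
  also have "int ((f - 1) * (f - 1)) + 1 \<le> int (f\<^sup>2)"
  proof -
    have "f = Suc (Suc (f - 2))" using f_ge_3 by simp
    then obtain k where "f = Suc (Suc k)" ..
    then show ?thesis by (simp add: power2_eq_square)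
  qed
  finally show ?thesis by simp
qed

text \<open>Landau's inequality bounds the Mahler measure by the 2-norm of the coefficients, hence
  by their 1-norm. The bound is free of D; it controls the roots off the unit circle in
  \<open>bad_sum\<close>.\<close>

lemma mahler_R:
  assumes "(\<Prod>a\<leftarrow>as. [:- a, 1:]) = map_poly complex_of_int R"
  shows "(\<Prod>a\<leftarrow>as. max 1 (cmod a)) \<le> real (f\<^sup>2)"
proof -
  have "(\<Prod>a\<leftarrow>as. max 1 (cmod a)) = mahler_measure R"
    unfolding mahler_measure_def assms[symmetric] using mahler_measure_poly_explicit[of 1 as] by simp
  also have "\<dots> \<le> sqrt (real_of_int (\<Sum>a\<leftarrow>coeffs R. a * a))" by (rule Landau_inequality_mahler_measure)
  also have "(\<Sum>a\<leftarrow>coeffs R. a * a) = (\<Sum>n\<le>degree R. coeff R n * coeff R n)"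
  proof -
    have "R \<noteq> 0" using degree_R D_pos by auto
    then show ?thesis
      by (simp add: coeffs_def comp_def sum_list_distinct_conv_sum_set atLeast0LessThan lessThan_Suc_atMost
          del: upt_Suc)
  qed
  also have "\<dots> \<le> (\<Sum>n\<le>degree R. \<bar>coeff R n\<bar>)\<^sup>2"
  proof -
    have "(\<Sum>n\<le>degree R. coeff R n * coeff R n) = (\<Sum>n\<le>degree R. \<bar>coeff R n\<bar> * \<bar>coeff R n\<bar>)"
      by (simp add: abs_mult_self)
    also have "\<dots> \<le> (\<Sum>n\<le>degree R. \<bar>coeff R n\<bar> * (\<Sum>n\<le>degree R. \<bar>coeff R n\<bar>))"
      by (intro sum_mono mult_left_mono member_le_sum) auto
    finally show ?thesis by (simp add: power2_eq_square sum_distrib_right)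
  qed
  also have "\<dots> \<le> (int (f\<^sup>2))\<^sup>2" using l1_norm_R by (intro power_mono sum_nonneg) auto
  finally show ?thesis by (simp add: real_sqrt_mult power2_eq_square)
qed

text \<open>R(1) = (f-1)^2 - 1 = f (f-2) is nonzero and prime to p, which settles a = 1 and, by
  \<open>cyc_root_dvd\<close>, every other p-th root of unity.\<close>

lemma R_root_of_unity:
  assumes "a ^ p = (1 :: complex)"
  shows "cpoly R a \<noteq> 0"
proof
  assume root: "cpoly R a = 0"
  have R1: "poly R 1 = int ((f - 1)\<^sup>2) - 1"
    by (simp add: R_def Q_def Qr_def poly_sum poly_monom card_I power2_eq_square)
  have R1': "poly R 1 = int (f * (f - 2))"
  proof -
    have "f = Suc (Suc (f - 2))" using f_ge_3 by simp
    then obtain k where "f = Suc (Suc k)" ..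
    then show ?thesis unfolding R1 by (simp add: power2_eq_square algebra_simps)
  qed
  show False
  proof (cases "a = 1")
    case True
    then have "of_int (poly R 1) = (0 :: complex)"
      using root of_int_hom.poly_map_poly[of R 1, where ?'a = complex] by simp
    then have "poly R 1 = 0" by (simp only: of_int_eq_0_iff)
    then have "f * (f - 2) = 0" unfolding R1' by (simp only: of_nat_eq_0_iff)
    then show False using f_ge_3 by simp
  next
    case False
    then have "int p dvd int (f * (f - 2))" using cyc_root_dvd[OF prime_p odd_p assms _ root] R1' by simp
    then have "p dvd f * (f - 2)" by (simp only: of_nat_dvd_iff)
    then have "p dvd f \<or> p dvd f - 2" using prime_p by (simp add: prime_dvd_mult_iff)
    then show False using p_gt_f f_ge_3 by (auto dest: dvd_imp_le)
  qed
qed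

lemma period_shift: "period (t * q) = e (t * (q + s)) * \<beta> t"
proof -
  have "period (t * q) = (\<Sum>i\<in>I. e (t * q * int g ^ i)) + e (t * q * int g ^ 1)"
    unfolding period_def I_def using f_ge_3 by (subst sum.remove[of _ 1]) auto
  also have "(\<Sum>i\<in>I. e (t * q * int g ^ i)) = (\<Sum>i\<in>I. e (t * (q + s)) * e t ^ c i)"
  proof (intro sum.cong refl)
    fix i assume "i \<in> I"
    then have "[t * (q * (int g ^ i - 1)) = t * (int (c i) + s)] (mod int p)"
      using c_cong by (intro cong_mult cong_refl) (auto simp: I_def)
    then have "[t * (q * (int g ^ i - 1)) + t * q = t * (int (c i) + s) + t * q] (mod int p)"
      by (intro cong_add cong_refl)
    then have "e (t * (q * (int g ^ i - 1)) + t * q) = e (t * (int (c i) + s) + t * q)" by (rule e_cong)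
    moreover have "t * (q * (int g ^ i - 1)) + t * q = t * q * int g ^ i" by (simp add: algebra_simps)
    moreover have "t * (int (c i) + s) + t * q = t * (q + s) + int (c i) * t" by (simp add: algebra_simps)
    ultimately show "e (t * q * int g ^ i) = e (t * (q + s)) * e t ^ c i" by (simp add: e_add e_power)
  qed
  also have "e (t * q * int g ^ 1) = e (t * (q + s)) * e (t * v)"
    unfolding e_add[symmetric] v_def by (simp add: algebra_simps)
  finally show ?thesis by (simp add: \<beta>_def poly_Q ring_distribs sum_distrib_left)
qed

lemma norm_\<beta>: "cmod (\<beta> t) = cmod (period (t * q))"
  by (simp add: period_shift norm_mult)

lemma \<beta>_nonzero: "\<not> int p dvd t \<Longrightarrow> \<beta> t \<noteq> 0"
  using period_nonzero[of "t * q"] q_not_dvd prime_p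
  by (auto simp: period_shift prime_dvd_mult_iff)

text \<open>As \<eta> has modulus 1, |Q(\<xi>)| differs from 1 by at most |\<beta>|; the other
  factor |Q(\<xi>)| + 1 of |Q(\<xi>)|^2 - 1 is at most 3.\<close>

lemma norm_R_le:
  assumes "cmod (\<beta> t) \<le> 1"
  shows "cmod (cpoly R (e t)) \<le> 3 * cmod (\<beta> t)"
proof -
  define z where "z = cpoly Q (e t)"
  have "cpoly Qr (e t) = e t ^ D * cnj z"
  proof -
    have "e t ^ (D - c i) = e t ^ D * cnj (e t ^ c i)" if "i \<in> I" for i
    proof -
      have "cnj (e t ^ c i) * e t ^ c i = 1"
        using complex_norm_square[of "e t ^ c i"] by (simp add: norm_power mult.commute)
      moreover have "e t ^ D = e t ^ (D - c i) * e t ^ c i"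
        using c_le_D[OF that] by (simp flip: power_add)
      ultimately show ?thesis by (simp add: mult_ac)
    qed
    then show ?thesis by (simp add: z_def poly_Q poly_Qr sum_distrib_left)
  qed
  then have "cpoly R (e t) = e t ^ D * (z * cnj z - 1)"
    by (simp add: poly_R z_def algebra_simps)
  also have "z * cnj z - 1 = of_real ((cmod z)\<^sup>2 - 1)" using complex_norm_square[of z] by simp
  finally have eq: "cmod (cpoly R (e t)) = \<bar>(cmod z)\<^sup>2 - 1\<bar>"
    by (simp only: norm_mult norm_power norm_e norm_of_real) simp
  have z: "\<bar>cmod z - 1\<bar> \<le> cmod (\<beta> t)"
    using norm_triangle_ineq3[of z "- e (t * v)"] by (simp add: \<beta>_def z_def)
  then have "cmod z + 1 \<le> 3" using assms by linarith
  then have "\<bar>cmod z - 1\<bar> * \<bar>cmod z + 1\<bar> \<le> cmod (\<beta> t) * 3" using z by (intro mult_mono) auto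
  moreover have "(cmod z)\<^sup>2 - 1 = (cmod z - 1) * (cmod z + 1)" by (simp add: power2_eq_square algebra_simps)
  ultimately show ?thesis unfolding eq by (simp add: abs_mult)
qed

end

subsection \<open>The auxiliary polynomial\<close>

lemma norm_power_minus_one_le:
  fixes w :: complex
  assumes "cmod (w - 1) \<le> \<epsilon>"
  shows "cmod (w ^ n - 1) \<le> (1 + \<epsilon>) ^ n - 1" and "cmod (w ^ n) \<le> (1 + \<epsilon>) ^ n"
proof -
  have \<epsilon>: "0 \<le> \<epsilon>" using assms norm_ge_zero order_trans by blast
  have w: "cmod w \<le> 1 + \<epsilon>" using norm_triangle_ineq[of "w - 1" 1] assms by simp
  show "cmod (w ^ n) \<le> (1 + \<epsilon>) ^ n" for n using w by (simp add: norm_power power_mono)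
  then have *: "cmod (w ^ n) \<le> (1 + \<epsilon>) ^ n" for n .
  show "cmod (w ^ n - 1) \<le> (1 + \<epsilon>) ^ n - 1"
  proof (induction n)
    case (Suc n)
    have "w ^ Suc n - 1 = w ^ n * (w - 1) + (w ^ n - 1)" by (simp add: algebra_simps)
    then have "cmod (w ^ Suc n - 1) \<le> cmod (w ^ n) * cmod (w - 1) + cmod (w ^ n - 1)"
      by (metis norm_mult norm_triangle_ineq)
    also have "\<dots> \<le> (1 + \<epsilon>) ^ n * \<epsilon> + ((1 + \<epsilon>) ^ n - 1)"
      using * assms Suc \<epsilon> by (intro add_mono mult_mono) auto
    finally show ?case by (simp add: algebra_simps)
  qed simp
qed

lemma norm_powers_minus_one_le:
  fixes w z :: complex
  assumes "cmod (w - 1) \<le> \<epsilon>" "cmod (z - 1) \<le> \<epsilon>" "real (m + n) * \<epsilon> \<le> 1"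
  shows "cmod (w ^ m * z ^ n - 1) \<le> 2 * (real (m + n) * \<epsilon>)"
proof -
  have \<epsilon>: "0 \<le> \<epsilon>" using assms(1) norm_ge_zero order_trans by blast
  have "w ^ m * z ^ n - 1 = w ^ m * (z ^ n - 1) + (w ^ m - 1)" by (simp add: algebra_simps)
  then have "cmod (w ^ m * z ^ n - 1) \<le> cmod (w ^ m) * cmod (z ^ n - 1) + cmod (w ^ m - 1)"
    by (metis norm_mult norm_triangle_ineq)
  also have "\<dots> \<le> (1 + \<epsilon>) ^ m * ((1 + \<epsilon>) ^ n - 1) + ((1 + \<epsilon>) ^ m - 1)"
    using norm_power_minus_one_le[OF assms(1)] norm_power_minus_one_le[OF assms(2)] \<epsilon>
    by (intro add_mono mult_mono) auto
  also have "\<dots> = (1 + \<epsilon>) ^ (m + n) - 1" by (simp add: power_add algebra_simps)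
  also have "\<dots> \<le> 2 * (real (m + n) * \<epsilon>)" using one_plus_power_le[OF \<epsilon> assms(3)] by linarith
  finally show ?thesis .
qed

context period_setup
begin

text \<open>For w = e(x - y) the numbers w^n - 1, n < p, sum to -p, while |w^n - 1| <= n |w -
  1|.\<close>

lemma e_separated:
  assumes "e x \<noteq> e y"
  shows "2 / real p \<le> cmod (e x - e y)"
proof -
  define w where "w = e (x - y)"
  have ex: "e x = w * e y" unfolding w_def e_add[symmetric] by simp
  have w1: "w \<noteq> 1" using assms ex by auto
  have wp: "w ^ p = 1" unfolding w_def by (rule e_pow_p)
  have wn: "cmod w = 1" by (simp add: w_def)
  have le: "cmod (w ^ n - 1) \<le> real n * cmod (w - 1)" for n
  proof (induction n)
    case (Suc n)
    have "w ^ Suc n - 1 = w ^ n * (w - 1) + (w ^ n - 1)" by (simp add: algebra_simps)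
    then have "cmod (w ^ Suc n - 1) \<le> cmod (w ^ n) * cmod (w - 1) + cmod (w ^ n - 1)"
      by (metis norm_mult norm_triangle_ineq)
    then show ?case using Suc wn by (simp add: norm_power algebra_simps)
  qed simp
  have "(\<Sum>n<p. w ^ n) = 0" using power_diff_1_eq[of w p] w1 wp by simp
  then have "(\<Sum>n<p. w ^ n - 1) = - of_nat p" by (simp add: sum_subtractf)
  then have "real p = cmod (\<Sum>n<p. w ^ n - 1)" by simp
  also have "\<dots> \<le> (\<Sum>n<p. real n * cmod (w - 1))" using le by (intro sum_norm_le) auto
  also have "\<dots> = (\<Sum>n<p. real n) * cmod (w - 1)" by (simp add: sum_distrib_right)
  also have "(\<Sum>n<p. real n) = real p * (real p - 1) / 2"
    by (induction p) (auto simp: field_simps)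
  also have "real p * (real p - 1) / 2 * cmod (w - 1) \<le> real p * real p / 2 * cmod (w - 1)"
    by (intro mult_right_mono divide_right_mono mult_left_mono) auto
  finally have "2 / real p \<le> cmod (w - 1)" using p_pos by (simp add: field_simps)
  also have "w - 1 = (e x - e y) / e y" using ex by (simp add: field_simps)
  also have "cmod \<dots> = cmod (e x - e y)" by (simp add: norm_divide)
  finally show ?thesis .
qed

end

context lacunary_period
begin

text \<open>If \<open>p dvd m * v + n\<close>, then \<open>\<eta>\<^sup>m \<xi>\<^sup>n = 1\<close>. Where the period is small, \<open>\<eta>\<close> is close to
  \<open>- Q(\<xi>)\<close>, so that \<open>relpoly m n\<close> is small at \<open>\<xi>\<close> as well.\<close>

definition relpoly :: "int \<Rightarrow> int \<Rightarrow> int poly" where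
  "relpoly m n = (- Q) ^ nat m * monom 1 (nat n) - monom 1 (nat (- n))"

lemma poly_relpoly: "cpoly (relpoly m n) (z :: complex) =
    (- cpoly Q z) ^ nat m * z ^ nat n - z ^ nat (- n)"
  by (simp add: relpoly_def of_int_poly_hom.hom_minus of_int_poly_hom.hom_mult of_int_poly_hom.hom_power
      of_int_poly_hom.hom_uminus poly_monom)

text \<open>If p did not divide m, the numbers m (c i + s), with m s - n for index 1, would
  represent m q (g^i - 1) and have size at most 2 K2, against \<open>short_vector_bound\<close>. The
  hypothesis \<open>K1 * p \<le> K2 * K\<close> is what turns |c i + s| <= p/K into the bound
  K2.\<close>

lemma no_short_relation:
  fixes m n :: int and K1 K2 :: nat
  assumes rel: "int p dvd m * v + n" and m: "\<bar>m\<bar> \<le> int K1" and n: "\<bar>n\<bar> \<le> int K2"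
    and K1: "K1 \<ge> 1" "K1 < p" and K2: "K2 < p" and K12: "K1 * p \<le> K2 * K"
    and small: "(2 * f) ^ ((f - 1) * (f - 2)) * (6 * f * K2) ^ (f - 1) < p ^ (f - 2)"
  shows "m = 0 \<and> n = 0"
proof -
  have "0 < K1 * p" using K1 p_pos by simp
  then have pos: "0 < K2" "0 < K" using K12 by (auto intro!: Nat.gr0I)
  have bound: "\<bar>m * y\<bar> \<le> int K2" if y: "int K * \<bar>y\<bar> \<le> int p" for y
  proof -
    have "int K * (\<bar>m\<bar> * \<bar>y\<bar>) = \<bar>m\<bar> * (int K * \<bar>y\<bar>)" by simp
    also have "\<dots> \<le> int K1 * int p" using m y by (intro mult_mono) auto
    also have "\<dots> \<le> int K * int K2" using K12 by (simp add: mult.commute flip: of_nat_mult)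
    finally show ?thesis using pos by (simp add: abs_mult)
  qed
  have s: "int K * \<bar>s\<bar> \<le> int p" using c_zero cs_bound by force
  have "int p dvd m"
  proof (rule ccontr)
    assume m_nd: "\<not> int p dvd m"
    define x where "x i = (if i = 1 then m * s - n else m * (int (c i) + s))" for i
    have "p ^ (f - 2) \<le> (2 * f) ^ ((f - 1) * (f - 2)) * (3 * f * (2 * K2)) ^ (f - 1)"
    proof (rule short_vector_bound[of "m * q" _ x])
      show "\<not> int p dvd m * q" using m_nd q_not_dvd prime_p by (simp add: prime_dvd_mult_iff)
      show "2 * K2 \<ge> 1" using pos by simp
      fix i assume i: "i \<in> {1..<f}"
      show "[x i = m * q * (int g ^ i - 1)] (mod int p)"
      proof (cases "i = 1")
        case True
        have "m * q * (int g ^ i - 1) - x i = m * v + n"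
          using True by (simp add: x_def v_def algebra_simps)
        then have "[m * q * (int g ^ i - 1) = x i] (mod int p)" using rel by (simp add: cong_iff_dvd_diff)
        then show ?thesis by (rule cong_sym)
      next
        case False
        then have "[m * (q * (int g ^ i - 1)) = m * (int (c i) + s)] (mod int p)"
          using i by (intro cong_mult cong_refl c_cong) auto
        then show ?thesis using False by (simp add: x_def mult.assoc cong_sym)
      qed
      show "\<bar>x i\<bar> \<le> int (2 * K2)"
      proof (cases "i = 1")
        case True
        then show ?thesis using bound[OF s] n by (simp add: x_def)
      next
        case False
        then have "\<bar>m * (int (c i) + s)\<bar> \<le> int K2" using i by (intro bound cs_bound) auto
        then show ?thesis using False by (simp add: x_def)
      qed
    qed
    moreover have "3 * f * (2 * K2) = 6 * f * K2" by simp
    ultimately show False using small by (metis not_le)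
  qed
  then have m0: "m = 0" using m K1 zdvd_imp_le[of "int p" "\<bar>m\<bar>"] by force
  then have "int p dvd n" using rel by simp
  then have "n = 0" using n K2 zdvd_imp_le[of "int p" "\<bar>n\<bar>"] by force
  with m0 show ?thesis by simp
qed

lemma relpoly_zero_imp:
  fixes a :: complex
  assumes root: "cpoly R a = 0"
    and z: "cpoly (relpoly m n) a = 0" and m: "m \<ge> 0"
  shows "a \<noteq> 0" "cpoly Q a \<noteq> 0" "(- cpoly Q a) powi m * a powi n = 1"
proof -
  show a: "a \<noteq> 0" using R_0 root by auto
  show Q: "cpoly Q a \<noteq> 0" using root a by (auto simp: poly_R)
  have *: "(- cpoly Q a) ^ nat m * a ^ nat n = a ^ nat (- n)" using z by (simp add: poly_relpoly)
  have "(- cpoly Q a) powi m = (- cpoly Q a) ^ nat m"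
    using m by (simp add: power_int_def)
  moreover have "a powi n = a ^ nat n / a ^ nat (- n)" using a by (auto simp: power_int_def field_simps)
  ultimately have "(- cpoly Q a) powi m * a powi n =
      ((- cpoly Q a) ^ nat m * a ^ nat n) / a ^ nat (- n)" by simp
  also have "\<dots> = 1" unfolding * using a by simp
  finally show "(- cpoly Q a) powi m * a powi n = 1" .
qed

text \<open>A common root of \<open>R\<close> and of \<open>relpoly\<close> for a basis of the relation lattice would be a
  \<open>p\<close>-th root of unity, because \<open>(0, p)\<close> is a relation. Hence some combination of the two
  polynomials has no root in common with \<open>R\<close>.\<close>

lemma auxiliary_poly_exists:
  fixes K1 K2 M L :: nat
  assumes K1: "K1 \<ge> 1" "K1 < p" and K2: "K2 < p" and K12: "K1 * p \<le> K2 * K"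
    and small: "(2 * f) ^ ((f - 1) * (f - 2)) * (6 * f * K2) ^ (f - 1) < p ^ (f - 2)"
    and M: "p \<le> M * (K2 + 1)" and L: "p \<le> K1 * (L + 1)"
  obtains m1 n1 m2 n2 :: int and \<kappa> :: nat where
    "int p dvd m1 * v + n1" "0 \<le> m1" "m1 \<le> int M" "\<bar>n1\<bar> \<le> int (max K2 L)"
    "int p dvd m2 * v + n2" "0 \<le> m2" "m2 \<le> int M" "\<bar>n2\<bar> \<le> int (max K2 L)" "\<kappa> \<le> 2 * D"
    "\<And>a. cpoly R a = 0 \<Longrightarrow>
      cpoly (relpoly m1 n1 + smult (int \<kappa>) (relpoly m2 n2)) a \<noteq> 0"
proof -
  obtain m1 n1 m2 n2 :: int where b: "int p dvd m1 * v + n1" "int p dvd m2 * v + n2"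
    "0 \<le> m1" "m1 \<le> int M" "0 \<le> m2" "m2 \<le> int M" "\<bar>n1\<bar> \<le> int K2" "\<bar>n2\<bar> \<le> int L"
    "\<And>m n. int p dvd m * v + n \<Longrightarrow> \<exists>a b. m = a * m1 + b * m2 \<and> n = a * n1 + b * n2"
  proof (rule lattice_small_basis[of "int p" v K1 K2 M L])
    show "m = 0 \<and> n = 0" if "int p dvd m * v + n" "\<bar>m\<bar> \<le> int K1" "\<bar>n\<bar> \<le> int K2" for m n
      by (rule no_short_relation[OF that K1 K2 K12 small])
    show "int p \<le> int M * (int K2 + 1)"
      using of_nat_mono[OF M, where ?'a = int] by (simp add: algebra_simps)
    show "int p \<le> int K1 * (int L + 1)"
      using of_nat_mono[OF L, where ?'a = int] by (simp add: algebra_simps)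
  qed (use p_pos K1 K2 in auto)
  let ?P = "\<lambda>m n a. cpoly (relpoly m n) a"
  have not_both: "\<not> (?P m1 n1 a = 0 \<and> ?P m2 n2 a = 0)"
    if root: "cpoly R a = 0" for a
  proof
    assume z: "?P m1 n1 a = 0 \<and> ?P m2 n2 a = 0"
    define Y where "Y = - cpoly Q a"
    have nz: "a \<noteq> 0" "Y \<noteq> 0" and eq: "Y powi m1 * a powi n1 = 1" "Y powi m2 * a powi n2 = 1"
      using relpoly_zero_imp[OF root, of m1 n1] relpoly_zero_imp[OF root, of m2 n2] z b(3,5) by (auto simp: Y_def)
    obtain u w where uw: "0 = u * m1 + w * m2" "int p = u * n1 + w * n2"
      using b(9)[of 0 "int p"] by auto
    have "1 = (Y powi m1 * a powi n1) powi u * (Y powi m2 * a powi n2) powi w" by (simp add: eq)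
    also have "\<dots> = Y powi (u * m1 + w * m2) * a powi (u * n1 + w * n2)"
      using nz by (simp add: power_int_mult_distrib power_int_add power_int_mult mult.commute mult.left_commute)
    also have "\<dots> = a ^ p" by (simp flip: uw)
    finally have "a ^ p = 1" by simp
    then show False using R_root_of_unity root by blast
  qed
  obtain as where as: "length as = degree R" "set as = {a. cpoly R a = 0}"
    using int_poly_roots_ex[OF monic_R] by metis
  \<comment> \<open>Each root rules out at most one value of \<kappa>, since two would make both
    polynomials vanish there; there are 2 D + 1 values and at most 2 D roots.\<close>
  have "\<exists>\<kappa>\<le>2 * D. \<forall>a\<in>set as. ?P m1 n1 a + of_nat \<kappa> * ?P m2 n2 a \<noteq> 0"
  proof (rule ccontr)
    assume "\<not> ?thesis"
    then have "\<forall>\<kappa>\<in>{..2 * D}. \<exists>a. a \<in> set as \<and> ?P m1 n1 a + of_nat \<kappa> * ?P m2 n2 a = 0" by auto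
    then obtain h where h: "\<And>\<kappa>. \<kappa> \<le> 2 * D \<Longrightarrow> h \<kappa> \<in> set as"
      "\<And>\<kappa>. \<kappa> \<le> 2 * D \<Longrightarrow> ?P m1 n1 (h \<kappa>) + of_nat \<kappa> * ?P m2 n2 (h \<kappa>) = 0" by (metis atMost_iff)
    have "inj_on h {..2 * D}"
    proof (rule inj_onI, rule ccontr)
      fix x y assume xy: "x \<in> {..2 * D}" "y \<in> {..2 * D}" "h x = h y" "x \<noteq> y"
      have "(of_nat x - of_nat y) * ?P m2 n2 (h x) =
          (?P m1 n1 (h x) + of_nat x * ?P m2 n2 (h x)) - (?P m1 n1 (h x) + of_nat y * ?P m2 n2 (h x))"
        by (simp add: algebra_simps)
      also have "\<dots> = 0" using h(2)[of x] h(2)[of y] xy by simp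
      finally have "?P m2 n2 (h x) = 0" using xy(4) by simp
      moreover from this have "?P m1 n1 (h x) = 0" using h(2)[of x] xy by simp
      ultimately show False using not_both h(1)[of x] xy as(2) by auto
    qed
    then have "card {..2 * D} \<le> card (set as)"
      by (rule card_inj_on_le) (use h(1) in auto)
    also have "\<dots> \<le> 2 * D" using card_length[of as] as(1) degree_R by simp
    finally show False by simp
  qed
  then obtain \<kappa> where \<kappa>: "\<kappa> \<le> 2 * D" "\<And>a. a \<in> set as \<Longrightarrow> ?P m1 n1 a + of_nat \<kappa> * ?P m2 n2 a \<noteq> 0" by auto
  show ?thesis
  proof (rule that[of m1 n1 m2 n2 \<kappa>])
    show "cpoly (relpoly m1 n1 + smult (int \<kappa>) (relpoly m2 n2)) a \<noteq> 0"
      if "cpoly R a = 0" for a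
      using \<kappa>(2)[of a] that
      by (simp add: as(2) of_int_poly_hom.hom_add of_int_hom.map_poly_hom_smult)
  qed (use b \<kappa> in auto)
qed

lemma norm_relpoly_near:
  fixes a :: complex
  assumes rel: "int p dvd m * v + n" and m: "m \<ge> 0"
    and near_Q: "cmod (- cpoly Q a - e (t * v)) \<le> \<epsilon>" and near: "cmod (a - e t) \<le> \<epsilon>"
    and small: "(real_of_int m + real_of_int \<bar>n\<bar>) * \<epsilon> \<le> 1"
  shows "cmod (cpoly (relpoly m n) a) \<le> 2 * ((real_of_int m + real_of_int \<bar>n\<bar>) * \<epsilon>)"
proof -
  define w where "w = - cpoly Q a / e (t * v)"
  define z where "z = a / e t"
  have "w - 1 = (- cpoly Q a - e (t * v)) / e (t * v)" by (simp add: w_def field_simps)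
  then have w: "cmod (w - 1) \<le> \<epsilon>" using near_Q by (simp add: norm_divide)
  have "z - 1 = (a - e t) / e t" by (simp add: z_def field_simps)
  then have z: "cmod (z - 1) \<le> \<epsilon>" using near by (simp add: norm_divide)
  have \<epsilon>: "0 \<le> \<epsilon>" using near norm_ge_zero order_trans by blast
  define u where "u = e t ^ nat (- n)"
  have u_eq: "e (t * v) ^ nat m * e t ^ nat n = u"
  proof -
    have "e (t * v) ^ nat m * e t ^ nat n = e (t * (m * v + n)) * e t ^ nat (- n)"
      unfolding e_power e_add[symmetric] using m
      by (intro arg_cong[of _ _ e]) (cases "n \<ge> 0"; simp add: algebra_simps)
    also have "e (t * (m * v + n)) = 1" using rel by (simp add: e_eq_1_iff)
    finally show ?thesis by (simp add: u_def)
  qed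
  have "cpoly (relpoly m n) a = (w * e (t * v)) ^ nat m * (z * e t) ^ nat n - (z * e t) ^ nat (- n)"
    by (simp add: poly_relpoly w_def z_def)
  also have "\<dots> = u * (w ^ nat m * z ^ nat n) - u * z ^ nat (- n)"
    by (simp add: power_mult_distrib flip: u_eq) (simp add: u_eq u_def)
  also have "\<dots> = u * ((w ^ nat m * z ^ nat n - 1) - (z ^ nat (- n) - 1))" by (simp add: algebra_simps)
  finally have "cmod (cpoly (relpoly m n) a) =
      cmod ((w ^ nat m * z ^ nat n - 1) - (w ^ 0 * z ^ nat (- n) - 1))"
    by (simp add: norm_mult u_def norm_power)
  also have "\<dots> \<le> cmod (w ^ nat m * z ^ nat n - 1) + cmod (w ^ 0 * z ^ nat (- n) - 1)"
    by (rule norm_triangle_ineq4)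
  also have "\<dots> \<le> 2 * (real (nat m + nat n) * \<epsilon>) + 2 * (real (0 + nat (- n)) * \<epsilon>)"
  proof (intro add_mono norm_powers_minus_one_le w z)
    have "real (nat m + nat n) \<le> real_of_int m + real_of_int \<bar>n\<bar>" using m by (cases "n \<ge> 0") auto
    then show "real (nat m + nat n) * \<epsilon> \<le> 1" using small \<epsilon> by (meson mult_right_mono order_trans)
    have "real (0 + nat (- n)) \<le> real_of_int m + real_of_int \<bar>n\<bar>" using m by (cases "n \<ge> 0") auto
    then show "real (0 + nat (- n)) * \<epsilon> \<le> 1" using small \<epsilon> by (meson mult_right_mono order_trans)
  qed
  also have "\<dots> = 2 * ((real_of_int m + real_of_int \<bar>n\<bar>) * \<epsilon>)"
    using m by (cases "n \<ge> 0") (auto simp: algebra_simps)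
  finally show ?thesis .
qed

lemma norm_relpoly_le:
  fixes a :: complex
  assumes "0 \<le> m" "m \<le> int M" "\<bar>n\<bar> \<le> int W"
  shows "cmod (cpoly (relpoly m n) a) \<le> 2 * (real f ^ M * max 1 (cmod a) ^ (D * M + W))"
proof -
  define x where "x = max 1 (cmod a)"
  have x: "1 \<le> x" "cmod a \<le> x" by (auto simp: x_def)
  have pow: "cmod a ^ i \<le> x ^ j" if "i \<le> j" for i j
  proof -
    have "cmod a ^ i \<le> x ^ i" using x by (intro power_mono) auto
    also have "\<dots> \<le> x ^ j" using x that by (intro power_increasing) auto
    finally show ?thesis .
  qed
  have "cmod (cpoly Q a) \<le> (\<Sum>i\<in>I. x ^ D)"
    unfolding poly_Q using pow c_le_D by (intro sum_norm_le) (auto simp: norm_power)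
  also have "\<dots> \<le> real f * x ^ D" using x by (simp add: card_I mult_right_mono)
  finally have Qa: "cmod (cpoly Q a) \<le> real f * x ^ D" .
  have f1: "1 \<le> real f * x ^ D"
    using mult_mono[of 1 "real f" 1 "x ^ D"] f_ge_3 one_le_power[OF x(1), of D] by simp
  have "cmod (cpoly (relpoly m n) a) \<le>
      cmod (cpoly Q a) ^ nat m * cmod a ^ nat n + cmod a ^ nat (- n)"
    unfolding poly_relpoly
    using norm_triangle_ineq4[of "(- cpoly Q a) ^ nat m * a ^ nat n" "a ^ nat (- n)"]
    by (simp add: norm_mult norm_power)
  also have "\<dots> \<le> (real f * x ^ D) ^ M * x ^ W + (real f * x ^ D) ^ M * x ^ W"
  proof (intro add_mono mult_mono)
    have "cmod (cpoly Q a) ^ nat m \<le> (real f * x ^ D) ^ nat m"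
      using Qa by (intro power_mono) auto
    also have "\<dots> \<le> (real f * x ^ D) ^ M" using assms f1 by (intro power_increasing) auto
    finally show "cmod (cpoly Q a) ^ nat m \<le> (real f * x ^ D) ^ M" .
    show "cmod a ^ nat n \<le> x ^ W" using assms by (intro pow) auto
    have "cmod a ^ nat (- n) \<le> 1 * x ^ W" using assms by (simp, intro pow) auto
    also have "\<dots> \<le> (real f * x ^ D) ^ M * x ^ W" using f1 x by (intro mult_right_mono one_le_power) auto
    finally show "cmod a ^ nat (- n) \<le> (real f * x ^ D) ^ M * x ^ W" .
  qed (use x in auto)
  also have "\<dots> = 2 * (real f ^ M * x ^ (D * M + W))"
    by (simp add: power_mult_distrib power_add mult.commute flip: power_mult)
  finally show ?thesis unfolding x_def .
qed

subsection \<open>Small periods\<close>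

text \<open>With k = f^2 bounding the number of terms of R and y the k-th root of |\<beta>|, every
  error is y times a fixed power of p. The threshold exponent 8 f^2 makes y <= p^(-8), and p >= 4000
  absorbs each numerical constant, the largest being 3852, into one more power of p.\<close>

lemma near_root:
  fixes t m1 n1 m2 n2 :: int and \<kappa> M W :: nat
  assumes t: "\<not> int p dvd t" and small: "cmod (\<beta> t) < 1 / real p ^ (8 * f\<^sup>2)"
    and p: "p \<ge> 4000" and D: "D \<le> p" and M: "M \<le> p" and W: "W \<le> p" and \<kappa>: "\<kappa> \<le> 2 * D"
    and 1: "int p dvd m1 * v + n1" "0 \<le> m1" "m1 \<le> int M" "\<bar>n1\<bar> \<le> int W"
    and 2: "int p dvd m2 * v + n2" "0 \<le> m2" "m2 \<le> int M" "\<bar>n2\<bar> \<le> int W"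
  shows "\<exists>a. cpoly R a = 0 \<and> cmod (e t - a) < 1 / real p \<and>
    cmod (cpoly (relpoly m1 n1 + smult (int \<kappa>) (relpoly m2 n2)) a)
      \<le> real p ^ 8 * root (f\<^sup>2) (cmod (\<beta> t))"
proof -
  define k where "k = f\<^sup>2"
  have k0: "k > 0" using f_ge_3 by (simp add: k_def)
  define y where "y = root k (cmod (\<beta> t))"
  have \<beta>0: "cmod (\<beta> t) > 0" using \<beta>_nonzero[OF t] by simp
  have y0: "y > 0" using \<beta>0 k0 by (simp add: y_def)
  have yk: "y ^ k = cmod (\<beta> t)" using k0 by (simp add: y_def)
  have p0: "real p > 0" using p by simp
  have p1: "real p \<ge> 1" using p by simp
  have y_small: "y * real p ^ 8 \<le> 1"
  proof -
    have "y ^ k < (1 / real p ^ 8) ^ k"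
      unfolding yk using small by (simp add: k_def power_one_over flip: power_mult)
    then have "y < 1 / real p ^ 8" by (rule power_less_imp_less_base) simp
    then show ?thesis using p0 by (simp add: field_simps)
  qed
  have y_pow: "y * real p ^ j \<le> 1" if "j \<le> 8" for j
  proof -
    have "y * real p ^ j \<le> y * real p ^ 8" using y0 p1 that by (intro mult_left_mono power_increasing) auto
    then show ?thesis using y_small by linarith
  qed
  have y_pow': "y * real p ^ j \<le> 1 / real p ^ (8 - j)" if "j \<le> 8" for j
  proof -
    have "y * real p ^ j * real p ^ (8 - j) \<le> 1" using y_small that by (simp add: mult.assoc flip: power_add)
    then show ?thesis using p0 by (simp add: field_simps)
  qed
  have y1: "y \<le> 1" using y_pow[of 0] by simp
  have \<beta>_le: "cmod (\<beta> t) \<le> y" unfolding yk[symmetric]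
    using power_decreasing[of 1 k y] k0 y0 y1 by simp
  \<comment> \<open>Chosen so that \<delta> / (8 k deg R) = 10 y, as deg R = 2 D; the k-th power
    10^k |\<beta>| of this exceeds 3 |R(\<xi>)|, which is at most 9 |\<beta>|.\<close>
  define \<delta> where "\<delta> = 160 * real k * real D * y"
  have fp: "real f \<le> real p" using p_gt_f by simp
  have Dp: "real D \<le> real p" using D by simp
  have D1: "1 \<le> real D" using D_pos by simp
  have \<delta>0: "\<delta> > 0" using y0 k0 D_pos by (simp add: \<delta>_def)
  have \<delta>_le: "\<delta> \<le> 160 * real p ^ 3 * y"
  proof -
    have "real k * real D \<le> (real p * real p) * real p"
      unfolding k_def power2_eq_square of_nat_mult using fp Dp by (intro mult_mono) auto
    then have "160 * (real k * real D) * y \<le> 160 * ((real p * real p) * real p) * y"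
      using y0 by (intro mult_right_mono mult_left_mono) auto
    then show ?thesis by (simp add: \<delta>_def power3_eq_cube mult.assoc)
  qed
  have p160: "160 * (y * real p ^ j) \<le> 1 / real p ^ (7 - j)" if "j \<le> 7" for j
  proof -
    have "160 * (y * real p ^ j) \<le> real p * (y * real p ^ j)" using p y0 by (intro mult_right_mono) auto
    also have "\<dots> = y * real p ^ Suc j" by simp
    also have "\<dots> \<le> 1 / real p ^ (7 - j)" using y_pow'[of "Suc j"] that by simp
    finally show ?thesis .
  qed
  have \<delta>4: "\<delta> \<le> 1 / real p ^ 4" using \<delta>_le p160[of 3] by (simp add: mult_ac)
  have \<delta>_p: "\<delta> < 1 / real p"
  proof -
    have "real p < real p ^ 4" using p by (intro power_strict_increasing[of 1 4, simplified]) auto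
    then have "1 / real p ^ 4 < 1 / real p" using p0 by (simp add: frac_less2)
    then show ?thesis using \<delta>4 by linarith
  qed
  have \<delta>1: "\<delta> \<le> 1" 
  proof -
    have "1 / real p \<le> 1" using p1 by (simp add: divide_le_eq_1)
    then show ?thesis using \<delta>_p by linarith
  qed
  obtain as where as: "(\<Prod>a\<leftarrow>as. [:- a, 1:]) = map_poly of_int R" "length as = degree R"
    "set as = {a. cpoly R a = 0}"
    using int_poly_roots_ex[OF monic_R] by metis
  have "\<exists>a\<in>set as. cmod (e t - a) < \<delta>"
  proof (rule fewnomial_root_near[OF as(1) as(2) _ card_support_R norm_e \<delta>0 \<delta>1])
    show "0 < degree R" using degree_R D_pos by simp
    have "\<delta> / (8 * real (f\<^sup>2) * real (degree R)) = 10 * y"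
      using k0 D_pos by (simp add: \<delta>_def k_def degree_R)
    then have "(\<delta> / (8 * real (f\<^sup>2) * real (degree R))) ^ f\<^sup>2 = 10 ^ k * cmod (\<beta> t)"
      by (simp add: power_mult_distrib flip: k_def yk)
    moreover have "(10::real) ^ 1 \<le> 10 ^ k" using k0 by (intro power_increasing) auto
    then have "10 * cmod (\<beta> t) \<le> 10 ^ k * cmod (\<beta> t)" by (intro mult_right_mono) auto
    moreover have "cmod (cpoly R (e t)) \<le> 3 * cmod (\<beta> t)"
      using \<beta>_le y1 by (intro norm_R_le) linarith
    ultimately show "3 * cmod (cpoly R (e t)) <
        (\<delta> / (8 * real (f\<^sup>2) * real (degree R))) ^ f\<^sup>2" using \<beta>0 by linarith
  qed
  then obtain a where a: "a \<in> set as" "cmod (e t - a) < \<delta>" by auto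
  \<comment> \<open>Bounds both |a - \<xi>| and |Q(a) + \<eta>|: moving from \<xi> to a changes each
    of the f-1 terms of Q by at most 2 D \<delta>, and |Q(\<xi>) + \<eta>| = |\<beta>|.\<close>
  define \<epsilon> where "\<epsilon> = real (f - 1) * (2 * (real D * \<delta>)) + cmod (\<beta> t)"
  have D\<delta>: "real D * \<delta> \<le> 1"
  proof -
    have "real D * \<delta> \<le> real p * (1 / real p)" using Dp \<delta>_p \<delta>0 by (intro mult_mono) auto
    then show ?thesis using p0 by simp
  qed
  have near_e: "cmod (a / e t - 1) \<le> \<delta>"
  proof -
    have "a / e t - 1 = (a - e t) / e t" by (simp add: field_simps)
    then have "cmod (a / e t - 1) = cmod (e t - a)" by (simp add: norm_divide norm_minus_commute)
    then show ?thesis using a(2) by simp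
  qed
  have nQ: "cmod (- cpoly Q a - e (t * v)) \<le> \<epsilon>"
  proof -
    have each: "cmod (a ^ c i - e t ^ c i) \<le> 2 * (real D * \<delta>)" if "i \<in> I" for i
    proof -
      have "a ^ c i - e t ^ c i = e t ^ c i * ((a / e t) ^ c i - 1)" by (simp add: power_divide right_diff_distrib)
      then have "cmod (a ^ c i - e t ^ c i) = cmod ((a / e t) ^ c i - 1)" by (simp add: norm_mult norm_power)
      also have "\<dots> \<le> (1 + \<delta>) ^ c i - 1" by (rule norm_power_minus_one_le(1)[OF near_e])
      also have "\<dots> \<le> (1 + \<delta>) ^ D - 1" using c_le_D[OF that] \<delta>0 by (simp add: power_increasing)
      also have "\<dots> \<le> 2 * (real D * \<delta>)" using one_plus_power_le[of \<delta> D] \<delta>0 D\<delta> by simp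
      finally show ?thesis .
    qed
    have "- cpoly Q a - e (t * v) = - (\<Sum>i\<in>I. a ^ c i - e t ^ c i) - \<beta> t"
      by (simp add: \<beta>_def poly_Q sum_subtractf)
    then have "cmod (- cpoly Q a - e (t * v)) \<le> cmod (\<Sum>i\<in>I. a ^ c i - e t ^ c i) + cmod (\<beta> t)"
      using norm_triangle_ineq4[of "- (\<Sum>i\<in>I. a ^ c i - e t ^ c i)" "\<beta> t"] by simp
    also have "cmod (\<Sum>i\<in>I. a ^ c i - e t ^ c i) \<le> (\<Sum>i\<in>I. 2 * (real D * \<delta>))" using each by (intro sum_norm_le) auto
    finally show ?thesis by (simp add: \<epsilon>_def card_I)
  qed
  have \<delta>\<epsilon>: "\<delta> \<le> \<epsilon>"
  proof -
    have "1 * (1 * \<delta>) \<le> real (f - 1) * (2 * (real D * \<delta>))"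
      using f_ge_3 D1 \<delta>0 by (intro mult_mono) auto
    then show ?thesis unfolding \<epsilon>_def using norm_ge_zero[of "\<beta> t"] by linarith
  qed
  have \<epsilon>0: "\<epsilon> \<ge> 0" using \<delta>\<epsilon> \<delta>0 by linarith
  have \<epsilon>_le: "\<epsilon> \<le> 321 * real p ^ 5 * y"
  proof -
    have "real (f - 1) * (2 * (real D * \<delta>)) \<le> real p * (2 * (real p * (160 * real p ^ 3 * y)))"
      using fp Dp \<delta>_le \<delta>0 y0 by (intro mult_mono) auto
    also have "\<dots> = 320 * real p ^ 5 * y" by (simp add: power3_eq_cube eval_nat_numeral)
    finally have "\<epsilon> \<le> 320 * real p ^ 5 * y + y" unfolding \<epsilon>_def using \<beta>_le by linarith
    moreover have "1 * y \<le> real p ^ 5 * y" using p1 y0 by (intro mult_right_mono) auto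
    ultimately show ?thesis by (simp add: algebra_simps)
  qed
  have MW: "(real_of_int m + real_of_int \<bar>n\<bar>) * \<epsilon> \<le> 642 * real p ^ 6 * y"
    if "0 \<le> m" "m \<le> int M" "\<bar>n\<bar> \<le> int W" for m n
  proof -
    have "real_of_int m + real_of_int \<bar>n\<bar> \<le> 2 * real p" using that M W by linarith
    then have "(real_of_int m + real_of_int \<bar>n\<bar>) * \<epsilon> \<le> (2 * real p) * (321 * real p ^ 5 * y)"
      using \<epsilon>0 \<epsilon>_le by (intro mult_mono) auto
    then show ?thesis by (simp add: eval_nat_numeral algebra_simps)
  qed
  have small642: "642 * real p ^ 6 * y \<le> 1"
  proof -
    have "642 * (real p ^ 6 * y) \<le> real p * (real p ^ 6 * y)" using p y0 by (intro mult_right_mono) auto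
    also have "\<dots> \<le> 1" using y_pow[of 7] by (simp add: eval_nat_numeral mult_ac)
    finally show ?thesis by simp
  qed
  have near_bound: "cmod (cpoly (relpoly m n) a) \<le> 1284 * real p ^ 6 * y"
    if "int p dvd m * v + n" "0 \<le> m" "m \<le> int M" "\<bar>n\<bar> \<le> int W" for m n
  proof -
    have "cmod (cpoly (relpoly m n) a) \<le> 2 * ((real_of_int m + real_of_int \<bar>n\<bar>) * \<epsilon>)"
    proof (rule norm_relpoly_near[OF that(1,2) nQ])
      show "cmod (a - e t) \<le> \<epsilon>" using a(2) \<delta>\<epsilon> by (simp add: norm_minus_commute)
      show "(real_of_int m + real_of_int \<bar>n\<bar>) * \<epsilon> \<le> 1" using MW[OF that(2-4)] small642 by linarith
    qed
    then show ?thesis using MW[OF that(2-4)] by linarith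
  qed
  have "cmod (cpoly (relpoly m1 n1 + smult (int \<kappa>) (relpoly m2 n2)) a) \<le>
      1284 * real p ^ 6 * y + real \<kappa> * (1284 * real p ^ 6 * y)"
  proof -
    have "cpoly (relpoly m1 n1 + smult (int \<kappa>) (relpoly m2 n2)) a =
        cpoly (relpoly m1 n1) a + of_nat \<kappa> * cpoly (relpoly m2 n2) a"
      by (simp add: of_int_poly_hom.hom_add of_int_hom.map_poly_hom_smult)
    also have "cmod \<dots> \<le> cmod (cpoly (relpoly m1 n1) a) +
        real \<kappa> * cmod (cpoly (relpoly m2 n2) a)"
      using norm_triangle_ineq[of "cpoly (relpoly m1 n1) a"
          "of_nat \<kappa> * cpoly (relpoly m2 n2) a"] by (simp add: norm_mult)
    also have "\<dots> \<le> 1284 * real p ^ 6 * y + real \<kappa> * (1284 * real p ^ 6 * y)"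
      using near_bound[OF 1] near_bound[OF 2] by (intro add_mono mult_left_mono) auto
    finally show ?thesis .
  qed
  also have "\<dots> = (1 + real \<kappa>) * (1284 * real p ^ 6 * y)" by (simp add: algebra_simps)
  also have "\<dots> \<le> (3 * real p) * (1284 * real p ^ 6 * y)"
  proof (rule mult_right_mono)
    have "real \<kappa> \<le> 2 * real p" using \<kappa> D by linarith
    then show "1 + real \<kappa> \<le> 3 * real p" using p1 by linarith
  qed (use y0 in auto)
  also have "\<dots> = 3852 * (real p ^ 7 * y)" by (simp add: eval_nat_numeral mult_ac)
  also have "\<dots> \<le> real p * (real p ^ 7 * y)" using p y0 by (intro mult_right_mono) auto
  also have "\<dots> = real p ^ 8 * root (f\<^sup>2) (cmod (\<beta> t))"
    by (simp add: eval_nat_numeral mult_ac y_def k_def)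
  finally have "cmod (cpoly (relpoly m1 n1 + smult (int \<kappa>) (relpoly m2 n2)) a)
      \<le> real p ^ 8 * root (f\<^sup>2) (cmod (\<beta> t))" .
  moreover have "cpoly R a = 0" using a(1) as(3) by simp
  moreover have "cmod (e t - a) < 1 / real p" using a(2) \<delta>_p by linarith
  ultimately show ?thesis by blast
qed

text \<open>Each small period gives its own root of \<open>R\<close>, where \<open>T\<close> is small; but the product of \<open>\<bar>T\<bar>\<close>
  over all roots of \<open>R\<close> is a positive integer.\<close>

lemma bad_sum:
  fixes K1 K2 M L :: nat
  assumes K1: "K1 \<ge> 1" "K1 < p" and K2: "K2 < p" and K12: "K1 * p \<le> K2 * K"
    and small: "(2 * f) ^ ((f - 1) * (f - 2)) * (6 * f * K2) ^ (f - 1) < p ^ (f - 2)"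
    and M: "p \<le> M * (K2 + 1)" and L: "p \<le> K1 * (L + 1)"
    and p: "p \<ge> 4000" and Dp: "D \<le> p" and Mp: "M \<le> p" and Lp: "L \<le> p"
  defines "Bad \<equiv> {t\<in>{1..<int p}. cmod (\<beta> t) < 1 / real p ^ (8 * f\<^sup>2)}"
  shows "(\<Sum>t\<in>Bad. - ln (cmod (\<beta> t))) \<le> 24 * real (f\<^sup>2) * (real D * real M + real (max K2 L)) * ln (real p)"
proof -
  define W where "W = max K2 L"
  define k where "k = f\<^sup>2"
  have k0: "k > 0" using f_ge_3 by (simp add: k_def)
  have p0: "real p > 0" "ln (real p) > 0" using p by auto
  have Wp: "W \<le> p" using K2 Lp by (simp add: W_def)
  obtain m1 n1 m2 n2 :: int and \<kappa> :: nat where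
    1: "int p dvd m1 * v + n1" "0 \<le> m1" "m1 \<le> int M" "\<bar>n1\<bar> \<le> int W" and
    2: "int p dvd m2 * v + n2" "0 \<le> m2" "m2 \<le> int M" "\<bar>n2\<bar> \<le> int W" and \<kappa>: "\<kappa> \<le> 2 * D" and
    nz: "\<And>a. cpoly R a = 0 \<Longrightarrow>
      cpoly (relpoly m1 n1 + smult (int \<kappa>) (relpoly m2 n2)) a \<noteq> 0"
    unfolding W_def by (rule auxiliary_poly_exists[OF K1 K2 K12 small M L]) blast
  define T where "T = relpoly m1 n1 + smult (int \<kappa>) (relpoly m2 n2)"
  obtain as where as: "(\<Prod>a\<leftarrow>as. [:- a, 1:]) = map_poly of_int R" "length as = degree R"
    "set as = {a. cpoly R a = 0}"
    using int_poly_roots_ex[OF monic_R] by metis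
  define h where "h i = ln (cmod (cpoly T (as ! i)))" for i
  have T_nz: "cpoly T (as ! i) \<noteq> 0" if "i < 2 * D" for i
  proof -
    have "as ! i \<in> set as" using that as(2) degree_R by simp
    then show ?thesis unfolding T_def using nz as(3) by blast
  qed
  have t_nd: "\<not> int p dvd t" if "t \<in> Bad" for t
    using that zdvd_imp_le[of "int p" t] by (auto simp: Bad_def)
  define y where "y t = root k (cmod (\<beta> t))" for t
  have "\<exists>i<2 * D. cmod (e t - as ! i) < 1 / real p \<and> cmod (cpoly T (as ! i)) \<le> real p ^ 8 * y t"
    if t: "t \<in> Bad" for t
  proof -
    have sm: "cmod (\<beta> t) < 1 / real p ^ (8 * f\<^sup>2)" using t by (simp add: Bad_def)
    obtain a where a: "cpoly R a = 0" "cmod (e t - a) < 1 / real p"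
      "cmod (cpoly T a) \<le> real p ^ 8 * y t"
      using near_root[OF t_nd[OF t] sm p Dp Mp Wp \<kappa> 1 2] unfolding T_def y_def k_def by blast
    then have "a \<in> set as" using as(3) by simp
    then obtain i where "i < length as" "as ! i = a" by (auto simp: in_set_conv_nth)
    then show ?thesis using a as(2) degree_R by auto
  qed
  then obtain \<iota> where \<iota>: "\<And>t. t \<in> Bad \<Longrightarrow> \<iota> t < 2 * D"
    "\<And>t. t \<in> Bad \<Longrightarrow> cmod (e t - as ! \<iota> t) < 1 / real p"
    "\<And>t. t \<in> Bad \<Longrightarrow> cmod (cpoly T (as ! \<iota> t)) \<le> real p ^ 8 * y t" by metis
  \<comment> \<open>Distinct p-th roots of unity are at least 2/p apart, so two of them cannot both
    lie within 1/p of the same root of R.\<close>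
  have inj: "inj_on \<iota> Bad"
  proof (rule inj_onI, rule ccontr)
    fix t u assume tu: "t \<in> Bad" "u \<in> Bad" "\<iota> t = \<iota> u" "t \<noteq> u"
    have "cmod (e t - e u) \<le> cmod (e t - as ! \<iota> t) + cmod (e u - as ! \<iota> u)"
      using norm_triangle_ineq4[of "e t - as ! \<iota> t" "e u - as ! \<iota> t"] tu(3) by simp
    also have "\<dots> < 2 / real p" using \<iota>(2)[OF tu(1)] \<iota>(2)[OF tu(2)] by simp
    finally have "e t = e u" using e_separated[of t u] by fastforce
    then have "e (t - u) = 1" using e_add[of "t - u" u] by simp
    then have "int p dvd t - u" by (simp add: e_eq_1_iff)
    then have "[t = u] (mod int p)" by (simp add: cong_iff_dvd_diff)
    then show False using tu by (auto simp: Bad_def cong_def)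
  qed
  \<comment> \<open>\<open>H\<close> is the logarithm of the growth bound for
    \<open>relpoly\<close>, including a factor 1 + 2 D for the combination with \<kappa> <= 2
    D.\<close>
  define A where "A = ln (2 * (1 + 2 * real D)) + real M * ln (real f)"
  define B where "B = real (D * M + W)"
  define H where "H i = A + B * ln (max 1 (cmod (as ! i)))" for i
  have lnf: "ln (real f) \<ge> 0" using f_ge_3 by simp
  have A0: "A \<ge> 0" unfolding A_def using lnf D_pos by simp
  have B0: "B \<ge> 0" by (simp add: B_def)
  have H0: "H i \<ge> 0" for i unfolding H_def using A0 B0 by simp
  have h_le: "h i \<le> H i" if i: "i < 2 * D" for i
  proof -
    define x where "x = max 1 (cmod (as ! i))"
    define E where "E = 2 * (real f ^ M * x ^ (D * M + W))"
    have E_pos: "E > 0" unfolding E_def x_def using f_ge_3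
      by (intro mult_pos_pos zero_less_power) (auto simp: less_max_iff_disj)
    then have E0: "E \<ge> 0" by simp
    have "cmod (cpoly T (as ! i)) \<le> cmod (cpoly (relpoly m1 n1) (as ! i)) +
        real \<kappa> * cmod (cpoly (relpoly m2 n2) (as ! i))"
      unfolding T_def
      using norm_triangle_ineq[of "cpoly (relpoly m1 n1) (as ! i)"
          "of_nat \<kappa> * cpoly (relpoly m2 n2) (as ! i)"]
      by (simp add: norm_mult of_int_poly_hom.hom_add of_int_hom.map_poly_hom_smult)
    also have "\<dots> \<le> E + real \<kappa> * E"
      unfolding E_def x_def using 1 2 by (intro add_mono mult_left_mono norm_relpoly_le) auto
    also have "\<dots> = (1 + real \<kappa>) * E" by (simp add: algebra_simps)
    also have "\<dots> \<le> (1 + 2 * real D) * E" using \<kappa> E0 by (intro mult_right_mono) auto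
    finally have "h i \<le> ln ((1 + 2 * real D) * E)"
      unfolding h_def using T_nz[OF i] E_pos D_pos by (subst ln_le_cancel_iff) (auto intro!: mult_pos_pos)
    also have "(1 + 2 * real D) * E = (2 * (1 + 2 * real D)) * (real f ^ M * x ^ (D * M + W))"
      by (simp add: E_def)
    also have "ln \<dots> = H i"
      using f_ge_3 D_pos by (simp add: H_def A_def B_def x_def ln_mult ln_realpow)
    finally show ?thesis .
  qed
  obtain N :: int where N: "of_int N = (\<Prod>a\<leftarrow>as. cpoly T a)"
    using prod_roots_int[OF monic_R _ as(1), of T] degree_R D_pos by auto
  have N_prod: "(\<Prod>a\<leftarrow>as. cpoly T a) = (\<Prod>i<2 * D. cpoly T (as ! i))"
    using as(2) degree_R by (simp add: prod.list_conv_set_nth atLeast0LessThan)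
  have sum_h: "0 \<le> (\<Sum>i<2 * D. h i)"
  proof -
    have "N \<noteq> 0"
    proof
      assume "N = 0"
      then have "(\<Prod>i<2 * D. cpoly T (as ! i)) = 0" using N N_prod by simp
      then show False using T_nz by (auto simp: prod_zero_iff)
    qed
    then have "1 \<le> \<bar>N\<bar>" by simp
    then have "1 \<le> cmod (of_int N)" by (simp add: norm_of_int)
    also have "\<dots> = (\<Prod>i<2 * D. cmod (cpoly T (as ! i)))"
      unfolding N N_prod by (rule prod_norm[symmetric])
    finally have "0 \<le> ln (\<Prod>i<2 * D. cmod (cpoly T (as ! i)))" by simp
    also have "\<dots> = (\<Sum>i<2 * D. h i)" unfolding h_def using T_nz by (intro ln_prod) auto
    finally show ?thesis .
  qed
  have card_Bad: "card Bad \<le> 2 * D"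
    using card_inj_on_le[OF inj, of "{..<2 * D}"] \<iota>(1) by auto
  have each: "- ln (cmod (\<beta> t)) \<le> real k * (8 * ln (real p) - h (\<iota> t))" if t: "t \<in> Bad" for t
  proof -
    have \<beta>0: "cmod (\<beta> t) > 0" using \<beta>_nonzero[OF t_nd[OF t]] by simp
    have y0: "y t > 0" using \<beta>0 k0 by (simp add: y_def)
    have "y t ^ k = cmod (\<beta> t)" using k0 by (simp add: y_def)
    then have "ln (cmod (\<beta> t)) = real k * ln (y t)" using y0 by (metis ln_realpow)
    moreover have "h (\<iota> t) \<le> ln (real p ^ 8 * y t)"
      unfolding h_def using T_nz[OF \<iota>(1)[OF t]] \<iota>(3)[OF t] p0 y0 by (subst ln_le_cancel_iff) auto
    then have "h (\<iota> t) \<le> 8 * ln (real p) + ln (y t)" using p0 y0 by (simp add: ln_mult ln_realpow)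
    then have "real k * (- ln (y t)) \<le> real k * (8 * ln (real p) - h (\<iota> t))"
      by (intro mult_left_mono) auto
    ultimately show ?thesis by simp
  qed
  have "(\<Sum>t\<in>Bad. - ln (cmod (\<beta> t))) \<le> (\<Sum>t\<in>Bad. real k * (8 * ln (real p) - h (\<iota> t)))"
    using each by (intro sum_mono) auto
  also have "\<dots> = real k * (8 * ln (real p) * real (card Bad) - (\<Sum>t\<in>Bad. h (\<iota> t)))"
    by (simp add: sum_subtractf right_diff_distrib sum_distrib_left)
  also have "(\<Sum>t\<in>Bad. h (\<iota> t)) = (\<Sum>i\<in>\<iota> ` Bad. h i)" using inj by (simp add: sum.reindex)
  finally have sum_le: "(\<Sum>t\<in>Bad. - ln (cmod (\<beta> t))) \<le>
    real k * (8 * ln (real p) * real (card Bad) - (\<Sum>i\<in>\<iota> ` Bad. h i))" .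
  have "8 * ln (real p) * real (card Bad) - (\<Sum>i\<in>\<iota> ` Bad. h i) \<le>
      8 * ln (real p) * real (2 * D) + (2 * real D * A + B * ln (real (f\<^sup>2)))"
  proof -
    have sub: "\<iota> ` Bad \<subseteq> {..<2 * D}" using \<iota>(1) by auto
    \<comment> \<open>The logarithms over all 2 D roots sum to at least 0, so those at the roots hit
      by \<open>Bad\<close> are compensated by the others, which are bounded by \<open>H\<close>; as
      \<open>H\<close> is nonnegative, its sum may run over all roots.\<close>
    have "- (\<Sum>i\<in>\<iota> ` Bad. h i) \<le> (\<Sum>i\<in>{..<2 * D} - \<iota> ` Bad. h i)"
      using sum_h sum.subset_diff[OF sub, of h] by simp
    also have "\<dots> \<le> (\<Sum>i\<in>{..<2 * D} - \<iota> ` Bad. H i)" using h_le by (intro sum_mono) auto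
    also have "\<dots> \<le> (\<Sum>i<2 * D. H i)" using H0 by (intro sum_mono2) auto
    also have "\<dots> = 2 * real D * A + B * (\<Sum>i<2 * D. ln (max 1 (cmod (as ! i))))"
      by (simp add: H_def sum.distrib sum_distrib_left)
    also have "(\<Sum>i<2 * D. ln (max 1 (cmod (as ! i)))) = ln (\<Prod>i<2 * D. max 1 (cmod (as ! i)))"
      by (rule ln_prod[symmetric]) auto
    also have "(\<Prod>i<2 * D. max 1 (cmod (as ! i))) = (\<Prod>a\<leftarrow>as. max 1 (cmod a))"
      using as(2) degree_R by (simp add: prod.list_conv_set_nth atLeast0LessThan)
    also have "ln (\<Prod>a\<leftarrow>as. max 1 (cmod a)) \<le> ln (real (f\<^sup>2))"
    proof -
      have "0 < (\<Prod>a\<leftarrow>as. max 1 (cmod a))" by (induction as) auto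
      then show ?thesis using mahler_R[OF as(1)] by (subst ln_le_cancel_iff) (use f_ge_3 in auto)
    qed
    finally have "- (\<Sum>i\<in>\<iota> ` Bad. h i) \<le> 2 * real D * A + B * ln (real (f\<^sup>2))" using B0 by (simp add: mult_left_mono)
    moreover have "8 * ln (real p) * real (card Bad) \<le> 8 * ln (real p) * real (2 * D)"
      using card_Bad p0 by (intro mult_left_mono) auto
    ultimately show ?thesis by linarith
  qed
  also have "8 * ln (real p) * real (2 * D) + (2 * real D * A + B * ln (real (f\<^sup>2))) \<le> 24 * B * ln (real p)"
  proof -
    have M1: "1 \<le> real M" using M p by (cases M) auto
    have lnf_le: "ln (real f) \<le> ln (real p)" using p_gt_f f_ge_3 by simp
    have "ln (2 * (1 + 2 * real D)) \<le> ln (real p ^ 2)"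
    proof (subst ln_le_cancel_iff)
      have "real D \<le> real p" "real p \<ge> 4000" using Dp p by auto
      then have "2 + 4 * real D \<le> 6 * real p" by simp
      then have "2 * (1 + 2 * real D) \<le> 6 * real p" by simp
      also have "\<dots> \<le> real p * real p" using p by (intro mult_right_mono) auto
      finally show "2 * (1 + 2 * real D) \<le> real p ^ 2" by (simp add: power2_eq_square)
    qed (use p in auto)
    then have "ln (2 * (1 + 2 * real D)) \<le> 2 * ln (real p)" using p0 by (simp add: ln_realpow)
    also have "\<dots> \<le> 2 * (real M * ln (real p))" using M1 p0 by simp
    finally have "A \<le> 2 * (real M * ln (real p)) + real M * ln (real p)"
      unfolding A_def using lnf_le by (intro add_mono mult_left_mono) auto
    then have A_le: "A \<le> 3 * (real M * ln (real p))" by simp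
    have DM: "real D * real M \<le> B" by (simp add: B_def)
    have "2 * real D * A \<le> 2 * real D * (3 * (real M * ln (real p)))" using A_le by (intro mult_left_mono) auto
    also have "\<dots> = 6 * ((real D * real M) * ln (real p))" by simp
    also have "\<dots> \<le> 6 * (B * ln (real p))" using DM p0 by (intro mult_left_mono mult_right_mono) auto
    finally have x1: "2 * real D * A \<le> 6 * (B * ln (real p))" .
    have "real D * 1 \<le> real D * real M" using M1 by (intro mult_left_mono) auto
    then have "real D * ln (real p) \<le> B * ln (real p)" using DM p0 by (intro mult_right_mono) auto
    then have x2: "8 * ln (real p) * real (2 * D) \<le> 16 * (B * ln (real p))" by (simp add: mult.commute)
    have "ln (real (f\<^sup>2)) = 2 * ln (real f)" using f_ge_3 by (simp add: ln_realpow)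
    then have x3: "B * ln (real (f\<^sup>2)) \<le> 2 * (B * ln (real p))"
      using lnf_le B0 by (simp add: mult_left_mono)
    show ?thesis using add_mono[OF x2 add_mono[OF x1 x3]] by (simp only: mult.assoc)
  qed
  finally have "real k * (8 * ln (real p) * real (card Bad) - (\<Sum>i\<in>\<iota> ` Bad. h i)) \<le> real k * (24 * B * ln (real p))"
    by (intro mult_left_mono) auto
  with sum_le show ?thesis by (simp add: k_def B_def W_def algebra_simps)
qed

end

section \<open>Choice of the parameters in the bound for small periods\<close>

lemma eventually_powr_ge:
  fixes s C :: real
  assumes "s > 0"
  shows "\<forall>\<^sub>F n in at_top. C \<le> real n powr s"
proof -
  have "filterlim (\<lambda>n. real n powr s) at_top at_top" using assms by real_asymp
  then show ?thesis by (simp add: filterlim_at_top)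
qed

context period_setup
begin

lemma sum_mult_mod:
  fixes h :: "int \<Rightarrow> real"
  assumes q: "\<not> int p dvd q" and h: "\<And>x y. [x = y] (mod int p) \<Longrightarrow> h x = h y"
  shows "(\<Sum>t\<in>{1..<int p}. h (t * q)) = (\<Sum>t\<in>{1..<int p}. h t)"
proof -
  define m where "m t = (t * q) mod int p" for t
  have inj: "inj_on m {1..<int p}"
  proof (rule inj_onI)
    fix x y assume xy: "x \<in> {1..<int p}" "y \<in> {1..<int p}" "m x = m y"
    then have "[x * q = y * q] (mod int p)" by (simp add: m_def cong_def)
    then have "int p dvd (x - y) * q" by (simp add: cong_iff_dvd_diff left_diff_distrib)
    then have "int p dvd x - y" using q prime_p by (simp add: prime_dvd_mult_iff)
    then have "[x = y] (mod int p)" by (simp add: cong_iff_dvd_diff)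
    then show "x = y" using xy by (simp add: cong_def)
  qed
  have sub: "m ` {1..<int p} \<subseteq> {1..<int p}"
  proof clarify
    fix t assume t: "t \<in> {1..<int p}"
    have "\<not> int p dvd t" using t zdvd_imp_le[of "int p" t] by auto
    then have "\<not> int p dvd t * q" using q prime_p by (simp add: prime_dvd_mult_iff)
    then have "m t \<noteq> 0" by (simp add: m_def dvd_eq_mod_eq_0)
    moreover have "0 \<le> m t" "m t < int p" using p_pos by (auto simp: m_def)
    ultimately show "m t \<in> {1..<int p}" by simp
  qed
  have img: "m ` {1..<int p} = {1..<int p}"
    by (rule endo_inj_surj[OF _ sub inj]) simp
  have "(\<Sum>t\<in>{1..<int p}. h t) = (\<Sum>t\<in>m ` {1..<int p}. h t)" by (simp only: img)
  also have "\<dots> = (\<Sum>t\<in>{1..<int p}. h (m t))" using inj by (simp add: sum.reindex)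
  also have "\<dots> = (\<Sum>t\<in>{1..<int p}. h (t * q))"
    by (intro sum.cong refl h) (simp add: m_def cong_def)
  finally show ?thesis by simp
qed

lemma period_cong: "[x = y] (mod int p) \<Longrightarrow> period x = period y"
  unfolding period_def by (intro sum.cong refl e_cong cong_mult cong_refl)

definition bad_threshold :: real where
  "bad_threshold = 1 / real p ^ (8 * f\<^sup>2)"

abbreviation small_log_sum :: real where
  "small_log_sum \<equiv> (\<Sum>t\<in>{t\<in>{1..<int p}. cmod (period t) < bad_threshold}. - ln (cmod (period t)))"

text \<open>Up to constants and with x = p, the choices are K = x^a, K2 = x^(1-b) and M = x^b, and D
  is at most x^(1-a). K1 is the largest integer with K1 p <= K2 K, hence about x^(a-b) = x^\<gamma>,
  which makes the bound for n2 about x^(1-\<gamma>). So D M and that bound have the same order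
  x^(1-\<gamma>), and K2 is not larger because \<gamma> <= b.\<close>

lemma period_bad_sum:
  fixes a b \<gamma> c :: real
  defines "b \<equiv> 1 / real (f - 1)" and "a \<equiv> 1 / real (f - 2)" and "\<gamma> \<equiv> 1 / (real (f - 1) * real (f - 2))"
    and "c \<equiv> 1 / (12 * real f * (2 * real f) ^ (f - 2))"
  assumes H1: "8 \<le> real p powr a" and H2: "2 \<le> c * real p powr (1 - b)"
    and H3: "16 \<le> c * real p powr \<gamma>" and p: "p \<ge> 4000"
  shows "small_log_sum \<le>
    24 * real (f\<^sup>2) * (8 * (2 / c + 1) + (c + 16 / c)) * real p powr (1 - \<gamma>) * ln (real p)"
proof -
  define x where "x = real p"
  have x: "x \<ge> 4000" "x > 0" "x \<ge> 1" using p by (auto simp: x_def)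
  have f3: "real f \<ge> 3" "real (f - 1) = real f - 1" "real (f - 2) = real f - 2" using f_ge_3 by auto
  have c0: "c > 0" "c \<le> 1"
  proof -
    have "1 * 1 \<le> (12 * real f) * (2 * real f) ^ (f - 2)" using f3 by (intro mult_mono one_le_power) auto
    then show "c > 0" "c \<le> 1" using f3 by (auto simp: c_def)
  qed
  have ab: "a - b = \<gamma>" "0 < b" "0 < a" "0 < \<gamma>" "b < 1" "a \<le> 1" "\<gamma> \<le> b"
  proof -
    show "a - b = \<gamma>" using f3 by (simp add: a_def b_def \<gamma>_def field_simps)
    have "1 * (real f - 1) \<le> (real f - 2) * (real f - 1)" using f3 by (intro mult_right_mono) auto
    then show "\<gamma> \<le> b" using f3 unfolding \<gamma>_def b_def by (intro divide_left_mono) (auto simp: mult.commute)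
  qed (use f3 in \<open>auto simp: a_def b_def \<gamma>_def\<close>)
  define K where "K = nat \<lfloor>x powr a / 2\<rfloor>"
  have K: "real K \<le> x powr a / 2" "x powr a / 4 \<le> real K" "2 \<le> K"
  proof -
    have y: "x powr a / 2 \<ge> 4" using H1 by (simp add: x_def)
    then have "real K = of_int \<lfloor>x powr a / 2\<rfloor>" by (simp add: K_def)
    then show "real K \<le> x powr a / 2" "x powr a / 4 \<le> real K" using y by linarith+
    then show "2 \<le> K" using y by linarith
  qed
  have Kp: "K ^ (f - 2) < p"
  proof -
    have "real K ^ (f - 2) \<le> (x powr a / 2) ^ (f - 2)" using K by (intro power_mono) auto
    also have "\<dots> = x / 2 ^ (f - 2)"
      using x f3 by (simp add: power_divide powr_realpow powr_powr a_def flip: powr_realpow)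
    also have "\<dots> < x" using x f_ge_3 one_less_power[of "2::real" "f - 2"] by (simp add: divide_less_eq)
    finally show ?thesis by (simp add: x_def flip: of_nat_power)
  qed
  obtain q s c' where lac: "\<not> int p dvd q"
    "\<And>i. i \<in> {..<f} - {1} \<Longrightarrow> [q * (int g ^ i - 1) = int (c' i) + s] (mod int p)"
    "\<And>i. i \<in> {..<f} - {1} \<Longrightarrow> K * c' i \<le> 2 * p"
    "\<And>i. i \<in> {..<f} - {1} \<Longrightarrow> int K * \<bar>int (c' i) + s\<bar> \<le> int p"
    "inj_on c' ({..<f} - {1})" "\<exists>i\<in>{..<f} - {1}. c' i = 0"
    using dirichlet_shift[of K] K(3) Kp by (metis (no_types, lifting) One_nat_def Suc_1 Suc_leD)
  interpret L: lacunary_period f p g K q s c'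
    by unfold_locales (use lac in blast)+
  define K2 where "K2 = nat \<lfloor>c * x powr (1 - b)\<rfloor>"
  have K2: "real K2 \<le> c * x powr (1 - b)" "c * x powr (1 - b) / 2 \<le> real K2" "1 \<le> K2"
  proof -
    have y: "2 \<le> c * x powr (1 - b)" using H2 by (simp add: x_def)
    then have "real K2 = of_int \<lfloor>c * x powr (1 - b)\<rfloor>" by (simp add: K2_def)
    then show "real K2 \<le> c * x powr (1 - b)" "c * x powr (1 - b) / 2 \<le> real K2" using y by linarith+
    then show "1 \<le> K2" using y by linarith
  qed
  have powr_lt: "x powr (1 - b) < x"
    using powr_less_mono[of "1 - b" 1 x] ab x by simp
  have K2p: "real K2 < x"
  proof -
    have "c * x powr (1 - b) \<le> 1 * x powr (1 - b)" using c0 by (intro mult_right_mono) auto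
    then show ?thesis using K2(1) powr_lt by linarith
  qed
  define K1 where "K1 = K2 * K div p"
  have K1p: "K1 * p \<le> K2 * K" unfolding K1_def by simp
  have K2K: "c / 8 * x powr \<gamma> \<le> real K2 * real K / x"
  proof -
    have "(c * x powr (1 - b) / 2) * (x powr a / 4) \<le> real K2 * real K"
      using K K2 c0 by (intro mult_mono) auto
    moreover have "(c * x powr (1 - b) / 2) * (x powr a / 4) = c / 8 * (x powr \<gamma> * x)"
    proof -
      have "x powr (1 - b) * x powr a = x powr (\<gamma> + 1)" using ab(1) by (simp flip: powr_add add: algebra_simps)
      also have "\<dots> = x powr \<gamma> * x" using x by (simp add: powr_add)
      finally show ?thesis by (simp add: field_simps)
    qed
    ultimately have "c / 8 * (x powr \<gamma> * x) \<le> real K2 * real K" by linarith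
    then show ?thesis using x by (simp add: pos_le_divide_eq mult.assoc)
  qed
  have K1_ge: "c / 16 * x powr \<gamma> \<le> real K1" "1 \<le> K1"
  proof -
    have "real K2 * real K / x < real K1 + 1"
    proof -
      have "K2 * K < (K1 + 1) * p" unfolding K1_def using p_pos dividend_less_div_times[of p "K2 * K"] by simp
      then have "real (K2 * K) < real ((K1 + 1) * p)" by (simp only: of_nat_less_iff)
      then show ?thesis using x by (simp add: x_def field_simps)
    qed
    moreover have "16 \<le> c * x powr \<gamma>" using H3 by (simp add: x_def)
    ultimately have "c / 16 * x powr \<gamma> \<le> real K1" "1 \<le> real K1" using K2K by linarith+
    then show "c / 16 * x powr \<gamma> \<le> real K1" "1 \<le> K1" by auto
  qed
  have "x powr a \<le> x powr 1" using ab x by (intro powr_mono) auto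
  then have Kx: "real K \<le> x / 2" using K x by simp
  have K1_lt: "K1 < p"
  proof -
    have "real (K1 * p) \<le> real (K2 * K)" using K1p by (simp only: of_nat_le_iff)
    also have "\<dots> \<le> x * (x / 2)" unfolding of_nat_mult using K2p Kx x by (intro mult_mono) auto
    finally have "real K1 \<le> x / 2" using x by (simp add: x_def)
    then show ?thesis using x by (simp add: x_def)
  qed
  define M where "M = p div (K2 + 1) + 1"
  define L' where "L' = p div K1"
  have Mp: "p \<le> M * (K2 + 1)" unfolding M_def using dividend_less_div_times[of "K2 + 1" p] by simp
  have Lp: "p \<le> K1 * (L' + 1)" unfolding L'_def using dividend_less_div_times[of K1 p] K1_ge by (simp add: mult.commute)
  have M_le: "real M \<le> (2 / c + 1) * x powr b" "M \<le> p"
  proof -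
    have "real (p div (K2 + 1)) \<le> x / real (K2 + 1)" unfolding x_def by (rule of_nat_div_le_of_nat)
    also have "\<dots> \<le> x / real K2" using K2(3) x by (intro divide_left_mono) auto
    also have "\<dots> \<le> x / (c * x powr (1 - b) / 2)" using K2 c0 x by (intro divide_left_mono) auto
    also have "\<dots> = 2 / c * x powr b" using x c0 by (simp add: powr_diff field_simps)
    finally have "real M \<le> 2 / c * x powr b + 1" by (simp add: M_def)
    also have "1 \<le> x powr b" using x ab by (simp add: ge_one_powr_ge_zero)
    finally show "real M \<le> (2 / c + 1) * x powr b" by (simp add: algebra_simps)
    have "p div (K2 + 1) \<le> p div 2" using K2(3) by (intro div_le_mono2) auto
    then show "M \<le> p" using p unfolding M_def by linarith
  qed
  have L_le: "real L' \<le> 16 / c * x powr (1 - \<gamma>)" "L' \<le> p"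
  proof -
    have "real L' \<le> x / real K1" unfolding L'_def x_def by (rule of_nat_div_le_of_nat)
    also have "\<dots> \<le> x / (c / 16 * x powr \<gamma>)" using K1_ge c0 x by (intro divide_left_mono) auto
    also have "\<dots> = 16 / c * x powr (1 - \<gamma>)" using x c0 by (simp add: powr_diff field_simps)
    finally show "real L' \<le> 16 / c * x powr (1 - \<gamma>)" .
    show "L' \<le> p" by (simp add: L'_def)
  qed
  have KD: "real K * real L.D \<le> 2 * x"
    using L.K_mult_D_le unfolding x_def by (metis of_nat_le_iff of_nat_mult of_nat_numeral)
  have D_le: "real L.D \<le> 8 * x powr (1 - a)" "L.D \<le> p"
  proof -
    have "x powr a / 4 * real L.D \<le> real K * real L.D" using K by (intro mult_right_mono) auto
    then have "x powr a * real L.D \<le> 8 * x" using KD by simp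
    then show "real L.D \<le> 8 * x powr (1 - a)" using x by (simp add: powr_diff field_simps)
    have "2 * L.D \<le> K * L.D" using K by (intro mult_right_mono) auto
    then show "L.D \<le> p" using L.K_mult_D_le by linarith
  qed
  \<comment> \<open>This fixes c: (2f)^(f-2) * 6 f * c = 1/2, so the left side is at most
    (x^(1-b)/2)^(f-1), which is below x^(f-2) because (1-b)(f-1) = f-2.\<close>
  have small: "(2 * f) ^ ((f - 1) * (f - 2)) * (6 * f * K2) ^ (f - 1) < p ^ (f - 2)"
  proof -
    have "(2 * real f) ^ (f - 2) * (6 * real f * real K2) \<le> (2 * real f) ^ (f - 2) * (6 * real f * (c * x powr (1 - b)))"
      using K2 f3 by (intro mult_left_mono) auto
    also have "\<dots> = x powr (1 - b) / 2" using f3 by (simp add: c_def field_simps)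
    finally have "((2 * real f) ^ (f - 2) * (6 * real f * real K2)) ^ (f - 1) \<le> (x powr (1 - b) / 2) ^ (f - 1)"
      by (intro power_mono) auto
    also have "\<dots> < (x powr (1 - b)) ^ (f - 1)" using x f_ge_3 by (intro power_strict_mono) auto
    also have "\<dots> = x powr ((1 - b) * real (f - 1))" using x by (simp add: powr_powr flip: powr_realpow)
    also have "(1 - b) * real (f - 1) = real (f - 2)" using f3 by (simp add: b_def field_simps)
    also have "x powr real (f - 2) = x ^ (f - 2)" using x by (simp add: powr_realpow)
    finally have "real ((2 * f) ^ ((f - 1) * (f - 2)) * (6 * f * K2) ^ (f - 1)) < real (p ^ (f - 2))"
      by (simp add: x_def power_mult_distrib mult.commute flip: power_mult)
    then show ?thesis by (simp only: of_nat_less_iff)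
  qed
  have "small_log_sum =
      (\<Sum>t\<in>{1..<int p}. if cmod (period t) < bad_threshold then - ln (cmod (period t)) else 0)"
    by (rule sum.inter_filter) simp
  also have "\<dots> = (\<Sum>t\<in>{1..<int p}. if cmod (period (t * q)) < bad_threshold then - ln (cmod (period (t * q))) else 0)"
    by (rule sum_mult_mod[OF lac(1), symmetric]) (simp add: period_cong)
  also have "\<dots> = (\<Sum>t\<in>{t\<in>{1..<int p}. cmod (L.\<beta> t) < bad_threshold}. - ln (cmod (L.\<beta> t)))"
    unfolding L.norm_\<beta> by (rule sum.inter_filter[symmetric]) simp
  also have "\<dots> \<le> 24 * real (f\<^sup>2) * (real L.D * real M + real (max K2 L')) * ln (real p)"
    unfolding bad_threshold_def
    using K1_ge K1_lt K2p K1p small Mp Lp p D_le M_le L_le by (intro L.bad_sum) (auto simp: x_def)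
  also have "\<dots> \<le> 24 * real (f\<^sup>2) * ((8 * (2 / c + 1) + (c + 16 / c)) * x powr (1 - \<gamma>)) * ln (real p)"
  proof (intro mult_right_mono mult_left_mono)
    have "real L.D * real M \<le> (8 * x powr (1 - a)) * ((2 / c + 1) * x powr b)"
      using D_le M_le by (intro mult_mono) auto
    also have "\<dots> = 8 * (2 / c + 1) * (x powr (1 - a) * x powr b)" by simp
    also have "x powr (1 - a) * x powr b = x powr (1 - \<gamma>)" using ab(1) by (simp flip: powr_add add: algebra_simps)
    finally have DM: "real L.D * real M \<le> 8 * (2 / c + 1) * x powr (1 - \<gamma>)" .
    have "c * x powr (1 - b) \<le> c * x powr (1 - \<gamma>)" using ab x c0 by (intro mult_left_mono powr_mono) auto
    moreover have "real (max K2 L') \<le> real K2 + real L'" by simp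
    ultimately have "real (max K2 L') \<le> c * x powr (1 - \<gamma>) + 16 / c * x powr (1 - \<gamma>)"
      using K2(1) L_le(1) by linarith
    then show "real L.D * real M + real (max K2 L') \<le> (8 * (2 / c + 1) + (c + 16 / c)) * x powr (1 - \<gamma>)"
      using DM by (simp only: ring_distribs)
  qed (use x in \<open>auto simp: x_def\<close>)
  finally show ?thesis by (simp add: x_def mult_ac)
qed

end

lemma period_bad_sum_asymptotic:
  assumes f: "prime f" "odd f"
  obtains C p0 where "\<And>p g. period_setup f p g \<Longrightarrow> p \<ge> p0 \<Longrightarrow>
    period_setup.small_log_sum f p g
      \<le> C * real p powr (1 - 1 / (real (f - 1) * real (f - 2))) * ln (real p)"
proof -
  have f3: "f \<ge> 3" using prime_ge_2_nat[OF f(1)] f(2) by (cases "f = 2") auto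
  define b where "b = 1 / real (f - 1)"
  define a where "a = 1 / real (f - 2)"
  define \<gamma> where "\<gamma> = 1 / (real (f - 1) * real (f - 2))"
  define c where "c = 1 / (12 * real f * (2 * real f) ^ (f - 2))"
  have c0: "c > 0" using f3 by (simp add: c_def)
  have pos: "a > 0" "1 - b > 0" "\<gamma> > 0" using f3 by (auto simp: a_def b_def \<gamma>_def)
  have "\<forall>\<^sub>F n in at_top. 8 \<le> real n powr a \<and> 2 / c \<le> real n powr (1 - b) \<and> 16 / c \<le> real n powr \<gamma> \<and> n \<ge> 4000"
    by (intro eventually_conj eventually_powr_ge pos eventually_ge_at_top)
  then obtain p0 where p0: "\<And>n. n \<ge> p0 \<Longrightarrow>
      8 \<le> real n powr a \<and> 2 / c \<le> real n powr (1 - b) \<and> 16 / c \<le> real n powr \<gamma> \<and> n \<ge> 4000"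
    by (auto simp: eventually_at_top_linorder)
  show ?thesis
  proof (rule that[of p0 "24 * real (f\<^sup>2) * (8 * (2 / c + 1) + (c + 16 / c))"])
    fix p g assume set: "period_setup f p g" and p: "p \<ge> p0"
    interpret period_setup f p g by (rule set)
    from p0[OF p] have *: "8 \<le> real p powr a" "2 \<le> c * real p powr (1 - b)" "16 \<le> c * real p powr \<gamma>" "p \<ge> 4000"
      using c0 by (auto simp: divide_le_eq mult.commute)
    show "small_log_sum
      \<le> 24 * real (f\<^sup>2) * (8 * (2 / c + 1) + (c + 16 / c)) *
        real p powr (1 - 1 / (real (f - 1) * real (f - 2))) * ln (real p)"
      using period_bad_sum *[unfolded a_def b_def c_def \<gamma>_def] unfolding c_def by blast
  qed
qed

subsection \<open>The torus\<close>

lemma leval_one_plus_sum_lvar: "leval (1 + (\<Sum>i = 1..n. lvar i)) z = 1 + (\<Sum>i = 1..n. z i)"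
proof -
  define P where "P = 1 + (\<Sum>i = 1..n. lvar i)"
  define u where "u i = Poly_Mapping.single i (1::int)" for i :: nat
  define S where "S = insert 0 (u ` {1..n})"
  define h where "h e = Poly_Mapping.lookup P e * (\<Prod>i\<in>Poly_Mapping.keys e. z i powi Poly_Mapping.lookup e i)" for e
  have u_inj: "u i = u j \<longleftrightarrow> i = j" and u_nz: "u i \<noteq> 0" for i j
  proof -
    have *: "Poly_Mapping.lookup (u i) j = (if i = j then 1 else 0)" for i j
      by (simp add: u_def lookup_single when_def)
    show "u i = u j \<longleftrightarrow> i = j" using * by (metis zero_neq_one)
    show "u i \<noteq> 0" using *[of i i] by auto
  qed
  have lookup_P: "Poly_Mapping.lookup P e = (if e = 0 then 1 else 0) + (\<Sum>i = 1..n. if e = u i then 1 else 0)" for e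
    by (auto simp: P_def lookup_add lookup_sum lookup_one lvar_def lookup_single when_def u_def intro!: sum.cong)
  have sub: "Poly_Mapping.keys P \<subseteq> S"
  proof
    fix e assume "e \<in> Poly_Mapping.keys P"
    then have "Poly_Mapping.lookup P e \<noteq> 0" by (simp add: in_keys_iff)
    moreover have "Poly_Mapping.lookup P e = 0" if "\<not> (e = 0 \<or> (\<exists>i\<in>{1..n}. e = u i))"
      unfolding lookup_P using that by (auto intro!: sum.neutral)
    ultimately have "e = 0 \<or> (\<exists>i\<in>{1..n}. e = u i)" by blast
    then show "e \<in> S" by (auto simp: S_def)
  qed
  have "leval P z = (\<Sum>e\<in>S. h e)"
    unfolding leval_def h_def using sub
    by (intro sum.mono_neutral_left) (auto simp: S_def in_keys_iff)
  also have "\<dots> = h 0 + (\<Sum>e\<in>u ` {1..n}. h e)"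
    unfolding S_def using u_nz by (subst sum.insert) auto
  also have "(\<Sum>e\<in>u ` {1..n}. h e) = (\<Sum>i = 1..n. h (u i))"
    using u_inj by (intro sum.reindex_cong[of u]) (auto simp: inj_on_def)
  also have "\<dots> = (\<Sum>i = 1..n. z i)"
  proof (intro sum.cong refl)
    fix i assume i: "i \<in> {1..n}"
    have "Poly_Mapping.lookup P (u i) = (\<Sum>j = 1..n. if i = j then 1 else 0)"
      unfolding lookup_P using u_nz u_inj by simp
    also have "\<dots> = 1" using i by simp
    finally show "h (u i) = z i" by (simp add: h_def u_def)
  qed
  also have "h 0 = 1" unfolding h_def lookup_P using u_nz by (simp add: eq_commute[of 0])
  finally show ?thesis by (simp add: P_def)
qed

definition cube :: "nat \<Rightarrow> (nat \<Rightarrow> real) set" where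
  "cube n = (\<Pi>\<^sub>E i\<in>{1..n}. {0..1})"

definition torus :: "nat \<Rightarrow> (nat \<Rightarrow> real) measure" where
  "torus n = restrict_space (\<Pi>\<^sub>M i\<in>{1..n}. lborel) (cube n)"

definition lin :: "nat \<Rightarrow> (nat \<Rightarrow> real) \<Rightarrow> complex" where
  "lin n x = 1 + (\<Sum>i = 1..n. cis (2 * pi * x i))"

interpretation lborel: product_sigma_finite "\<lambda>_::nat. lborel :: real measure" ..

lemma cube_sets [measurable]: "cube n \<in> sets (\<Pi>\<^sub>M i\<in>{1..n}. lborel)"
  unfolding cube_def by (intro sets_PiM_I_finite) auto

lemma space_torus: "space (torus n) = cube n"
  by (auto simp: torus_def space_restrict_space cube_def space_PiM PiE_def)

lemma prob_space_torus: "prob_space (torus n)"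
proof (rule prob_spaceI)
  have "emeasure (torus n) (space (torus n)) = emeasure (\<Pi>\<^sub>M i\<in>{1..n}. lborel) (cube n)"
    unfolding space_torus unfolding torus_def using cube_sets
    by (intro emeasure_restrict_space) (auto simp: cube_def space_PiM PiE_def)
  also have "\<dots> = 1"
    unfolding cube_def by (subst lborel.emeasure_PiM) auto
  finally show "emeasure (torus n) (space (torus n)) = 1" .
qed

lemma integral_torus:
  fixes h :: "(nat \<Rightarrow> real) \<Rightarrow> 'b :: {banach, second_countable_topology}"
  shows "(\<integral>x. h x \<partial>torus n) = (\<integral>x. indicator (cube n) x *\<^sub>R h x \<partial>(\<Pi>\<^sub>M i\<in>{1..n}. lborel))"
  unfolding torus_def by (rule integral_restrict_space) (use cube_sets in auto)

lemma log_mahler_eq: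
  "log_mahler n (1 + (\<Sum>i = 1..n. lvar i)) = (\<integral>x. ln (cmod (lin n x)) \<partial>torus n)"
proof -
  have "exp (2 * complex_of_real pi * \<i> * complex_of_real y) = cis (2 * pi * y)" for y
    by (simp add: cis_conv_exp mult_ac)
  then show ?thesis
    unfolding log_mahler_def set_lebesgue_integral_def leval_one_plus_sum_lvar integral_torus cube_def lin_def
    by simp
qed

lemma measurable_cis [measurable]: "cis \<in> borel_measurable borel"
  by (intro borel_measurable_continuous_onI continuous_intros)

lemma measurable_lin [measurable]: "lin n \<in> borel_measurable (\<Pi>\<^sub>M i\<in>{1..n}. lborel)"
  unfolding lin_def by measurable

lemma measurable_lin_torus [measurable]: "lin n \<in> borel_measurable (torus n)"
  unfolding torus_def by (rule measurable_restrict_space1) measurable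

lemma norm_lin_le: "cmod (lin n x) \<le> real n + 1"
proof -
  have "cmod (lin n x) \<le> 1 + (\<Sum>i = 1..n. cmod (cis (2 * pi * x i)))"
    unfolding lin_def by (intro norm_triangle_le add_mono norm_sum) auto
  then show ?thesis by simp
qed

lemma integral_character:
  "(\<integral>y. indicator {0..1} y *\<^sub>R cis (2 * pi * (of_int k * y)) \<partial>lborel) = (if k = 0 then 1 else 0 :: complex)"
proof (cases "k = 0")
  case False
  define c where "c = 2 * pi * of_int k"
  have c: "c \<noteq> 0" using False by (simp add: c_def)
  have "(\<integral>y. indicator {0..1} y *\<^sub>R cis (c * y) \<partial>lborel) = cis (c * 1) / (\<i> * of_real c) - cis (c * 0) / (\<i> * of_real c)"
  proof (rule integral_FTC_Icc)
    fix y :: real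
    have "((\<lambda>z. exp (\<i> * of_real c * z) / (\<i> * of_real c)) has_field_derivative exp (\<i> * of_real c * of_real y)) (at (of_real y))"
      using c by (auto intro!: derivative_eq_intros)
    then have "((\<lambda>y. exp (\<i> * of_real c * of_real y) / (\<i> * of_real c)) has_vector_derivative exp (\<i> * of_real c * of_real y)) (at y within {0..1})"
      by (rule has_vector_derivative_real_field)
    then show "((\<lambda>y. cis (c * y) / (\<i> * of_real c)) has_vector_derivative cis (c * y)) (at y within {0..1})"
      by (simp add: cis_conv_exp mult.assoc)
  qed (auto intro!: continuous_intros)
  also have "cis (c * 1) = 1"
    using cis_multiple_2pi[of "of_int k"] by (simp add: c_def mult_ac)
  finally show ?thesis using False by (simp add: c_def mult.assoc)
qed simp

definition torus_char :: "nat \<Rightarrow> (nat \<Rightarrow> int) \<Rightarrow> (nat \<Rightarrow> real) \<Rightarrow> complex" where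
  "torus_char n b x = cis (2 * pi * (\<Sum>i = 1..n. of_int (b i) * x i))"

lemma measurable_torus_char [measurable]: "torus_char n b \<in> borel_measurable (torus n)"
  unfolding torus_char_def torus_def by (rule measurable_restrict_space1) measurable

lemma torus_char_mult: "torus_char n b x * torus_char n b' x = torus_char n (\<lambda>i. b i + b' i) x"
  by (simp add: torus_char_def cis_mult ring_distribs sum.distrib)

lemma integrable_torus_bounded:
  fixes h :: "(nat \<Rightarrow> real) \<Rightarrow> 'b :: {banach, second_countable_topology}"
  assumes "h \<in> borel_measurable (torus n)" "\<And>x. norm (h x) \<le> B"
  shows "integrable (torus n) h"
proof -
  interpret prob_space "torus n" by (rule prob_space_torus)
  show ?thesis using assms by (intro integrable_const_bound[where B = B]) auto
qed

lemma integrable_torus_char: "integrable (torus n) (torus_char n b)"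
  by (rule integrable_torus_bounded[where B = 1]) (auto simp: torus_char_def)

lemma integral_torus_char: "(\<integral>x. torus_char n b x \<partial>torus n) = (if \<forall>i\<in>{1..n}. b i = 0 then 1 else 0)"
proof -
  have cis_sum: "cis (\<Sum>i\<in>A. h i) = (\<Prod>i\<in>A. cis (h i))" if "finite A" for A :: "nat set" and h
    using that by (induction A rule: finite_induct) (auto simp flip: cis_mult)
  have ind: "indicator (cube n) x = (\<Prod>i = 1..n. indicator {0..1} (x i) :: real)"
    if x: "x \<in> space (\<Pi>\<^sub>M i\<in>{1..n}. (lborel :: real measure))" for x :: "nat \<Rightarrow> real"
  proof (cases "\<forall>i\<in>{1..n}. x i \<in> {0..1}")
    case True
    then have "x \<in> cube n" using x by (auto simp: cube_def space_PiM PiE_iff)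
    moreover have "(\<Prod>i = 1..n. indicator {0..1} (x i) :: real) = 1" using True by (intro prod.neutral) auto
    ultimately show ?thesis by simp
  next
    case False
    then obtain i where i: "i \<in> {1..n}" "x i \<notin> {0..1}" by blast
    then have "x \<notin> cube n" by (auto simp: cube_def PiE_iff)
    moreover have "(\<Prod>i = 1..n. indicator {0..1} (x i) :: real) = 0" using i by (intro prod_zero bexI[of _ i]) auto
    ultimately show ?thesis by simp
  qed
  have "(\<integral>x. torus_char n b x \<partial>torus n) = (\<integral>x. indicator (cube n) x *\<^sub>R torus_char n b x \<partial>(\<Pi>\<^sub>M i\<in>{1..n}. lborel))"
    by (rule integral_torus)
  also have "\<dots> = (\<integral>x. (\<Prod>i = 1..n. indicator {0..1} (x i) *\<^sub>R cis (2 * pi * (of_int (b i) * x i))) \<partial>(\<Pi>\<^sub>M i\<in>{1..n}. lborel))"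
    by (intro Bochner_Integration.integral_cong refl)
       (simp add: ind torus_char_def sum_distrib_left cis_sum scaleR_conv_of_real prod.distrib flip: of_real_prod)
  also have "\<dots> = (\<Prod>i = 1..n. \<integral>y. indicator {0..1} y *\<^sub>R cis (2 * pi * (of_int (b i) * y)) \<partial>lborel)"
  proof (rule lborel.product_integral_prod)
    fix i
    show "integrable lborel (\<lambda>y. indicator {0..1} y *\<^sub>R cis (2 * pi * (of_int (b i) * y)))"
      by (intro borel_integrable_compact continuous_intros) auto
  qed simp
  also have "\<dots> = (\<Prod>i = 1..n. if b i = 0 then 1 else 0)" by (simp only: integral_character)
  also have "\<dots> = (if \<forall>i\<in>{1..n}. b i = 0 then 1 else 0)" by (auto intro!: prod.neutral)
  finally show ?thesis .
qed

text \<open>The constant 1/3 suffices: as pi > 3, it yields sin(pi s) >= s for s in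
  [0, 1/2].\<close>

lemma sin_ge_third:
  assumes "0 \<le> x" "x \<le> pi / 2"
  shows "x / 3 \<le> sin x"
proof -
  have "\<bar>sin x - (\<Sum>m<3. sin_coeff m * x ^ m)\<bar> \<le> inverse (fact 3) * \<bar>x\<bar> ^ 3"
    by (rule Maclaurin_sin_bound)
  then have "\<bar>sin x - x\<bar> * 6 \<le> x ^ 3" using assms by (simp add: eval_nat_numeral sin_coeff_def fact_numeral)
  then have "x - x ^ 3 / 6 \<le> sin x" using abs_ge_minus_self[of "sin x - x"] by (simp add: field_simps)
  moreover have "x ^ 3 \<le> 4 * x"
  proof -
    have "x \<le> 2" using assms pi_half_less_two by simp
    then have "x * x \<le> 2 * 2" using assms by (intro mult_mono) auto
    then have "(x * x) * x \<le> 4 * x" using assms by (intro mult_right_mono) auto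
    then show ?thesis by (simp add: power3_eq_cube)
  qed
  ultimately show ?thesis by linarith
qed

text \<open>The chord has length 2 |sin(pi u)|, which is symmetric under replacing |u| by 1 -
  |u|.\<close>

lemma dist_cis_ge:
  assumes "\<bar>u\<bar> \<le> 1"
  shows "2 * min \<bar>u\<bar> (1 - \<bar>u\<bar>) \<le> cmod (cis (2 * pi * (y + u)) - cis (2 * pi * y))"
proof -
  have *: "s \<le> sin (pi * s)" if "0 \<le> s" "s \<le> 1 / 2" for s
  proof -
    have "s * 3 \<le> s * pi" using pi_gt3 that by (intro mult_left_mono) auto
    moreover have "pi * s / 3 \<le> sin (pi * s)"
      using that mult_left_mono[OF that(2), of pi] by (intro sin_ge_third) auto
    ultimately show ?thesis by (simp add: mult.commute)
  qed
  have "min \<bar>u\<bar> (1 - \<bar>u\<bar>) \<le> sin (pi * \<bar>u\<bar>)"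
  proof (cases "\<bar>u\<bar> \<le> 1 / 2")
    case True
    then show ?thesis using *[of "\<bar>u\<bar>"] by simp
  next
    case False
    then have "1 - \<bar>u\<bar> \<le> sin (pi * (1 - \<bar>u\<bar>))" using assms by (intro *) auto
    also have "\<dots> = sin (pi * \<bar>u\<bar>)" by (simp add: right_diff_distrib sin_diff)
    finally show ?thesis using False by simp
  qed
  also have "sin (pi * \<bar>u\<bar>) \<le> \<bar>sin (pi * u)\<bar>" by (cases "u \<ge> 0") auto
  finally have le: "min \<bar>u\<bar> (1 - \<bar>u\<bar>) \<le> \<bar>sin (pi * u)\<bar>" .
  have "cis (2 * pi * (y + u)) - cis (2 * pi * y) = cis (2 * pi * y + pi * u) * (cis (pi * u) - cis (- (pi * u)))"
    by (simp add: right_diff_distrib cis_mult algebra_simps)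
  also have "cis (pi * u) - cis (- (pi * u)) = 2 * \<i> * of_real (sin (pi * u))"
    by (simp add: complex_eq_iff)
  finally have "cmod (cis (2 * pi * (y + u)) - cis (2 * pi * y)) = 2 * \<bar>sin (pi * u)\<bar>"
    by (simp add: norm_mult)
  with le show ?thesis by simp
qed

text \<open>Two points \<open>y\<close>, \<open>y'\<close> of the set satisfy \<open>\<bar>e(y) - e(y')\<bar> < 2\<epsilon>\<close>, so the set lies
  in an arc around any one of its points.\<close>

lemma emeasure_circle_near:
  fixes w :: complex and \<epsilon> :: real
  assumes "\<epsilon> \<ge> 0"
  shows "emeasure lborel {y\<in>{0..1}. cmod (w + cis (2 * pi * y)) < \<epsilon>} \<le> ennreal (4 * \<epsilon>)"
proof (cases "{y\<in>{0..1}. cmod (w + cis (2 * pi * y)) < \<epsilon>} = {}")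
  case False
  then obtain z where z: "z \<in> {0..1}" "cmod (w + cis (2 * pi * z)) < \<epsilon>" by auto
  \<comment> \<open>The interval around z covers |y - z| < \<epsilon>; the other two pieces cover
    the points close to z across the identification of 0 and 1.\<close>
  have sub: "{y\<in>{0..1}. cmod (w + cis (2 * pi * y)) < \<epsilon>} \<subseteq>
    {z - \<epsilon>..z + \<epsilon>} \<union> ({z + 1 - \<epsilon>..z + 1} \<union> {z - 1..z - 1 + \<epsilon>})"
  proof (rule subsetI)
    fix y :: real assume "y \<in> {y\<in>{0..1}. cmod (w + cis (2 * pi * y)) < \<epsilon>}"
    then have y: "y \<in> {0..1}" "cmod (w + cis (2 * pi * y)) < \<epsilon>" by auto
    have "cmod (cis (2 * pi * y) - cis (2 * pi * z)) < 2 * \<epsilon>"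
      using norm_triangle_ineq4[of "w + cis (2 * pi * y)" "w + cis (2 * pi * z)"] y z by simp
    moreover have "2 * min \<bar>y - z\<bar> (1 - \<bar>y - z\<bar>) \<le> cmod (cis (2 * pi * (z + (y - z))) - cis (2 * pi * z))"
      using y z by (intro dist_cis_ge) auto
    ultimately have "min \<bar>y - z\<bar> (1 - \<bar>y - z\<bar>) < \<epsilon>" by simp
    then show "y \<in> {z - \<epsilon>..z + \<epsilon>} \<union> ({z + 1 - \<epsilon>..z + 1} \<union> {z - 1..z - 1 + \<epsilon>})" using y z by (auto simp: min_def abs_if split: if_splits)
  qed
  have "emeasure lborel {y\<in>{0..1}. cmod (w + cis (2 * pi * y)) < \<epsilon>} \<le>
      emeasure lborel ({z - \<epsilon>..z + \<epsilon>} \<union> ({z + 1 - \<epsilon>..z + 1} \<union> {z - 1..z - 1 + \<epsilon>}))"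
    using sub by (intro emeasure_mono) auto
  also have "\<dots> \<le> emeasure lborel {z - \<epsilon>..z + \<epsilon>} +
      emeasure lborel ({z + 1 - \<epsilon>..z + 1} \<union> {z - 1..z - 1 + \<epsilon>})"
    by (intro emeasure_subadditive) auto
  also have "\<dots> \<le> emeasure lborel {z - \<epsilon>..z + \<epsilon>} + (emeasure lborel {z + 1 - \<epsilon>..z + 1} +
      emeasure lborel {z - 1..z - 1 + \<epsilon>})"
    by (intro add_left_mono emeasure_subadditive) auto
  also have "\<dots> = ennreal (2 * \<epsilon>) + (ennreal \<epsilon> + ennreal \<epsilon>)" using assms by simp
  also have "\<dots> = ennreal (4 * \<epsilon>)" using assms by (simp flip: ennreal_plus)
  finally show ?thesis .
next
  case True
  then show ?thesis by (simp only: emeasure_empty zero_le)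
qed

text \<open>Fubini: with the coordinates 2, ..., n fixed, the first one moves on a circle, and the
  one-dimensional bound is uniform in its centre.\<close>

lemma emeasure_lin_small:
  assumes "n \<ge> 1" "\<epsilon> \<ge> 0"
  shows "emeasure (torus n) {x\<in>space (torus n). cmod (lin n x) < \<epsilon>} \<le> ennreal (4 * \<epsilon>)"
proof -
  let ?M = "\<lambda>_::nat. lborel :: real measure"
  define J where "J = {2..n}"
  have I: "{1..n} = insert 1 J" "1 \<notin> J" "finite J" using assms(1) by (auto simp: J_def)
  define S where "S = {x\<in>cube n. cmod (lin n x) < \<epsilon>}"
  define E where "E = PiE J (\<lambda>_. {0..1::real})"
  have S: "S \<in> sets (PiM {1..n} ?M)"
  proof -
    have "S = cube n \<inter> {x \<in> space (PiM {1..n} ?M). cmod (lin n x) < \<epsilon>}"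
      by (auto simp: S_def cube_def space_PiM PiE_def)
    also have "\<dots> \<in> sets (PiM {1..n} ?M)" by measurable
    finally show ?thesis .
  qed
  have E: "E \<in> sets (PiM J ?M)" unfolding E_def using I by (intro sets_PiM_I_finite) auto
  have "emeasure (torus n) {x\<in>space (torus n). cmod (lin n x) < \<epsilon>} = emeasure (PiM {1..n} ?M) S"
    unfolding space_torus S_def[symmetric] unfolding torus_def using cube_sets
    by (intro emeasure_restrict_space) (auto simp: S_def cube_def space_PiM PiE_def)
  also have "\<dots> = (\<integral>\<^sup>+x. indicator S x \<partial>PiM (insert 1 J) ?M)" using S I by simp
  also have "\<dots> = (\<integral>\<^sup>+x. (\<integral>\<^sup>+y. indicator S (x(1 := y)) \<partial>lborel) \<partial>PiM J ?M)"
    using S I by (intro lborel.product_nn_integral_insert) (auto simp flip: I(1))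
  also have "\<dots> \<le> (\<integral>\<^sup>+x. ennreal (4 * \<epsilon>) * indicator E x \<partial>PiM J ?M)"
  proof (rule nn_integral_mono)
    fix x assume x: "x \<in> space (PiM J ?M)"
    define w where "w = 1 + (\<Sum>i\<in>J. cis (2 * pi * x i))"
    have lin_eq: "lin n (x(1 := y)) = w + cis (2 * pi * y)" for y
    proof -
      have "(\<Sum>i\<in>J. cis (2 * pi * (x(1 := y)) i)) = (\<Sum>i\<in>J. cis (2 * pi * x i))"
        using I by (intro sum.cong) auto
      then show ?thesis unfolding lin_def w_def I(1) using I by simp
    qed
    have cube_iff: "x(1 := y) \<in> cube n \<longleftrightarrow> y \<in> {0..1} \<and> x \<in> E" for y
    proof
      assume "x(1 := y) \<in> cube n"
      then have H: "(x(1 := y)) i \<in> {0..1}" if "i \<in> insert 1 J" for i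
        using that unfolding cube_def I(1) by (rule PiE_mem)
      have "x \<in> E"
        unfolding E_def
      proof (rule PiE_I)
        fix i assume "i \<in> J"
        then show "x i \<in> {0..1}" using H[of i] I by (cases "i = 1") auto
      next
        fix i assume "i \<notin> J"
        then show "x i = undefined" using x by (auto simp: space_PiM PiE_def extensional_def)
      qed
      then show "y \<in> {0..1} \<and> x \<in> E" using H[of 1] by simp
    next
      assume "y \<in> {0..1} \<and> x \<in> E"
      then show "x(1 := y) \<in> cube n"
        unfolding cube_def I(1) E_def by (intro PiE_I) (auto simp: PiE_def extensional_def)
    qed
    have "(\<integral>\<^sup>+y. indicator S (x(1 := y)) \<partial>lborel) =
        (\<integral>\<^sup>+y. indicator {y\<in>{0..1}. cmod (w + cis (2 * pi * y)) < \<epsilon>} y * indicator E x \<partial>lborel)"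
      by (intro nn_integral_cong) (auto simp: S_def cube_iff lin_eq indicator_def simp del: One_nat_def)
    also have "\<dots> = emeasure lborel {y\<in>{0..1}. cmod (w + cis (2 * pi * y)) < \<epsilon>} * indicator E x"
      by (subst nn_integral_multc) auto
    also have "\<dots> \<le> ennreal (4 * \<epsilon>) * indicator E x"
      by (intro mult_right_mono emeasure_circle_near assms) auto
    finally show "(\<integral>\<^sup>+y. indicator S (x(1 := y)) \<partial>lborel) \<le> ennreal (4 * \<epsilon>) * indicator E x" .
  qed
  also have "\<dots> = ennreal (4 * \<epsilon>) * emeasure (PiM J ?M) E" using E by (rule nn_integral_cmult_indicator)
  also have "emeasure (PiM J ?M) E = 1" unfolding E_def using I by (subst lborel.emeasure_PiM) auto
  finally show ?thesis by simp
qed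

subsection \<open>Moments and the Mahler measure\<close>

text \<open>The function v of the overview, for n + 1 = f.\<close>

definition defect :: "nat \<Rightarrow> (nat \<Rightarrow> real) \<Rightarrow> real" where
  "defect n x = 1 - (cmod (lin n x))\<^sup>2 / (real n + 1)\<^sup>2"

definition moment :: "nat \<Rightarrow> nat \<Rightarrow> real" where
  "moment n k = (\<integral>x. defect n x ^ k \<partial>torus n)"

lemma measurable_defect [measurable]: "defect n \<in> borel_measurable (torus n)"
  unfolding defect_def by measurable

lemma defect_nonneg: "0 \<le> defect n x" and defect_le_1: "defect n x \<le> 1"
proof -
  have "(cmod (lin n x))\<^sup>2 \<le> (real n + 1)\<^sup>2" using norm_lin_le[of n x] by (intro power_mono) auto
  then show "0 \<le> defect n x" by (simp add: defect_def divide_le_eq)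
qed (simp add: defect_def)

lemma integrable_defect_power: "integrable (torus n) (\<lambda>x. defect n x ^ k)"
  by (rule integrable_torus_bounded[where B = 1])
     (use defect_nonneg defect_le_1 in \<open>auto intro: power_le_one\<close>)

lemma moment_nonneg: "0 \<le> moment n k"
  unfolding moment_def by (intro integral_nonneg_AE) (simp add: defect_nonneg)

lemma power_one_minus_le:
  fixes s :: real
  assumes "0 < s" "s \<le> 1" "k > 0"
  shows "(1 - s) ^ k \<le> 1 / (real k * s)"
proof -
  have "(1 - s) ^ k * (real k * s) \<le> (1 - s) ^ k * (1 + s) ^ k"
    using Bernoulli_inequality[of s k] assms by (intro mult_left_mono) auto
  also have "\<dots> = (1 - s * s) ^ k" by (simp add: algebra_simps flip: power_mult_distrib)
  also have "\<dots> \<le> 1" using assms mult_mono[of s 1 s 1] by (intro power_le_one) auto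
  finally show ?thesis using assms by (simp add: le_divide_eq)
qed

text \<open>The set where |lin| < \<epsilon> has measure at most 4 \<epsilon>; elsewhere the k-th
  power is at most (n+1)^2 / (k \<epsilon>^2). The choice \<epsilon> = k^(-1/3) balances the
  two.\<close>

lemma moment_bound:
  assumes n: "n \<ge> 1" and k: "k \<ge> 1"
  shows "moment n k \<le> (4 + (real n + 1)\<^sup>2) * real k powr (- 1 / 3)"
proof -
  interpret prob_space "torus n" by (rule prob_space_torus)
  define \<epsilon> where "\<epsilon> = real k powr (- 1 / 3)"
  define r where "r = (real n + 1)\<^sup>2"
  have r: "r \<ge> 1" by (simp add: r_def one_le_power)
  have \<epsilon>: "0 < \<epsilon>" "\<epsilon> \<le> 1"
    using k powr_mono[of "- 1 / 3" 0 "real k"] by (auto simp: \<epsilon>_def)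
  define S where "S = {x\<in>space (torus n). cmod (lin n x) < \<epsilon>}"
  have S: "S \<in> sets (torus n)" unfolding S_def by measurable
  have \<epsilon>r: "0 < \<epsilon>\<^sup>2 / r" "\<epsilon>\<^sup>2 / r \<le> 1"
    using \<epsilon> r by (auto simp: divide_le_eq power_le_one intro: order_trans[of _ 1])
  have "moment n k \<le> (\<integral>x. indicator S x + (1 - \<epsilon>\<^sup>2 / r) ^ k \<partial>torus n)"
    unfolding moment_def
  proof (rule integral_mono)
    show "integrable (torus n) (\<lambda>x. indicator S x + (1 - \<epsilon>\<^sup>2 / r) ^ k)"
      using S by (intro Bochner_Integration.integrable_add integrable_real_indicator) (auto simp: emeasure_eq_measure)
    fix x assume x: "x \<in> space (torus n)"
    show "defect n x ^ k \<le> indicator S x + (1 - \<epsilon>\<^sup>2 / r) ^ k"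
    proof (cases "x \<in> S")
      case True
      have "defect n x ^ k \<le> 1" using defect_nonneg defect_le_1 by (intro power_le_one) auto
      moreover have "0 \<le> (1 - \<epsilon>\<^sup>2 / r) ^ k" using \<epsilon>r by simp
      ultimately show ?thesis using True by simp
    next
      case False
      then have "\<epsilon> \<le> cmod (lin n x)" using x by (simp add: S_def)
      then have "\<epsilon>\<^sup>2 \<le> (cmod (lin n x))\<^sup>2" using \<epsilon> by (intro power_mono) auto
      then have "defect n x \<le> 1 - \<epsilon>\<^sup>2 / r" using r unfolding defect_def r_def by (simp add: divide_right_mono)
      then show ?thesis using False defect_nonneg by (simp add: power_mono)
    qed
  qed (rule integrable_defect_power)
  also have "\<dots> = measure (torus n) S + (1 - \<epsilon>\<^sup>2 / r) ^ k"
    using S by (subst Bochner_Integration.integral_add) (auto simp: emeasure_eq_measure prob_space)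
  also have "\<dots> \<le> 4 * \<epsilon> + 1 / (real k * (\<epsilon>\<^sup>2 / r))"
  proof (intro add_mono power_one_minus_le \<epsilon>r)
    have "ennreal (measure (torus n) S) \<le> ennreal (4 * \<epsilon>)"
      using emeasure_lin_small[OF n, of \<epsilon>] \<epsilon> unfolding S_def emeasure_eq_measure by simp
    then show "measure (torus n) S \<le> 4 * \<epsilon>" using \<epsilon> by simp
  qed (use k in auto)
  also have "1 / (real k * (\<epsilon>\<^sup>2 / r)) = r * \<epsilon>"
  proof -
    have "\<epsilon>\<^sup>2 * \<epsilon> = real k powr (-1)"
      unfolding \<epsilon>_def power2_eq_square using k by (simp flip: powr_add)
    then have "real k * \<epsilon>\<^sup>2 * \<epsilon> = 1" using k by (simp add: powr_minus mult.assoc)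
    then have "1 / (real k * \<epsilon>\<^sup>2) = \<epsilon>" using k \<epsilon> by (simp add: field_simps)
    then show ?thesis using k \<epsilon> r by (simp add: field_simps)
  qed
  finally show ?thesis by (simp add: \<epsilon>_def r_def algebra_simps)
qed

lemma AE_lin_nonzero:
  assumes n: "n \<ge> 1"
  shows "AE x in torus n. lin n x \<noteq> 0"
proof -
  interpret prob_space "torus n" by (rule prob_space_torus)
  define S where "S = {x\<in>space (torus n). lin n x = 0}"
  have S: "S \<in> sets (torus n)" unfolding S_def by measurable
  have "measure (torus n) S \<le> 0"
  proof (rule field_le_epsilon)
    fix \<epsilon> :: real assume \<epsilon>: "\<epsilon> > 0"
    have "emeasure (torus n) S \<le> emeasure (torus n) {x\<in>space (torus n). cmod (lin n x) < \<epsilon> / 4}"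
      using \<epsilon> by (intro emeasure_mono) (auto simp: S_def)
    also have "\<dots> \<le> ennreal (4 * (\<epsilon> / 4))" using \<epsilon> by (intro emeasure_lin_small n) auto
    finally show "measure (torus n) S \<le> 0 + \<epsilon>" using \<epsilon> by (simp add: emeasure_eq_measure)
  qed
  then have "measure (torus n) S = 0" by (simp add: measure_le_0_iff)
  then have "emeasure (torus n) S = 0" by (simp add: emeasure_eq_measure)
  then show ?thesis by (intro AE_I[of _ _ S]) (auto simp: S S_def)
qed

lemma neg_ln_sums:
  fixes u :: real
  assumes "0 \<le> u" "u < 1"
  shows "(\<lambda>k. u ^ Suc k / real (Suc k)) sums (- ln (1 - u))"
proof -
  have "(\<lambda>k. - ((- (- u)) ^ k) / of_nat k) sums ln (1 + - u)"
    using assms by (intro ln_series') auto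
  then have "(\<lambda>k. u ^ k / real k) sums (- ln (1 - u))" using sums_minus by fastforce
  from sums_split_initial_segment[OF this, of 1] show ?thesis by simp
qed

text \<open>For \<open>k > N\<close> one has \<open>u\<^sup>k/k \<le> u\<^sup>N u\<^bsup>k-N\<^esup>/(k-N)\<close>.\<close>

lemma neg_ln_tail_bounds:
  fixes u :: real
  assumes "0 \<le> u" "u < 1"
  shows "0 \<le> - ln (1 - u) - (\<Sum>k<N. u ^ Suc k / real (Suc k))"
    and "- ln (1 - u) - (\<Sum>k<N. u ^ Suc k / real (Suc k)) \<le> u ^ N * - ln (1 - u)"
proof -
  have tail: "(\<lambda>k. u ^ Suc (k + N) / real (Suc (k + N))) sums (- ln (1 - u) - (\<Sum>k<N. u ^ Suc k / real (Suc k)))"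
    using sums_split_initial_segment[OF neg_ln_sums[OF assms], of N] by simp
  show "0 \<le> - ln (1 - u) - (\<Sum>k<N. u ^ Suc k / real (Suc k))"
    by (rule sums_le[OF _ sums_zero tail]) (use assms in auto)
  show "- ln (1 - u) - (\<Sum>k<N. u ^ Suc k / real (Suc k)) \<le> u ^ N * - ln (1 - u)"
  proof (rule sums_le[OF _ tail sums_mult[OF neg_ln_sums[OF assms]]])
    fix k
    have "u ^ Suc (k + N) / real (Suc (k + N)) \<le> u ^ Suc (k + N) / real (Suc k)"
      using assms by (intro divide_left_mono) auto
    then show "u ^ Suc (k + N) / real (Suc (k + N)) \<le> u ^ N * (u ^ Suc k / real (Suc k))"
      by (simp add: power_add mult_ac)
  qed
qed

lemma one_minus_defect: "1 - defect n x = (cmod (lin n x))\<^sup>2 / (real n + 1)\<^sup>2"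
  by (simp add: defect_def)

lemma neg_ln_defect:
  assumes "lin n x \<noteq> 0"
  shows "defect n x < 1" "- ln (1 - defect n x) = ln ((real n + 1)\<^sup>2) - 2 * ln (cmod (lin n x))"
  using assms unfolding one_minus_defect by (auto simp: defect_def ln_div ln_realpow)

lemma summable_powr_Suc:
  assumes "s < -1"
  shows "summable (\<lambda>k. real (Suc k) powr s)"
  using assms summable_Suc_iff[of "\<lambda>k. real k powr s"] by (simp add: summable_real_powr_iff)

definition torus_mean :: "nat \<Rightarrow> real" where
  "torus_mean n = (\<integral>x. ln (cmod (lin n x)) \<partial>torus n)"

lemma moment_term_bound:
  assumes n: "n \<ge> 1"
  shows "moment n (Suc k) / real (Suc k) \<le> (4 + (real n + 1)\<^sup>2) * real (Suc k) powr (- 4 / 3)"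
proof -
  have "moment n (Suc k) / real (Suc k) \<le> (4 + (real n + 1)\<^sup>2) * real (Suc k) powr (- 1 / 3) / real (Suc k)"
    by (intro divide_right_mono moment_bound n) auto
  also have "\<dots> = (4 + (real n + 1)\<^sup>2) * (real (Suc k) powr (- 1 / 3) / real (Suc k))" by simp
  also have "real (Suc k) powr (- 1 / 3) / real (Suc k) = real (Suc k) powr (- 4 / 3)"
    using powr_diff[of "real (Suc k)" "- 1 / 3" 1] by simp
  finally show ?thesis .
qed

lemma summable_moments:
  assumes n: "n \<ge> 1"
  shows "summable (\<lambda>k. moment n (Suc k) / real (Suc k))"
proof (rule summable_comparison_test')
  show "summable (\<lambda>k. (4 + (real n + 1)\<^sup>2) * real (Suc k) powr (- 4 / 3))"
    by (intro summable_mult summable_powr_Suc) auto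
  show "norm (moment n (Suc k) / real (Suc k)) \<le> (4 + (real n + 1)\<^sup>2) * real (Suc k) powr (- 4 / 3)"
    if "k \<ge> 0" for k
    using moment_term_bound[OF n, of k] moment_nonneg[of n "Suc k"] by simp
qed

text \<open>Term-by-term integration of the series for -log(1 - v). Its terms are nonnegative, so
  the summability of norms that this requires is that of the moments divided by k, and integrability
  of the limit comes along.\<close>

lemma torus_mean_sums:
  assumes n: "n \<ge> 1"
  shows "(\<lambda>k. moment n (Suc k) / real (Suc k)) sums (ln ((real n + 1)\<^sup>2) - 2 * torus_mean n)"
proof -
  interpret prob_space "torus n" by (rule prob_space_torus)
  define h where "h k x = defect n x ^ Suc k / real (Suc k)" for k x
  have int_h: "integrable (torus n) (h k)" for k
    unfolding h_def using integrable_defect_power[of n "Suc k"] by (rule integrable_divide_zero[rotated])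
  have integral_h: "(\<integral>x. h k x \<partial>torus n) = moment n (Suc k) / real (Suc k)" for k
    unfolding h_def moment_def by (rule integral_divide_zero)
  have norm_h: "norm (h k x) = h k x" for k x by (simp add: h_def defect_nonneg)
  have AE_sum: "AE x in torus n. (\<lambda>k. h k x) sums (ln ((real n + 1)\<^sup>2) - 2 * ln (cmod (lin n x)))"
    using AE_lin_nonzero[OF n]
  proof eventually_elim
    case (elim x)
    show ?case using neg_ln_sums[OF defect_nonneg neg_ln_defect(1)[OF elim]] neg_ln_defect(2)[OF elim]
      unfolding h_def by simp
  qed
  have AE_summable: "AE x in torus n. summable (\<lambda>k. norm (h k x))"
    using AE_sum unfolding norm_h by eventually_elim (rule sums_summable)
  have summ: "summable (\<lambda>k. \<integral>x. norm (h k x) \<partial>torus n)"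
    unfolding norm_h integral_h by (rule summable_moments[OF n])
  note thms = int_h AE_summable summ
  have int_S: "integrable (torus n) (\<lambda>x. suminf (\<lambda>k. h k x))" by (rule integrable_suminf[OF thms])
  have "torus_mean n = (\<integral>x. (ln ((real n + 1)\<^sup>2) - (suminf (\<lambda>k. h k x))) / 2 \<partial>torus n)"
    unfolding torus_mean_def
  proof (rule integral_cong_AE)
    show "(\<lambda>x. (ln ((real n + 1)\<^sup>2) - (suminf (\<lambda>k. h k x))) / 2) \<in> borel_measurable (torus n)"
      using int_S by measurable
    show "AE x in torus n. ln (cmod (lin n x)) = (ln ((real n + 1)\<^sup>2) - (suminf (\<lambda>k. h k x))) / 2"
      using AE_sum by eventually_elim (auto dest: sums_unique[symmetric])
  qed measurable
  also have "\<dots> = (ln ((real n + 1)\<^sup>2) - (\<integral>x. (suminf (\<lambda>k. h k x)) \<partial>torus n)) / 2"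
    using int_S by (simp add: prob_space)
  finally have "(\<integral>x. (suminf (\<lambda>k. h k x)) \<partial>torus n) = ln ((real n + 1)\<^sup>2) - 2 * torus_mean n" by simp
  moreover have "(\<lambda>k. \<integral>x. h k x \<partial>torus n) sums (\<integral>x. (suminf (\<lambda>k. h k x)) \<partial>torus n)"
    by (rule sums_integral[OF thms])
  ultimately show ?thesis by (simp add: integral_h)
qed

lemma moment_tail_bound:
  assumes n: "n \<ge> 1"
  obtains C where "\<And>N. N \<ge> 1 \<Longrightarrow>
    \<bar>ln ((real n + 1)\<^sup>2) - 2 * torus_mean n - (\<Sum>k<N. moment n (Suc k) / real (Suc k))\<bar> \<le> C * real N powr (- 1 / 6)"
proof
  define C where "C = (4 + (real n + 1)\<^sup>2)"
  have C0: "C \<ge> 0" by (simp add: C_def)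
  define Z where "Z = suminf (\<lambda>k. real (Suc k) powr (- 7 / 6))"
  have sumZ: "summable (\<lambda>k. real (Suc k) powr (- 7 / 6))" by (rule summable_powr_Suc) simp
  fix N :: nat assume N: "N \<ge> 1"
  have tail: "(\<lambda>k. moment n (Suc (k + N)) / real (Suc (k + N))) sums
      (ln ((real n + 1)\<^sup>2) - 2 * torus_mean n - (\<Sum>k<N. moment n (Suc k) / real (Suc k)))"
    using sums_split_initial_segment[OF torus_mean_sums[OF n], of N] by simp
  have "0 \<le> ln ((real n + 1)\<^sup>2) - 2 * torus_mean n - (\<Sum>k<N. moment n (Suc k) / real (Suc k))"
    by (rule sums_le[OF _ sums_zero tail]) (simp add: moment_nonneg)
  moreover have "ln ((real n + 1)\<^sup>2) - 2 * torus_mean n - (\<Sum>k<N. moment n (Suc k) / real (Suc k)) \<le>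
      (C * real N powr (- 1 / 6)) * Z"
  proof (rule sums_le[OF _ tail])
    show "(\<lambda>k. (C * real N powr (- 1 / 6)) * real (Suc k) powr (- 7 / 6)) sums ((C * real N powr (- 1 / 6)) * Z)"
      unfolding Z_def by (intro sums_mult summable_sums sumZ)
    fix k
    have "moment n (Suc (k + N)) / real (Suc (k + N)) \<le> C * real (Suc (k + N)) powr (- 4 / 3)"
      unfolding C_def by (rule moment_term_bound[OF n])
    \<comment> \<open>Splitting off the exponent 1/6 gives a power of N and leaves the summable
      exponent -7/6.\<close>
    also have "real (Suc (k + N)) powr (- 4 / 3) = real (Suc (k + N)) powr (- 1 / 6) * real (Suc (k + N)) powr (- 7 / 6)"
      by (simp flip: powr_add)
    also have "C * \<dots> \<le> C * (real N powr (- 1 / 6) * real (Suc k) powr (- 7 / 6))"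
      using N C0 by (intro mult_left_mono mult_mono powr_mono2') auto
    finally show "moment n (Suc (k + N)) / real (Suc (k + N)) \<le> (C * real N powr (- 1 / 6)) * real (Suc k) powr (- 7 / 6)"
      by (simp add: mult.assoc)
  qed
  ultimately show "\<bar>ln ((real n + 1)\<^sup>2) - 2 * torus_mean n - (\<Sum>k<N. moment n (Suc k) / real (Suc k))\<bar> \<le> (C * Z) * real N powr (- 1 / 6)"
    by (simp add: mult_ac)
qed

subsection \<open>Equidistribution\<close>

text \<open>Trigonometric polynomials of degree at most k in each variable. The inductive form lets
  products and averages be treated rule by rule, without families of coefficients.\<close>

inductive trig :: "nat \<Rightarrow> nat \<Rightarrow> ((nat \<Rightarrow> real) \<Rightarrow> complex) \<Rightarrow> bool" for n where
  character: "(\<And>i. i \<in> {1..n} \<Longrightarrow> \<bar>b i\<bar> \<le> int k) \<Longrightarrow> trig n k (\<lambda>x. a * torus_char n b x)"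
| plus: "trig n k F \<Longrightarrow> trig n k G \<Longrightarrow> trig n k (\<lambda>x. F x + G x)"

lemma trig_mult_torus_char:
  assumes "trig n k F" "\<And>i. i \<in> {1..n} \<Longrightarrow> \<bar>b i\<bar> \<le> int l"
  shows "trig n (k + l) (\<lambda>x. F x * (a * torus_char n b x))"
  using assms(1)
proof induction
  case (character b' k a')
  have "trig n (k + l) (\<lambda>x. (a' * a) * torus_char n (\<lambda>i. b' i + b i) x)"
  proof (rule trig.character)
    fix i assume "i \<in> {1..n}"
    then show "\<bar>b' i + b i\<bar> \<le> int (k + l)" using character[of i] assms(2)[of i] by linarith
  qed
  then show ?case by (simp add: mult_ac flip: torus_char_mult)
next
  case (plus k F G)
  then show ?case using trig.plus by (simp add: ring_distribs)
qed

lemma trig_mult: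
  assumes "trig n l G" "trig n k F"
  shows "trig n (k + l) (\<lambda>x. F x * G x)"
  using assms(1)
proof induction
  case (character b l a)
  then show ?case using trig_mult_torus_char[OF assms(2)] by blast
next
  case (plus l G H)
  then show ?case using trig.plus by (simp add: ring_distribs)
qed

lemma trig_const: "trig n k (\<lambda>x. a)"
  using trig.character[of n "\<lambda>_. 0" k a] by (simp add: torus_char_def)

lemma trig_sum:
  assumes "finite A" "\<And>i. i \<in> A \<Longrightarrow> trig n k (F i)"
  shows "trig n k (\<lambda>x. \<Sum>i\<in>A. F i x)"
  using assms by (induction A rule: finite_induct) (auto intro: trig_const trig.plus)

lemma trig_power: "trig n 1 F \<Longrightarrow> trig n k (\<lambda>x. F x ^ k)"
proof (induction k)
  case (Suc k)
  then show ?case using trig_mult[of n k "\<lambda>x. F x ^ k" 1 F] by simp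
qed (simp add: trig_const)

text \<open>|lin|^2 expands into products \<open>w i x * cnj (w j x)\<close> with
  \<open>w 0 x = 1\<close>, each a character with exponents -1, 0 or 1; hence degree 1.\<close>

lemma trig_defect: "trig n 1 (\<lambda>x. of_real (defect n x))"
proof -
  define w where "w i x = (if i = 0 then 1 else cis (2 * pi * x i))" for i :: nat and x :: "nat \<Rightarrow> real"
  have lin_w: "lin n x = (\<Sum>i\<in>{0..n}. w i x)" for x
  proof -
    have "{0..n} = insert 0 {1..n}" by auto
    then show ?thesis by (simp add: lin_def w_def del: atLeast0AtMost)
  qed
  have wc: "w i x * cnj (w j x) = 1 * torus_char n (\<lambda>l. (if l = i then 1 else 0) - (if l = j then 1 else 0)) x"
    if "i \<in> {0..n}" "j \<in> {0..n}" for i j x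
  proof -
    have w_cis: "w i x = cis (2 * pi * (\<Sum>l = 1..n. (if l = i then 1 else 0) * x l))" if "i \<in> {0..n}" for i
    proof -
      have "(\<Sum>l = 1..n. (if l = i then 1 else 0) * x l) = (\<Sum>l = 1..n. if l = i then x i else 0)"
        by (intro sum.cong) auto
      then show ?thesis using that by (auto simp: w_def)
    qed
    have eq: "(\<Sum>l = 1..n. of_int ((if l = i then 1 else 0) - (if l = j then 1 else 0)) * x l) =
        (\<Sum>l = 1..n. (if l = i then 1 else 0) * x l) - (\<Sum>l = 1..n. (if l = j then 1 else 0) * x l)"
      unfolding sum_subtractf[symmetric] by (intro sum.cong) auto
    show ?thesis
      unfolding w_cis[OF that(1)] w_cis[OF that(2)] torus_char_def eq cis_cnj
      by (simp add: cis_mult right_diff_distrib)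
  qed
  have "trig n 1 (\<lambda>x. 1 + complex_of_real (- 1 / (real n + 1)\<^sup>2) * (\<Sum>i\<in>{0..n}. \<Sum>j\<in>{0..n}. w i x * cnj (w j x)))"
  proof (rule trig.plus[OF trig_const])
    have "trig n 1 (\<lambda>x. \<Sum>i\<in>{0..n}. \<Sum>j\<in>{0..n}. w i x * cnj (w j x))"
    proof (intro trig_sum finite_atLeastAtMost)
      fix i j assume ij: "i \<in> {0..n}" "j \<in> {0..n}"
      show "trig n 1 (\<lambda>x. w i x * cnj (w j x))"
        unfolding wc[OF ij] by (rule trig.character) auto
    qed
    from trig_mult[OF this trig_const[of n 0 "complex_of_real (- 1 / (real n + 1)\<^sup>2)"]]
    show "trig n 1 (\<lambda>x. complex_of_real (- 1 / (real n + 1)\<^sup>2) * (\<Sum>i\<in>{0..n}. \<Sum>j\<in>{0..n}. w i x * cnj (w j x)))"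
      by (simp only: add_0)
  qed
  moreover have "1 + complex_of_real (- 1 / (real n + 1)\<^sup>2) * (\<Sum>i\<in>{0..n}. \<Sum>j\<in>{0..n}. w i x * cnj (w j x)) = of_real (defect n x)" for x
  proof -
    have "(\<Sum>i\<in>{0..n}. \<Sum>j\<in>{0..n}. w i x * cnj (w j x)) = lin n x * cnj (lin n x)"
      unfolding lin_w cnj_sum by (simp add: sum_product)
    also have "\<dots> = of_real ((cmod (lin n x))\<^sup>2)" using complex_norm_square by simp
    finally show ?thesis by (simp add: defect_def)
  qed
  ultimately show ?thesis by simp
qed

text \<open>Among the admissible characters only the trivial one has a nonzero mean, in the sum as
  in the integral; so sampling is exact, not merely asymptotic.\<close>

lemma trig_average:
  assumes "trig n k F" "finite A"
    and "\<And>b. (\<And>i. i \<in> {1..n} \<Longrightarrow> \<bar>b i\<bar> \<le> int k) \<Longrightarrow> \<exists>i\<in>{1..n}. b i \<noteq> 0 \<Longrightarrow>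
      (\<Sum>t\<in>A. torus_char n b (y t)) = 0"
  shows "integrable (torus n) F \<and> (\<Sum>t\<in>A. F (y t)) = of_nat (card A) * (\<integral>x. F x \<partial>torus n)"
  using assms(1,3)
proof induction
  case (character b k a)
  interpret prob_space "torus n" by (rule prob_space_torus)
  show ?case
  proof (cases "\<exists>i\<in>{1..n}. b i \<noteq> 0")
    case True
    then have "(\<Sum>t\<in>A. torus_char n b (y t)) = 0" using character by blast
    then show ?thesis using True integrable_torus_char[of n b]
      by (auto simp: integral_torus_char sum_distrib_left[symmetric])
  next
    case False
    then have "torus_char n b x = 1" for x by (simp add: torus_char_def)
    then show ?thesis by (simp add: prob_space)
  qed
next
  case (plus k F G)
  then show ?case by (simp add: sum.distrib ring_distribs)
qed

lemma defect_average:
  assumes "finite A"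
    and "\<And>b. (\<And>i. i \<in> {1..n} \<Longrightarrow> \<bar>b i\<bar> \<le> int k) \<Longrightarrow> \<exists>i\<in>{1..n}. b i \<noteq> 0 \<Longrightarrow>
      (\<Sum>t\<in>A. torus_char n b (y t)) = 0"
  shows "(\<Sum>t\<in>A. defect n (y t) ^ k) = real (card A) * moment n k"
proof -
  have "(\<Sum>t\<in>A. (of_real (defect n (y t)) :: complex) ^ k) =
      of_nat (card A) * (\<integral>x. of_real (defect n x) ^ k \<partial>torus n)"
    using trig_average[OF trig_power[OF trig_defect] assms] by blast
  also have "(\<integral>x. (of_real (defect n x) :: complex) ^ k \<partial>torus n) = of_real (moment n k)"
    unfolding moment_def of_real_power[symmetric] by (rule integral_complex_of_real)
  finally have "complex_of_real (\<Sum>t\<in>A. defect n (y t) ^ k) = of_real (real (card A) * moment n k)" by simp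
  then show ?thesis by (simp only: of_real_eq_iff)
qed

section \<open>Periods as sampled values on the torus\<close>

context period_setup
begin

text \<open>The coordinates are not reduced modulo 1, since \<open>lin\<close> and the characters
  have period 1 in each of them.\<close>

definition lattice_pt :: "int \<Rightarrow> nat \<Rightarrow> real" where
  "lattice_pt t i = of_int (t * (int g ^ i - 1)) / real p"

lemma cis_lattice_pt: "cis (2 * pi * lattice_pt t i) = e (t * (int g ^ i - 1))"
  by (simp add: lattice_pt_def e_def)

lemma idx_eq: "{1..f - 1} = {1..<f}" using f_ge_3 by auto

lemma norm_lin_lattice: "cmod (lin (f - 1) (lattice_pt t)) = cmod (period t)"
proof -
  have "{..<f} = insert 0 {1..<f}" using f_ge_3 by auto
  then have "period t = e (t * int g ^ 0) + (\<Sum>i\<in>{1..<f}. e (t * int g ^ i))"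
    unfolding period_def by simp
  also have "(\<Sum>i\<in>{1..<f}. e (t * int g ^ i)) = (\<Sum>i\<in>{1..<f}. e t * e (t * (int g ^ i - 1)))"
    by (intro sum.cong refl) (simp add: algebra_simps flip: e_add)
  also have "e (t * int g ^ 0) + \<dots> = e t * lin (f - 1) (lattice_pt t)"
    unfolding lin_def cis_lattice_pt idx_eq by (simp add: ring_distribs sum_distrib_left)
  finally show ?thesis by (simp add: norm_mult)
qed

lemma torus_char_lattice: "torus_char (f - 1) b (lattice_pt t) = e (t * (\<Sum>i\<in>{1..<f}. b i * (int g ^ i - 1)))"
proof -
  have "(\<Sum>i\<in>{1..<f}. of_int (b i) * lattice_pt t i) = of_int (t * (\<Sum>i\<in>{1..<f}. b i * (int g ^ i - 1))) / real p"
    by (simp add: lattice_pt_def sum_distrib_left sum_divide_distrib mult_ac)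
  then show ?thesis unfolding torus_char_def e_def idx_eq by simp
qed

lemma sum_e_zero:
  assumes "\<not> int p dvd S"
  shows "(\<Sum>t\<in>{0..<int p}. e (t * S)) = 0"
proof -
  have "(\<Sum>t\<in>{0..<int p}. e (t * S)) = (\<Sum>t<p. e (int t * S))"
    by (rule sum.reindex_bij_witness[of _ int nat]) auto
  also have "\<dots> = (\<Sum>t<p. e S ^ t)" by (simp add: e_power)
  also have "\<dots> = 0"
    using power_diff_1_eq[of "e S" p] e_pow_p[of S] assms e_eq_1_iff[of S] by simp
  finally show ?thesis .
qed

lemma lattice_average:
  assumes k: "(2 * f * k) ^ (f - 1) < p"
  shows "(\<Sum>t\<in>{0..<int p}. defect (f - 1) (lattice_pt t) ^ k) = real p * moment (f - 1) k"
proof -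
  have "(\<Sum>t\<in>{0..<int p}. defect (f - 1) (lattice_pt t) ^ k) = real (card {0..<int p}) * moment (f - 1) k"
  proof (rule defect_average)
    fix b :: "nat \<Rightarrow> int"
    assume b: "\<And>i. i \<in> {1..f - 1} \<Longrightarrow> \<bar>b i\<bar> \<le> int k" "\<exists>i\<in>{1..f - 1}. b i \<noteq> 0"
    have "\<not> int p dvd (\<Sum>i\<in>{1..<f}. b i * (int g ^ i - 1))"
    proof
      assume "int p dvd (\<Sum>i\<in>{1..<f}. b i * (int g ^ i - 1))"
      then have "p \<le> (2 * f * k) ^ (f - 1)" using relation_lower_bound b unfolding idx_eq by blast
      with k show False by simp
    qed
    then show "(\<Sum>t\<in>{0..<int p}. torus_char (f - 1) b (lattice_pt t)) = 0"
      unfolding torus_char_lattice by (rule sum_e_zero)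
  qed simp
  then show ?thesis by simp
qed

text \<open>r - 2 log|period| is the series in u up to N plus a remainder \<tau>. The head averages
  exactly to moments. The remainder is at most u^N times the full logarithm: outside
  \<open>Bad\<close> this logarithm is O(log p) and u^N averages to a moment; on \<open>Bad\<close>
  it is at most 3 times -log|period|.\<close>

lemma log_period_discrepancy:
  fixes N :: nat
  defines "r \<equiv> ln ((real f)\<^sup>2)"
  assumes N: "N \<ge> 1" "(2 * f * N) ^ (f - 1) < p"
  shows "\<bar>(\<Sum>t\<in>{1..<int p}. 2 * ln (cmod (period t))) / real p - 2 * torus_mean (f - 1)\<bar> \<le>
    r / real p + \<bar>r - 2 * torus_mean (f - 1) - (\<Sum>k<N. moment (f - 1) (Suc k) / real (Suc k))\<bar> +
    (r + 16 * real (f\<^sup>2) * ln (real p)) * moment (f - 1) N +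
    3 * small_log_sum / real p"
proof -
  define n where "n = f - 1"
  have n: "n \<ge> 1" "real n + 1 = real f" using f_ge_3 by (auto simp: n_def)
  have p0: "real p > 0" using p_pos by simp
  have lnp: "ln (real p) \<ge> 0" using p_gt_f f_ge_3 by simp
  have r0: "r \<ge> 0" unfolding r_def using f_ge_3 by simp
  define A where "A = {1..<int p}"
  define Bad where "Bad = {t\<in>A. cmod (period t) < bad_threshold}"
  have fin: "finite A" by (simp add: A_def)
  define u where "u t = defect n (lattice_pt t)" for t
  define lg where "lg t = r - 2 * ln (cmod (period t))" for t
  have nd: "\<not> int p dvd t" if "t \<in> A" for t
    using that zdvd_imp_le[of "int p" t] by (auto simp: A_def)
  have u01: "0 \<le> u t" "u t \<le> 1" for t unfolding u_def by (rule defect_nonneg defect_le_1)+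
  have lin_nz: "lin n (lattice_pt t) \<noteq> 0" if "t \<in> A" for t
    using norm_lin_lattice[of t] period_nonzero[OF nd[OF that]] by (auto simp: n_def)
  have u_lt: "u t < 1" if "t \<in> A" for t unfolding u_def by (rule neg_ln_defect(1)[OF lin_nz[OF that]])
  have lg_eq: "- ln (1 - u t) = lg t" if "t \<in> A" for t
    using neg_ln_defect(2)[OF lin_nz[OF that]] norm_lin_lattice[of t, folded n_def]
    unfolding u_def lg_def r_def n(2) by simp
  define \<tau> where "\<tau> t = lg t - (\<Sum>k<N. u t ^ Suc k / real (Suc k))" for t
  have \<tau>: "0 \<le> \<tau> t" "\<tau> t \<le> u t ^ N * lg t" if "t \<in> A" for t
    using neg_ln_tail_bounds[OF u01(1) u_lt[OF that], of N] unfolding lg_eq[OF that] \<tau>_def by auto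
  \<comment> \<open>Complete character sums include t = 0, where the period is f. There u = 0, so
    for positive powers the sum over t >= 1 is the complete sum.\<close>
  have u_0: "u 0 = 0"
  proof -
    have "lin n (lattice_pt 0) = of_nat f" using n by (simp add: lin_def lattice_pt_def flip: of_nat_Suc)
    then show ?thesis using f_ge_3 by (simp add: u_def defect_def n)
  qed
  have avg: "(\<Sum>t\<in>A. u t ^ k) = real p * moment n k" if k: "k \<ge> 1" "k \<le> N" for k
  proof -
    have "(2 * f * k) ^ (f - 1) \<le> (2 * f * N) ^ (f - 1)" using k by (intro power_mono) auto
    then have "(\<Sum>t\<in>{0..<int p}. u t ^ k) = real p * moment n k"
      unfolding u_def n_def using N by (intro lattice_average) auto
    moreover have "{0..<int p} = insert 0 A" "0 \<notin> A" using p_pos by (auto simp: A_def)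
    ultimately show ?thesis using fin u_0 k by (simp add: power_0_left)
  qed
  define G where "G = (\<Sum>k<N. moment n (Suc k) / real (Suc k))"
  have cardA: "real (card A) = real p - 1" using p_pos by (simp add: A_def of_nat_diff)
  have sum_eq: "(real p - 1) * r - (\<Sum>t\<in>A. 2 * ln (cmod (period t))) = real p * G + (\<Sum>t\<in>A. \<tau> t)"
  proof -
    have "(\<Sum>t\<in>A. lg t) = (\<Sum>t\<in>A. \<Sum>k<N. u t ^ Suc k / real (Suc k)) + (\<Sum>t\<in>A. \<tau> t)"
      by (simp add: \<tau>_def sum_subtractf)
    also have "(\<Sum>t\<in>A. \<Sum>k<N. u t ^ Suc k / real (Suc k)) = (\<Sum>k<N. (\<Sum>t\<in>A. u t ^ Suc k) / real (Suc k))"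
      unfolding sum_divide_distrib by (rule sum.swap)
    also have "\<dots> = (\<Sum>k<N. real p * (moment n (Suc k) / real (Suc k)))"
      by (intro sum.cong refl) (subst avg, auto)
    also have "\<dots> = real p * G" by (simp add: G_def sum_distrib_left)
    finally show ?thesis by (simp add: lg_def sum_subtractf cardA)
  qed
  have \<tau>_sum: "(\<Sum>t\<in>A. \<tau> t) \<le> (r + 16 * real (f\<^sup>2) * ln (real p)) * (real p * moment n N) +
      3 * (\<Sum>t\<in>Bad. - ln (cmod (period t)))"
  proof -
    have thr: "ln bad_threshold = - (8 * real (f\<^sup>2) * ln (real p))"
      using p0 by (simp add: bad_threshold_def ln_div ln_realpow)
    have thr0: "bad_threshold > 0" using p0 by (simp add: bad_threshold_def)
    have each: "\<tau> t \<le> (r + 16 * real (f\<^sup>2) * ln (real p)) * u t ^ N + 3 * (if t \<in> Bad then - ln (cmod (period t)) else 0)"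
      if t: "t \<in> A" for t
    proof -
      have per0: "cmod (period t) > 0" using period_nonzero[OF nd[OF t]] by simp
      have l0: "0 \<le> lg t" unfolding lg_eq[OF t, symmetric] using u01[of t] u_lt[OF t] by simp
      have uN: "0 \<le> u t ^ N" "u t ^ N \<le> 1" using u01[of t] by (auto intro: power_le_one)
      show ?thesis
      proof (cases "t \<in> Bad")
        case True
        then have "ln (cmod (period t)) \<le> ln bad_threshold"
          using per0 thr0 by (subst ln_le_cancel_iff) (auto simp: Bad_def)
        then have b: "8 * real (f\<^sup>2) * ln (real p) \<le> - ln (cmod (period t))" unfolding thr by simp
        have "r = 2 * ln (real f)" unfolding r_def using f_ge_3 by (simp add: ln_realpow)
        also have "\<dots> \<le> 2 * ln (real p)" using p_gt_f f_ge_3 by simp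
        also have "\<dots> \<le> 8 * real (f\<^sup>2) * ln (real p)"
        proof (rule mult_right_mono[OF _ lnp])
          have "1 \<le> real (f\<^sup>2)" using f_ge_3 by (simp add: one_le_power)
          then show "2 \<le> 8 * real (f\<^sup>2)" by linarith
        qed
        \<comment> \<open>This turns r + 2 (-log|period|) into at most 3 times -log|period|, the
          origin of the factor 3.\<close>
        finally have "r \<le> - ln (cmod (period t))" using b by linarith
        then have l3: "lg t \<le> 3 * - ln (cmod (period t))" by (simp add: lg_def)
        have "\<tau> t \<le> u t ^ N * lg t" by (rule \<tau>(2)[OF t])
        also have "\<dots> \<le> 1 * lg t" using uN l0 by (intro mult_right_mono) auto
        finally have "\<tau> t \<le> 3 * - ln (cmod (period t))" using l3 by simp
        moreover have "0 \<le> (r + 16 * real (f\<^sup>2) * ln (real p)) * u t ^ N" using r0 lnp uN by simp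
        ultimately show ?thesis using True by simp
      next
        case False
        from False have "ln bad_threshold \<le> ln (cmod (period t))"
          using t thr0 by (subst ln_le_cancel_iff) (auto simp: Bad_def)
        then have "2 * - (8 * real (f\<^sup>2) * ln (real p)) \<le> 2 * ln (cmod (period t))"
          unfolding thr by (rule mult_left_mono) simp
        then have "lg t \<le> r + 16 * real (f\<^sup>2) * ln (real p)" unfolding lg_def by linarith
        then have "u t ^ N * lg t \<le> u t ^ N * (r + 16 * real (f\<^sup>2) * ln (real p))"
          using uN by (intro mult_left_mono) auto
        then show ?thesis using False \<tau>(2)[OF t] by (simp add: mult.commute)
      qed
    qed
    have "(\<Sum>t\<in>A. \<tau> t) \<le> (\<Sum>t\<in>A. (r + 16 * real (f\<^sup>2) * ln (real p)) * u t ^ N +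
        3 * (if t \<in> Bad then - ln (cmod (period t)) else 0))"
      using each by (intro sum_mono) auto
    also have "\<dots> = (r + 16 * real (f\<^sup>2) * ln (real p)) * (\<Sum>t\<in>A. u t ^ N) +
        3 * (\<Sum>t\<in>A. if t \<in> Bad then - ln (cmod (period t)) else 0)"
      unfolding sum.distrib sum_distrib_left by simp
    also have "(\<Sum>t\<in>A. if t \<in> Bad then - ln (cmod (period t)) else 0) = (\<Sum>t\<in>Bad. - ln (cmod (period t)))"
      by (rule sum.mono_neutral_cong_right[OF fin]) (auto simp: Bad_def)
    finally show ?thesis using avg[of N] N by simp
  qed
  have \<tau>0: "0 \<le> (\<Sum>t\<in>A. \<tau> t)" using \<tau>(1) by (intro sum_nonneg) auto
  have "(\<Sum>t\<in>A. 2 * ln (cmod (period t))) = (real p - 1) * r - real p * G - (\<Sum>t\<in>A. \<tau> t)" using sum_eq by simp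
  then have "(\<Sum>t\<in>A. 2 * ln (cmod (period t))) / real p - 2 * torus_mean n =
      (r - 2 * torus_mean n - G) - r / real p - (\<Sum>t\<in>A. \<tau> t) / real p"
    using p0 by (simp only:) (simp add: diff_divide_distrib left_diff_distrib)
  moreover have "0 \<le> r / real p" "0 \<le> (\<Sum>t\<in>A. \<tau> t) / real p" using r0 \<tau>0 p0 by auto
  ultimately have "\<bar>(\<Sum>t\<in>A. 2 * ln (cmod (period t))) / real p - 2 * torus_mean n\<bar> \<le>
      r / real p + \<bar>r - 2 * torus_mean n - G\<bar> + (\<Sum>t\<in>A. \<tau> t) / real p" by linarith
  moreover have "(\<Sum>t\<in>A. \<tau> t) / real p \<le> (r + 16 * real (f\<^sup>2) * ln (real p)) * moment n N +
      3 * (\<Sum>t\<in>Bad. - ln (cmod (period t))) / real p"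
  proof -
    have "(\<Sum>t\<in>A. \<tau> t) / real p \<le> ((r + 16 * real (f\<^sup>2) * ln (real p)) * (real p * moment n N) +
      3 * (\<Sum>t\<in>Bad. - ln (cmod (period t)))) / real p"
      using \<tau>_sum p0 by (intro divide_right_mono) auto
    also have "\<dots> = (r + 16 * real (f\<^sup>2) * ln (real p)) * moment n N +
      3 * (\<Sum>t\<in>Bad. - ln (cmod (period t))) / real p"
      using p0 by (simp add: add_divide_distrib)
    finally show ?thesis .
  qed
  ultimately show ?thesis unfolding A_def Bad_def G_def n_def by linarith
qed

end

section \<open>Truncation point and final exponent\<close>

lemma ln_times_powr_le:
  fixes x s \<kappa> :: real
  assumes "x \<ge> 1" "\<kappa> < s"
  shows "ln x * x powr (- s) \<le> 1 / (s - \<kappa>) * x powr (- \<kappa>)"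
proof -
  have "ln x * x powr (- s) \<le> (x powr (s - \<kappa>) / (s - \<kappa>)) * x powr (- s)"
    using assms by (intro mult_right_mono ln_powr_bound) auto
  also have "\<dots> = 1 / (s - \<kappa>) * (x powr (s - \<kappa>) * x powr (- s))" by simp
  also have "x powr (s - \<kappa>) * x powr (- s) = x powr (- \<kappa>)" by (simp flip: powr_add)
  finally show ?thesis .
qed

lemma log_period_asymptotic:
  assumes f: "prime f" "odd f"
  obtains C p0 where "\<And>p g. period_setup f p g \<Longrightarrow> p \<ge> p0 \<Longrightarrow>
    \<bar>(\<Sum>t\<in>{1..<int p}. 2 * ln (cmod (period_setup.period f p g t))) / real p - 2 * torus_mean (f - 1)\<bar>
      \<le> C * real p powr (- 1 / (5 * (real f - 1)\<^sup>2))"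
proof -
  have f3: "f \<ge> 3" using prime_ge_2_nat[OF f(1)] f(2) by (cases "f = 2") auto
  define d where "d = real f - 1"
  have d: "d \<ge> 2" "real (f - 1) = d" "real (f - 2) = d - 1" "real f = d + 1" using f3 by (auto simp: d_def)
  define \<kappa> where "\<kappa> = 1 / (5 * d\<^sup>2)"
  define \<gamma> where "\<gamma> = 1 / (d * (d - 1))"
  define r where "r = ln ((real f)\<^sup>2)"
  have n1: "f - 1 \<ge> 1" using f3 by simp
  have r0: "r \<ge> 0" unfolding r_def using f3 by simp
  \<comment> \<open>The inequality is strict for the exponents \<gamma> and 1/(3d), which carry a
    factor log p to be absorbed. The comparison with 1/(6d) amounts to 6 <= 5 d and uses d >=
    2.\<close>
  have \<kappa>: "0 < \<kappa>" "\<kappa> \<le> 1" "\<kappa> < \<gamma>" "\<kappa> < 1 / (3 * d)" "\<kappa> \<le> 1 / (6 * d)"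
  proof -
    have dd: "2 * d \<le> d\<^sup>2" using d unfolding power2_eq_square by (intro mult_right_mono) auto
    show "0 < \<kappa>" using d by (simp add: \<kappa>_def)
    show "\<kappa> \<le> 1" using d dd by (simp add: \<kappa>_def divide_le_eq)
    have "d * (d - 1) = d\<^sup>2 - d" by (simp add: power2_eq_square algebra_simps)
    then have "d * (d - 1) < 5 * d\<^sup>2" using d dd by linarith
    then show "\<kappa> < \<gamma>" using d unfolding \<kappa>_def \<gamma>_def by (intro divide_strict_left_mono) auto
    have "3 * d < 5 * d\<^sup>2" "6 * d \<le> 5 * d\<^sup>2" using d dd by linarith+
    then show "\<kappa> < 1 / (3 * d)" "\<kappa> \<le> 1 / (6 * d)"
      using d unfolding \<kappa>_def by (auto intro!: divide_strict_left_mono divide_left_mono)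
  qed
  obtain C0 p0 where bad: "\<And>p g. period_setup f p g \<Longrightarrow> p \<ge> p0 \<Longrightarrow>
    period_setup.small_log_sum f p g
      \<le> C0 * real p powr (1 - 1 / (real (f - 1) * real (f - 2))) * ln (real p)"
    by (rule period_bad_sum_asymptotic[OF f]) blast
  obtain C1 where tail: "\<And>N. N \<ge> 1 \<Longrightarrow>
    \<bar>ln ((real (f - 1) + 1)\<^sup>2) - 2 * torus_mean (f - 1) - (\<Sum>k<N. moment (f - 1) (Suc k) / real (Suc k))\<bar>
      \<le> C1 * real N powr (- 1 / 6)"
    by (rule moment_tail_bound[OF n1]) blast
  define C2 where "C2 = 4 + (real f)\<^sup>2"
  have C20: "C2 \<ge> 0" by (simp add: C2_def)
  \<comment> \<open>Twice the denominator 4 f of \<open>Y\<close> below: once Y >= 2, the rounded N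
    is at least Y/2.\<close>
  define b where "b = 8 * real f"
  have b0: "b > 0" using f3 by (simp add: b_def)
  define C where "C = r + \<bar>C1\<bar> * b powr (1 / 6) +
    C2 * b powr (1 / 3) * (r + 16 * real (f\<^sup>2) * (1 / (1 / (3 * d) - \<kappa>))) + 3 * \<bar>C0\<bar> * (1 / (\<gamma> - \<kappa>))"
  have "\<forall>\<^sub>F n in at_top. b \<le> real n powr (1 / d) \<and> n \<ge> p0"
    using d by (intro eventually_conj eventually_powr_ge eventually_ge_at_top) auto
  then obtain p1 where p1: "\<And>n. n \<ge> p1 \<Longrightarrow> b \<le> real n powr (1 / d) \<and> n \<ge> p0"
    by (auto simp: eventually_at_top_linorder)
  show ?thesis
  proof (rule that[of p1 C])
    fix p g assume set: "period_setup f p g" and p: "p \<ge> p1"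
    interpret period_setup f p g by (rule set)
    define x where "x = real p"
    have x: "x \<ge> 1" using p_pos by (simp add: x_def)
    have xb: "b \<le> x powr (1 / d)" using p1[OF p] by (simp add: x_def)
    \<comment> \<open>The denominator is twice the critical value 2 f, which makes (2 f N)^(f-1) < p
      strict.\<close>
    define Y where "Y = x powr (1 / d) / (4 * real f)"
    define N where "N = nat \<lfloor>Y\<rfloor>"
    have Y: "Y \<ge> 2" using xb f3 by (simp add: Y_def b_def le_divide_eq)
    then have "real N = of_int \<lfloor>Y\<rfloor>" by (simp add: N_def)
    then have N: "real N \<le> Y" "Y / 2 \<le> real N" "real N \<ge> 1" using Y by linarith+
    note N1 = N(3)
    have N_le: "real N \<le> x powr (1 / d) / (4 * real f)" using N(1) by (simp add: Y_def)
    have N_ge: "x powr (1 / d) / b \<le> real N" using N(2) by (simp add: Y_def b_def)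
    have Np: "(2 * f * N) ^ (f - 1) < p"
    proof -
      have "2 * real f * real N \<le> x powr (1 / d) / 2" using N_le f3 by (simp add: field_simps)
      then have "(2 * real f * real N) ^ (f - 1) \<le> (x powr (1 / d) / 2) ^ (f - 1)" by (intro power_mono) auto
      also have "\<dots> < (x powr (1 / d)) ^ (f - 1)" using x f3 by (intro power_strict_mono) auto
      also have "\<dots> = x powr (1 / d * real (f - 1))" using x by (simp add: powr_powr flip: powr_realpow)
      also have "\<dots> = x" using x d by simp
      finally have "real ((2 * f * N) ^ (f - 1)) < real p" by (simp add: x_def)
      then show ?thesis by (simp only: of_nat_less_iff)
    qed
    have Npow: "real N powr (- s) \<le> b powr s * x powr (- (s / d))" if "s > 0" for s
    proof -
      have "real N powr (- s) \<le> (x powr (1 / d) / b) powr (- s)"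
        using that N_ge x b0 by (intro powr_mono2') auto
      also have "\<dots> = b powr s * x powr (- (s / d))"
        using x b0 by (simp add: powr_divide powr_powr powr_minus field_simps)
      finally show ?thesis .
    qed
    have "\<bar>(\<Sum>t\<in>{1..<int p}. 2 * ln (cmod (period t))) / real p - 2 * torus_mean (f - 1)\<bar> \<le>
      r / x + \<bar>r - 2 * torus_mean (f - 1) - (\<Sum>k<N. moment (f - 1) (Suc k) / real (Suc k))\<bar> +
      (r + 16 * real (f\<^sup>2) * ln x) * moment (f - 1) N +
      3 * small_log_sum / x"
      unfolding r_def x_def using N1 by (intro log_period_discrepancy Np) auto
    also have "\<dots> \<le> r * x powr (- \<kappa>) + \<bar>C1\<bar> * b powr (1 / 6) * x powr (- \<kappa>) +
      C2 * b powr (1 / 3) * (r + 16 * real (f\<^sup>2) * (1 / (1 / (3 * d) - \<kappa>))) * x powr (- \<kappa>) +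
      3 * \<bar>C0\<bar> * (1 / (\<gamma> - \<kappa>)) * x powr (- \<kappa>)"
    proof (intro add_mono)
      have "x powr (- 1) \<le> x powr (- \<kappa>)" using x \<kappa> by (intro powr_mono) auto
      then have "r * x powr (- 1) \<le> r * x powr (- \<kappa>)" using r0 by (intro mult_left_mono) auto
      then show "r / x \<le> r * x powr (- \<kappa>)" using x by (simp add: powr_minus divide_inverse)
      have "\<bar>r - 2 * torus_mean (f - 1) - (\<Sum>k<N. moment (f - 1) (Suc k) / real (Suc k))\<bar> \<le> C1 * real N powr (- 1 / 6)"
        using tail[of N] N1 d by (simp add: r_def add.commute)
      also have "\<dots> \<le> \<bar>C1\<bar> * (b powr (1 / 6) * x powr (- (1 / 6 / d)))"
        using Npow[of "1 / 6"] by (intro mult_mono) auto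
      also have "\<dots> \<le> \<bar>C1\<bar> * (b powr (1 / 6) * x powr (- \<kappa>))"
        using x \<kappa> by (intro mult_left_mono powr_mono) auto
      finally show "\<bar>r - 2 * torus_mean (f - 1) - (\<Sum>k<N. moment (f - 1) (Suc k) / real (Suc k))\<bar> \<le>
        \<bar>C1\<bar> * b powr (1 / 6) * x powr (- \<kappa>)" by (simp add: mult.assoc)
      have lnx: "0 \<le> ln x" using x by simp
      have "moment (f - 1) N \<le> C2 * real N powr (- 1 / 3)"
        using moment_bound[OF n1, of N] N1 d by (simp add: C2_def add.commute)
      also have "\<dots> \<le> C2 * (b powr (1 / 3) * x powr (- (1 / 3 / d)))"
        using Npow[of "1 / 3"] C20 by (intro mult_left_mono) auto
      finally have "(r + 16 * real (f\<^sup>2) * ln x) * moment (f - 1) N \<le>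
          (r + 16 * real (f\<^sup>2) * ln x) * (C2 * (b powr (1 / 3) * x powr (- (1 / 3 / d))))"
        using r0 lnx by (intro mult_left_mono) auto
      also have "\<dots> = C2 * b powr (1 / 3) * (r * x powr (- (1 / (3 * d))) + 16 * real (f\<^sup>2) * (ln x * x powr (- (1 / (3 * d)))))"
        by (simp add: algebra_simps)
      also have "\<dots> \<le> C2 * b powr (1 / 3) * (r * x powr (- \<kappa>) + 16 * real (f\<^sup>2) * (1 / (1 / (3 * d) - \<kappa>) * x powr (- \<kappa>)))"
        using x \<kappa> r0 C20 by (intro mult_left_mono add_mono powr_mono ln_times_powr_le) auto
      also have "\<dots> = C2 * b powr (1 / 3) * (r + 16 * real (f\<^sup>2) * (1 / (1 / (3 * d) - \<kappa>))) * x powr (- \<kappa>)"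
        by (simp add: ring_distribs)
      finally show "(r + 16 * real (f\<^sup>2) * ln x) * moment (f - 1) N \<le>
        C2 * b powr (1 / 3) * (r + 16 * real (f\<^sup>2) * (1 / (1 / (3 * d) - \<kappa>))) * x powr (- \<kappa>)" .
      have "small_log_sum \<le> C0 * x powr (1 - \<gamma>) * ln x"
        using bad[OF set] p1[OF p] unfolding d(2,3) \<gamma>_def x_def by blast
      also have "\<dots> \<le> \<bar>C0\<bar> * x powr (1 - \<gamma>) * ln x" using lnx by (intro mult_right_mono) auto
      finally have "3 * small_log_sum / x \<le>
          3 * (\<bar>C0\<bar> * x powr (1 - \<gamma>) * ln x) / x" using x by (intro divide_right_mono mult_left_mono) auto
      also have "\<dots> = 3 * \<bar>C0\<bar> * (ln x * x powr (- \<gamma>))" using x by (simp add: powr_diff powr_minus field_simps)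
      also have "\<dots> \<le> 3 * \<bar>C0\<bar> * (1 / (\<gamma> - \<kappa>) * x powr (- \<kappa>))"
        using x \<kappa> by (intro mult_left_mono ln_times_powr_le) auto
      finally show "3 * small_log_sum / x \<le>
        3 * \<bar>C0\<bar> * (1 / (\<gamma> - \<kappa>)) * x powr (- \<kappa>)" by (simp add: mult.assoc)
    qed
    also have "\<dots> = C * x powr (- \<kappa>)" by (simp add: C_def ring_distribs)
    also have "- \<kappa> = - 1 / (5 * (real f - 1)\<^sup>2)" by (simp add: \<kappa>_def d_def)
    finally show "\<bar>(\<Sum>t\<in>{1..<int p}. 2 * ln (cmod (period t))) / real p - 2 * torus_mean (f - 1)\<bar> \<le>
      C * real p powr (- 1 / (5 * (real f - 1)\<^sup>2))" by (simp add: x_def)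
  qed
qed

subsection \<open>The subgroup of order f\<close>

text \<open>As f is prime, any h other than 1 in the subgroup generates it: its first f powers are
  distinct and lie in the subgroup, which has f elements.\<close>

lemma order_subgroup_generator:
  assumes f: "prime f" "odd f" and p: "prime p" "[p = 1] (mod f)"
  obtains g where "period_setup f p g" "inj_on (\<lambda>i. int (g ^ i mod p)) {..<f}"
    "order_subgroup f p = (\<lambda>i. int (g ^ i mod p)) ` {..<f}"
proof -
  interpret R: residues_prime p "residue_ring (int p)"
    by (simp add: residues_prime_def p)
  let ?R = "residue_ring (int p)"
  let ?G = "mult_of ?R"
  interpret G: group ?G by (rule R.field_mult_group)
  define H where "H = order_subgroup f p"
  have H: "subgroup H ?G" "card H = f"
    using order_subgroup[OF p] unfolding H_def R.mult_of_is_Units by auto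
  have p1: "p > 1" using p(1) by (rule prime_gt_1_nat)
  have carr: "H \<subseteq> {0..int p - 1}"
    using subgroup.subset[OF H(1)] by (auto simp: R.res_carrier_eq)
  have one: "1 \<in> H"
    using subgroup.one_closed[OF H(1)] p1 by (simp add: R.res_one_eq)
  have mult: "(x * y) mod int p \<in> H" if "x \<in> H" "y \<in> H" for x y
    using subgroup.m_closed[OF H(1) that] by (simp add: R.res_mult_eq)
  have "\<not> H \<subseteq> {1}"
  proof
    assume "H \<subseteq> {1}"
    then have "card H \<le> 1" using card_mono[of "{1::int}" H] by simp
    then show False using H(2) prime_gt_1_nat[OF f(1)] by simp
  qed
  then obtain h where h: "h \<in> H" "h \<noteq> 1" by blast
  define g where "g = nat h"
  have "0 \<le> h" "h \<le> int p - 1" using carr h(1) by auto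
  then have hg: "h = int g" "g < p" using p1 by (auto simp: g_def)
  have pow_in: "int (g ^ i mod p) \<in> H" for i
  proof (induction i)
    case 0
    then show ?case using one p1 by simp
  next
    case (Suc i)
    have "int (g ^ Suc i mod p) = (int (g ^ i mod p) * h) mod int p"
      unfolding hg by (simp add: zmod_int mod_mult_right_eq mult.commute)
    then show ?case using mult[OF Suc h(1)] by simp
  qed
  have "h [^]\<^bsub>?G\<^esub> f = \<one>\<^bsub>?G\<^esub>"
  proof -
    interpret HG: group "?G\<lparr>carrier := H\<rparr>"
      using H(1) G.is_group by (rule subgroup.subgroup_is_group)
    have "h [^]\<^bsub>?G\<lparr>carrier := H\<rparr>\<^esub> Coset.order (?G\<lparr>carrier := H\<rparr>) = \<one>\<^bsub>?G\<lparr>carrier := H\<rparr>\<^esub>"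
      using h by (intro HG.pow_order_eq_1) simp
    then show ?thesis using H(2) G.nat_pow_consistent[of h f H] by (simp add: Coset.order_def)
  qed
  then have "(h mod int p) [^]\<^bsub>?R\<^esub> f = 1 mod int p"
    using hg p1 by (simp add: nat_pow_mult_of R.res_one_eq)
  then have "h ^ f mod int p = 1 mod int p" by (simp only: R.pow_cong)
  then have "[int (g ^ f) = int 1] (mod int p)" by (simp add: cong_def hg)
  then have "[g ^ f = 1] (mod p)" by (simp only: cong_int_iff)
  moreover have "\<not> [g = 1] (mod p)" using hg h(2) p1 by (auto simp: cong_def)
  ultimately have set: "period_setup f p g" using f p by unfold_locales
  then interpret period_setup f p g .
  have inj: "inj_on (\<lambda>i. int (g ^ i mod p)) {..<f}"
  proof (rule inj_onI)
    fix i j assume "i \<in> {..<f}" "j \<in> {..<f}" "int (g ^ i mod p) = int (g ^ j mod p)"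
    then show "i = j" using g_pow_cong_iff[of i j] by (simp add: cong_def)
  qed
  have "(\<lambda>i. int (g ^ i mod p)) ` {..<f} = H"
  proof (rule card_subset_eq)
    show "finite H" using carr by (rule finite_subset) simp
    show "(\<lambda>i. int (g ^ i mod p)) ` {..<f} \<subseteq> H" using pow_in by auto
    show "card ((\<lambda>i. int (g ^ i mod p)) ` {..<f}) = card H" using card_image[OF inj] H(2) by simp
  qed
  then show ?thesis using set inj by (intro that[of g]) (auto simp: H_def)
qed

lemma gaussian_period_eq:
  assumes "period_setup f p g" "inj_on (\<lambda>i. int (g ^ i mod p)) {..<f}"
    "order_subgroup f p = (\<lambda>i. int (g ^ i mod p)) ` {..<f}"
  shows "gaussian_period f p t = period_setup.period f p g (int t)"
proof -
  interpret period_setup f p g by fact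
  have e_exp: "exp (2 * complex_of_real pi * \<i> * of_nat t * of_int x / of_nat p) = e (int t * x)" for x
    by (simp add: e_def cis_conv_exp mult_ac)
  have "gaussian_period f p t = (\<Sum>i<f. e (int t * int (g ^ i mod p)))"
    unfolding gaussian_period_def e_exp assms(3) using assms(2) by (simp add: sum.reindex)
  also have "\<dots> = period (int t)"
    unfolding period_def
    by (intro sum.cong refl e_cong cong_mult cong_refl) (simp add: cong_def zmod_int)
  finally show ?thesis .
qed

section \<open>Normalisation by p - 1 and the asymptotic formula\<close>

lemma mean_log_gaussian_period:
  assumes f: "prime f" "odd f"
  obtains C p0 where "\<And>p. prime p \<Longrightarrow> [p = 1] (mod f) \<Longrightarrow> p \<ge> p0 \<Longrightarrow>
    \<bar>1 / (real p - 1) * (\<Sum>t = 1..p - 1. ln (cmod (gaussian_period f p t))) - torus_mean (f - 1)\<bar>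
      \<le> C * real p powr (- 1 / (5 * (real f - 1)\<^sup>2))"
proof -
  define m where "m = torus_mean (f - 1)"
  define \<kappa> where "\<kappa> = 1 / (5 * (real f - 1)\<^sup>2)"
  have \<kappa>: "- 1 / (5 * (real f - 1)\<^sup>2) = - \<kappa>" by (simp add: \<kappa>_def)
  have \<kappa>1: "\<kappa> \<le> 1"
  proof -
    have "real f - 1 \<ge> 1" using prime_ge_2_nat[OF f(1)] by simp
    then have "1 \<le> (real f - 1)\<^sup>2" by (simp add: one_le_power)
    then show ?thesis by (simp add: \<kappa>_def divide_le_eq)
  qed
  obtain C p0 where C: "\<And>p g. period_setup f p g \<Longrightarrow> p \<ge> p0 \<Longrightarrow>
    \<bar>(\<Sum>t\<in>{1..<int p}. 2 * ln (cmod (period_setup.period f p g t))) / real p - 2 * m\<bar>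
      \<le> C * real p powr (- \<kappa>)"
    unfolding m_def \<kappa>[symmetric] by (rule log_period_asymptotic[OF f]) blast
  show ?thesis
  proof (rule that[of p0 "C + 2 * \<bar>m\<bar>"])
    fix p assume p: "prime p" "[p = 1] (mod f)" "p \<ge> p0"
    obtain g where g: "period_setup f p g" "inj_on (\<lambda>i. int (g ^ i mod p)) {..<f}"
      "order_subgroup f p = (\<lambda>i. int (g ^ i mod p)) ` {..<f}"
      using order_subgroup_generator[OF f p(1,2)] by blast
    interpret period_setup f p g by (rule g)
    define x where "x = real p"
    have x: "x \<ge> 2" using prime_ge_2_nat[OF p(1)] by (simp add: x_def)
    define S where "S = (\<Sum>t\<in>{1..<int p}. ln (cmod (period t)))"
    have S_eq: "(\<Sum>t = 1..p - 1. ln (cmod (gaussian_period f p t))) = S"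
      unfolding S_def gaussian_period_eq[OF g]
      by (rule sum.reindex_bij_witness[of _ nat int]) auto
    have eq: "(\<Sum>t\<in>{1..<int p}. 2 * ln (cmod (period t))) / real p - 2 * m = 2 * (S / x - m)"
      by (simp add: S_def x_def right_diff_distrib flip: sum_distrib_left)
    have "\<bar>2 * (S / x - m)\<bar> \<le> C * x powr (- \<kappa>)"
      unfolding eq[symmetric] unfolding x_def by (rule C[OF g(1) p(3)])
    then have B: "2 * \<bar>S / x - m\<bar> \<le> C * x powr (- \<kappa>)" by (simp only: abs_mult abs_numeral)
    \<comment> \<open>Replacing 1/p by 1/(p-1) costs m/(p-1), which is O(x^(-\<kappa>)) as \<kappa>
      <= 1; the factor x/(x-1) is at most 2.\<close>
    have "1 / (x - 1) * S - m = x / (x - 1) * (S / x - m) + m / (x - 1)"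
    proof -
      have "x / (x - 1) * (S / x - m) + m / (x - 1) = S / (x - 1) - (x * m - m) / (x - 1)"
        using x by (simp add: right_diff_distrib diff_divide_distrib)
      also have "(x * m - m) / (x - 1) = m"
      proof -
        have "x * m - m = m * (x - 1)" by (simp add: algebra_simps)
        then show ?thesis using x by simp
      qed
      finally show ?thesis by simp
    qed
    then have "\<bar>1 / (x - 1) * S - m\<bar> \<le> \<bar>x / (x - 1) * (S / x - m)\<bar> + \<bar>m / (x - 1)\<bar>"
      by (simp only: abs_triangle_ineq)
    also have "\<bar>x / (x - 1) * (S / x - m)\<bar> \<le> 2 * \<bar>S / x - m\<bar>"
      unfolding abs_mult using x by (intro mult_right_mono) (auto simp: divide_le_eq)
    also have "\<bar>m / (x - 1)\<bar> \<le> 2 * \<bar>m\<bar> * x powr (- \<kappa>)"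
    proof -
      have "1 / (x - 1) \<le> 2 / x" using x by (simp add: field_simps)
      also have "\<dots> = 2 * x powr (- 1)" using x by (simp add: powr_minus divide_inverse)
      also have "\<dots> \<le> 2 * x powr (- \<kappa>)" using x \<kappa>1 by (intro mult_left_mono powr_mono) auto
      finally have "\<bar>m\<bar> * (1 / (x - 1)) \<le> \<bar>m\<bar> * (2 * x powr (- \<kappa>))" by (intro mult_left_mono) auto
      then show ?thesis using x by (simp add: abs_mult mult_ac)
    qed
    finally have "\<bar>1 / (x - 1) * S - m\<bar> \<le> 2 * \<bar>S / x - m\<bar> + 2 * \<bar>m\<bar> * x powr (- \<kappa>)" by simp
    also have "\<dots> \<le> C * x powr (- \<kappa>) + 2 * \<bar>m\<bar> * x powr (- \<kappa>)" using B by simp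
    also have "\<dots> = (C + 2 * \<bar>m\<bar>) * x powr (- \<kappa>)" by (simp add: algebra_simps)
    finally show "\<bar>1 / (real p - 1) * (\<Sum>t = 1..p - 1. ln (cmod (gaussian_period f p t))) - torus_mean (f - 1)\<bar>
      \<le> (C + 2 * \<bar>m\<bar>) * real p powr (- 1 / (5 * (real f - 1)\<^sup>2))"
      unfolding S_eq \<kappa> x_def m_def .
  qed
qed

theorem theorem1p1:
  fixes f :: nat
  assumes "prime f" and "odd f"
  shows "(\<forall>\<^sub>F p in at_top_primes_1_mod f. \<forall>t\<in>{1..p - 1}. gaussian_period f p t \<noteq> 0) \<and>
    (\<lambda>p. 1 / (real p - 1) * (\<Sum>t = 1..p - 1. ln (cmod (gaussian_period f p t)))
           - log_mahler (f - 1) (1 + (\<Sum>i = 1..f - 1. lvar i)))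
      \<in> O[at_top_primes_1_mod f](\<lambda>p. real p powr (- 1 / (5 * (real f - 1)\<^sup>2)))"
proof
  have "gaussian_period f p t \<noteq> 0" if p: "prime p" "[p = 1] (mod f)" and t: "t \<in> {1..p - 1}" for p t
  proof -
    obtain g where g: "period_setup f p g" "inj_on (\<lambda>i. int (g ^ i mod p)) {..<f}"
      "order_subgroup f p = (\<lambda>i. int (g ^ i mod p)) ` {..<f}"
      using order_subgroup_generator[OF assms p] by blast
    have "\<not> p dvd t" using t by (auto dest: dvd_imp_le)
    then have "\<not> int p dvd int t" by simp
    then show ?thesis
      unfolding gaussian_period_eq[OF g] by (rule period_setup.period_nonzero[OF g(1)])
  qed
  then show "\<forall>\<^sub>F p in at_top_primes_1_mod f. \<forall>t\<in>{1..p - 1}. gaussian_period f p t \<noteq> 0"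
    unfolding at_top_primes_1_mod_def eventually_inf_principal by (intro always_eventually) auto
  have mahler: "log_mahler (f - 1) (1 + (\<Sum>i = 1..f - 1. lvar i)) = torus_mean (f - 1)"
    unfolding torus_mean_def by (rule log_mahler_eq)
  obtain C p0 where C: "\<And>p. prime p \<Longrightarrow> [p = 1] (mod f) \<Longrightarrow> p \<ge> p0 \<Longrightarrow>
    \<bar>1 / (real p - 1) * (\<Sum>t = 1..p - 1. ln (cmod (gaussian_period f p t))) - torus_mean (f - 1)\<bar>
      \<le> C * real p powr (- 1 / (5 * (real f - 1)\<^sup>2))"
    by (rule mean_log_gaussian_period[OF assms]) blast
  show "(\<lambda>p. 1 / (real p - 1) * (\<Sum>t = 1..p - 1. ln (cmod (gaussian_period f p t)))
           - log_mahler (f - 1) (1 + (\<Sum>i = 1..f - 1. lvar i)))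
      \<in> O[at_top_primes_1_mod f](\<lambda>p. real p powr (- 1 / (5 * (real f - 1)\<^sup>2)))"
    unfolding mahler
  proof (rule bigoI[where c = C])
    show "\<forall>\<^sub>F p in at_top_primes_1_mod f.
      norm (1 / (real p - 1) * (\<Sum>t = 1..p - 1. ln (cmod (gaussian_period f p t))) - torus_mean (f - 1))
      \<le> C * norm (real p powr (- 1 / (5 * (real f - 1)\<^sup>2)))"
      unfolding at_top_primes_1_mod_def eventually_inf_principal
      using eventually_ge_at_top[of p0]
    proof eventually_elim
      case (elim p)
      then show ?case using C[of p] by auto
    qed
  qed
qed

end
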